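(* The fundamental group of an oriented graph of CSA$^\ast$-groups (i.e. one in which all vertex groups are CSA$^\ast$-groups) is again a CSA$^\ast$-group in each of the following two situations: (1) the underlying oriented graph is $L_\alpha$ for some ordinal $\alpha$, and the oriented graph of groups is quasi-malnormal; (2) the underlying oriented graph is a tree and the graph of groups is malnormal.
   Context: A subgroup $H$ of a group $G$ is malnormal if $H\cap x^{-1}Hx=1$ for all $x\in G\setminus H$; the malnormal closure of a subgroup is the intersection of all malnormal subgroups containing it. A group is a CSA-group if all its maximal abelian subgroups are malnormal. A CSA$^\ast$-group is a CSA-group without elements of order 2. An oriented graph of groups consists of an oriented graph $\Gamma=(V,E,\bar\iota,\bar\tau)$ (where $\bar\iota(e),\bar\tau(e)\in V$ are the initial and terminal vertices of $e\in E$) together with a function $G$ assigning to each vertex $v\in V$ a group $G(v)$ and to each edge $e\in E$ a subgroup $G(e)$ of $G(\bar\iota(e))$ and a monomorphism $t_e:G(e)\to G(\bar\tau(e))$. It is quasi-malnormal if for every $e\in E$, $G(e)$ is malnormal in $G(\bar\iota(e))$ and $t_e(G(e))$ is normal in its malnormal closure in $G(\bar\tau(e))$. It is malnormal if in addition, for every $e\in E$, $t_e(G(e))$ is malnormal in $G(\bar\tau(e))$. For an ordinal $\alpha$, $L_\alpha$ is the oriented graph whose vertices are the ordinals $\beta$ with $1\le\beta\le\alpha$, and whose edges are the pairs $(\beta,\beta+1)$ with $1\le\beta$ and $\beta+1\le\alpha$; the edge $(\beta,\beta+1)$ has initial vertex $\beta$ and terminal vertex $\beta+1$. For the graphs considered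 here (trees, and the graphs $L_\alpha$, which are disjoint unions of trees), the fundamental group is the quotient of the free product of all vertex groups $G(v)$, $v\in V$, by the relations $g=t_e(g)$ for all $e\in E$, $g\in G(e)$ (so for a disconnected graph it is the free product of the fundamental groups of the components). *)

theory Defs
  imports "HOL-Algebra.Multiplicative_Group" "Graph_Theory.Graph_Theory"
begin

definition malnormal :: "'a set \<Rightarrow> ('a, 'b) monoid_scheme \<Rightarrow> bool" where
  "malnormal H G \<longleftrightarrow> subgroup H G \<and>
     (\<forall>x \<in> carrier G - H. H \<inter> (inv\<^bsub>G\<^esub> x <#\<^bsub>G\<^esub> H #>\<^bsub>G\<^esub> x) = {\<one>\<^bsub>G\<^esub>})"

definition malnormal_closure :: "('a, 'b) monoid_scheme \<Rightarrow> 'a set \<Rightarrow> 'a set" where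
  "malnormal_closure G K = \<Inter> {M. malnormal M G \<and> K \<subseteq> M}"

definition abelian_subgroup :: "'a set \<Rightarrow> ('a, 'b) monoid_scheme \<Rightarrow> bool" where
  "abelian_subgroup A G \<longleftrightarrow> subgroup A G \<and> comm_group (G\<lparr>carrier := A\<rparr>)"

definition maximal_abelian_subgroup :: "'a set \<Rightarrow> ('a, 'b) monoid_scheme \<Rightarrow> bool" where
  "maximal_abelian_subgroup A G \<longleftrightarrow>
     abelian_subgroup A G \<and> (\<forall>B. abelian_subgroup B G \<and> A \<subseteq> B \<longrightarrow> B = A)"

definition csa_group :: "('a, 'b) monoid_scheme \<Rightarrow> bool" where
  "csa_group G \<longleftrightarrow> group G \<and> (\<forall>A. maximal_abelian_subgroup A G \<longrightarrow> malnormal A G)"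

definition csa_star_group :: "('a, 'b) monoid_scheme \<Rightarrow> bool" where
  "csa_star_group G \<longleftrightarrow> csa_group G \<and> \<not> (\<exists>x \<in> carrier G. group.ord G x = 2)"

text \<open>
  The free product is presented by words in letters \<open>(i, x)\<close> with \<open>x \<in> carrier (G i)\<close>, modulo
  the congruence generated by multiplying adjacent letters of the same factor and deleting
  units.  All vertex groups share one element type, but their carriers need not be disjoint.
\<close>

definition fp_words :: "'i set \<Rightarrow> ('i \<Rightarrow> 'g monoid) \<Rightarrow> ('i \<times> 'g) list set" where
  "fp_words I G = lists (SIGMA i:I. carrier (G i))"

inductive_set fp_rel :: "'i set \<Rightarrow> ('i \<Rightarrow> 'g monoid) \<Rightarrow> (('i \<times> 'g) list \<times> ('i \<times> 'g) list) set"
  for I :: "'i set" and G :: "'i \<Rightarrow> 'g monoid" where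
  refl: "w \<in> fp_words I G \<Longrightarrow> (w, w) \<in> fp_rel I G"
| sym: "(u, w) \<in> fp_rel I G \<Longrightarrow> (w, u) \<in> fp_rel I G"
| trans: "(u, v) \<in> fp_rel I G \<Longrightarrow> (v, w) \<in> fp_rel I G \<Longrightarrow> (u, w) \<in> fp_rel I G"
| mult: "u \<in> fp_words I G \<Longrightarrow> w \<in> fp_words I G \<Longrightarrow> i \<in> I \<Longrightarrow>
    x \<in> carrier (G i) \<Longrightarrow> y \<in> carrier (G i) \<Longrightarrow>
    (u @ [(i, x), (i, y)] @ w, u @ [(i, x \<otimes>\<^bsub>G i\<^esub> y)] @ w) \<in> fp_rel I G"
| one: "u \<in> fp_words I G \<Longrightarrow> w \<in> fp_words I G \<Longrightarrow> i \<in> I \<Longrightarrow>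
    (u @ [(i, \<one>\<^bsub>G i\<^esub>)] @ w, u @ w) \<in> fp_rel I G"

definition free_product :: "'i set \<Rightarrow> ('i \<Rightarrow> 'g monoid) \<Rightarrow> ('i \<times> 'g) list set monoid" where
  "free_product I G =
     \<lparr>carrier = fp_words I G // fp_rel I G,
      monoid.mult = (\<lambda>X Y. \<Union>u \<in> X. \<Union>w \<in> Y. fp_rel I G `` {u @ w}),
      one = fp_rel I G `` {[]}\<rparr>"

definition fp_inj :: "'i set \<Rightarrow> ('i \<Rightarrow> 'g monoid) \<Rightarrow> 'i \<Rightarrow> 'g \<Rightarrow> ('i \<times> 'g) list set" where
  "fp_inj I G i x = fp_rel I G `` {[(i, x)]}"

text \<open>
  An oriented graph is a \<^locale>\<open>wf_digraph\<close>.  Being a tree refers to the underlying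
  unoriented graph, so \<^const>\<open>tree\<close> is not the right notion here: it only
  excludes directed cycles.  In \<open>doubled \<Gamma>\<close> every arc of \<open>\<Gamma>\<close> may be traversed in both
  directions; a circuit of the unoriented graph is a cycle in it that uses no arc of \<open>\<Gamma>\<close>
  twice.  Loops and pairs of parallel or antiparallel arcs thus count as circuits.
\<close>

definition doubled :: "('v, 'e) pre_digraph \<Rightarrow> ('v, 'e \<times> bool) pre_digraph" where
  "doubled \<Gamma> =
     \<lparr>verts = verts \<Gamma>,
      arcs = arcs \<Gamma> \<times> UNIV,
      tail = (\<lambda>(e, forward). if forward then tail \<Gamma> e else head \<Gamma> e),
      head = (\<lambda>(e, forward). if forward then head \<Gamma> e else tail \<Gamma> e)\<rparr>"

definition oriented_tree :: "('v, 'e) pre_digraph \<Rightarrow> bool" where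
  "oriented_tree \<Gamma> \<longleftrightarrow> wf_digraph \<Gamma> \<and> Digraph_Component.connected \<Gamma> \<and>
     \<not> (\<exists>p. pre_digraph.cycle (doubled \<Gamma>) p \<and> distinct (map fst p))"

text \<open>
  An element \<open>\<beta>\<close> of the field of a well-order \<open>r\<close> represents the ordinal that is the order
  type of its set \<open>underS r \<beta>\<close> of strict predecessors.  Every ordinal \<open>\<alpha>\<close> arises in this
  way, from the top element of a well-order of type \<open>\<alpha> + 1\<close>.  The condition
  \<open>underS r \<beta> \<noteq> {}\<close> says \<open>1 \<le> \<beta>\<close>, and \<open>wo_rel.suc r {\<beta>}\<close> is \<open>\<beta> + 1\<close>, which is meaningful
  because it is used only for \<open>\<beta>\<close> strictly below \<open>\<alpha>\<close>, i.e. for \<open>\<beta> + 1 \<le> \<alpha>\<close>.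
\<close>

definition ordinal_graph :: "'o rel \<Rightarrow> 'o \<Rightarrow> ('o, 'o \<times> 'o) pre_digraph" where
  "ordinal_graph r \<alpha> =
     \<lparr>verts = {\<beta>. (\<beta>, \<alpha>) \<in> r \<and> underS r \<beta> \<noteq> {}},
      arcs = {(\<beta>, wo_rel.suc r {\<beta>}) | \<beta>. \<beta> \<in> underS r \<alpha> \<and> underS r \<beta> \<noteq> {}},
      tail = fst,
      head = snd\<rparr>"

record ('v, 'e, 'g) graph_of_groups =
  base_graph :: "('v, 'e) pre_digraph"
  vertex_group :: "'v \<Rightarrow> 'g monoid"
  edge_group :: "'e \<Rightarrow> 'g set"
  edge_map :: "'e \<Rightarrow> 'g \<Rightarrow> 'g"

abbreviation tail_group :: "('v, 'e, 'g) graph_of_groups \<Rightarrow> 'e \<Rightarrow> 'g monoid" where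
  "tail_group \<G> e \<equiv> vertex_group \<G> (tail (base_graph \<G>) e)"

abbreviation head_group :: "('v, 'e, 'g) graph_of_groups \<Rightarrow> 'e \<Rightarrow> 'g monoid" where
  "head_group \<G> e \<equiv> vertex_group \<G> (head (base_graph \<G>) e)"

locale oriented_graph_of_groups =
  fixes \<G> :: "('v, 'e, 'g) graph_of_groups"
  assumes base_graph: "wf_digraph (base_graph \<G>)"
    and vertex_group: "v \<in> verts (base_graph \<G>) \<Longrightarrow> group (vertex_group \<G> v)"
    and edge_group: "e \<in> arcs (base_graph \<G>) \<Longrightarrow> subgroup (edge_group \<G> e) (tail_group \<G> e)"
    and edge_map: "e \<in> arcs (base_graph \<G>) \<Longrightarrow>
      edge_map \<G> e \<in> mon ((tail_group \<G> e)\<lparr>carrier := edge_group \<G> e\<rparr>) (head_group \<G> e)"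

definition quasi_malnormal :: "('v, 'e, 'g) graph_of_groups \<Rightarrow> bool" where
  "quasi_malnormal \<G> \<longleftrightarrow> (\<forall>e \<in> arcs (base_graph \<G>).
     malnormal (edge_group \<G> e) (tail_group \<G> e) \<and>
     edge_map \<G> e ` edge_group \<G> e \<lhd>
       (head_group \<G> e)
         \<lparr>carrier := malnormal_closure (head_group \<G> e) (edge_map \<G> e ` edge_group \<G> e)\<rparr>)"

definition malnormal_graph_of_groups :: "('v, 'e, 'g) graph_of_groups \<Rightarrow> bool" where
  "malnormal_graph_of_groups \<G> \<longleftrightarrow> quasi_malnormal \<G> \<and>
     (\<forall>e \<in> arcs (base_graph \<G>). malnormal (edge_map \<G> e ` edge_group \<G> e) (head_group \<G> e))"

definition normal_closure :: "('a, 'b) monoid_scheme \<Rightarrow> 'a set \<Rightarrow> 'a set" where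
  "normal_closure G S = \<Inter> {N. N \<lhd> G \<and> S \<subseteq> N}"

definition vertex_free_product ::
    "('v, 'e, 'g) graph_of_groups \<Rightarrow> ('v \<times> 'g) list set monoid" where
  "vertex_free_product \<G> = free_product (verts (base_graph \<G>)) (vertex_group \<G>)"

definition vertex_inj :: "('v, 'e, 'g) graph_of_groups \<Rightarrow> 'v \<Rightarrow> 'g \<Rightarrow> ('v \<times> 'g) list set" where
  "vertex_inj \<G> = fp_inj (verts (base_graph \<G>)) (vertex_group \<G>)"

definition edge_relators :: "('v, 'e, 'g) graph_of_groups \<Rightarrow> ('v \<times> 'g) list set set" where
  "edge_relators \<G> =
     {vertex_inj \<G> (tail (base_graph \<G>) e) g \<otimes>\<^bsub>vertex_free_product \<G>\<^esub>
        inv\<^bsub>vertex_free_product \<G>\<^esub> vertex_inj \<G> (head (base_graph \<G>) e) (edge_map \<G> e g)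
      | e g. e \<in> arcs (base_graph \<G>) \<and> g \<in> edge_group \<G> e}"

text \<open>
  No stable letters are introduced, so this is the usual fundamental group only if the
  components of the base graph are trees.
\<close>

definition fundamental_group ::
    "('v, 'e, 'g) graph_of_groups \<Rightarrow> ('v \<times> 'g) list set set monoid" where
  "fundamental_group \<G> =
     vertex_free_product \<G> Mod normal_closure (vertex_free_product \<G>) (edge_relators \<G>)"

end

theory Submission
  imports Defs
begin

text \<open>
A group is CSA exactly if it obeys a single law (\<open>csa_law\<close>): if \<open>a\<close> and \<open>y\<close> are nontrivial and commute, and a conjugate of \<open>a\<close> by
some \<open>x\<close> also commutes with \<open>y\<close>, then \<open>x\<close> commutes with \<open>a\<close>. This law and the absence of
involutions concern finitely many elements and finitely many equations between them. An equation between words that holds in the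
fundamental group already follows from the relations of finitely many vertices, so it is enough to
prove the two conditions for the groups of all finite subgraphs (\<open>csa_star_if_finite_subgraphs\<close>).

A finite subgraph is built up by adding one vertex at a time, and at each step the new vertex is
joined to the old ones by at most one edge. The group then changes into an amalgam \<open>A *\<^sub>C B\<close>, where
\<open>C\<close> is the edge group (trivial if there is no edge) and \<open>A\<close> contains the group of the initial vertex
of the edge. Suppose that \<open>C\<close> is malnormal in \<open>A\<close>. Then the amalgam inherits both
conditions from \<open>A\<close> and \<open>B\<close> (\<open>csa_law_amalgam\<close>). To see this, let the amalgam act on its Bass-Serre
tree. By malnormality, a nontrivial element fixes at most one edge at any vertex of type \<open>A\<close>;
hence its fixed vertices, if there are any, form a star around one vertex of type \<open>B\<close>, or there is
just one of them, of type \<open>A\<close>. So an element with a fixed vertex has a distinguished one, which all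
elements commuting with it fix as well, and the law follows from the law in the stabilizer of that
vertex, a conjugate of \<open>A\<close> or \<open>B\<close>. An element without fixed vertices translates a unique line, its
axis, and in the situation of the law \<open>a\<close>, \<open>y\<close> and the conjugate of \<open>a\<close> have the same axis, which \<open>x\<close>
therefore preserves. Only the identity fixes a line pointwise. If \<open>x\<close> reversed the axis, its square
would fix it pointwise and \<open>x\<close> would be an involution; so \<open>x\<close> shifts the axis, and it commutes with
the shift \<open>a\<close>. An involution cannot translate a line, so it would lie in a conjugate of \<open>A\<close> or \<open>B\<close>.

It remains to choose the order of the vertices. For the graph of an ordinal, the new vertex is the
least one (\<open>ordinal_graph_csa_star\<close>): the only edge joining it to the larger ones leaves it, so \<open>A\<close>
is a single vertex group, in which the edge group is malnormal by hypothesis. For a tree, the new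
vertex is a leaf of the enlarged subgraph (\<open>oriented_tree_csa_star\<close>). If its edge points towards it,
then \<open>A\<close> is the group of the old subgraph; therefore the induction also carries along that all
vertex groups are malnormal in the group of the subgraph. This persists because malnormality is
transitive and because both factors of an amalgam are malnormal if \<open>C\<close> is malnormal in both of them.

Two facts about presentations support the argument. The normal form theorem for amalgams,
from which the Bass-Serre tree is a tree, comes from letting the pushout act on normal words, as
van der Waerden does (locales \<open>span\<close> and \<open>pushout\<close>). And the fundamental group, defined as a
quotient of the free product, is the group of all words modulo the vertex and edge relations
(\<open>fundamental_group_iso\<close>); only in this form do the groups of subgraphs become comparable.
\<close>

section \<open>The CSA property as a law about elements\<close>

text \<open>
For \<open>y = b\<close> the law says that a nontrivial element commuting with one of its conjugates commutes with
the conjugating element; if \<open>x\<close> commutes with \<open>y\<close> it says that commuting is transitive on nontrivial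
elements. Conjugates are described by the equation \<open>x b = a x\<close>, so that the law involves products
only and can be carried over to words without treating inverses.
\<close>

definition csa_law :: "('a, 'b) monoid_scheme \<Rightarrow> bool" where
  "csa_law G \<longleftrightarrow> (\<forall>a \<in> carrier G. \<forall>b \<in> carrier G. \<forall>x \<in> carrier G. \<forall>y \<in> carrier G.
     a \<noteq> \<one>\<^bsub>G\<^esub> \<longrightarrow> y \<noteq> \<one>\<^bsub>G\<^esub> \<longrightarrow> a \<otimes>\<^bsub>G\<^esub> y = y \<otimes>\<^bsub>G\<^esub> a \<longrightarrow> x \<otimes>\<^bsub>G\<^esub> b = a \<otimes>\<^bsub>G\<^esub> x \<longrightarrow>
     b \<otimes>\<^bsub>G\<^esub> y = y \<otimes>\<^bsub>G\<^esub> b \<longrightarrow> a \<otimes>\<^bsub>G\<^esub> x = x \<otimes>\<^bsub>G\<^esub> a)"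

definition involution_free :: "('a, 'b) monoid_scheme \<Rightarrow> bool" where
  "involution_free G \<longleftrightarrow> (\<forall>g \<in> carrier G. g \<otimes>\<^bsub>G\<^esub> g = \<one>\<^bsub>G\<^esub> \<longrightarrow> g = \<one>\<^bsub>G\<^esub>)"

lemma csa_lawD:
  assumes "csa_law G" "a \<in> carrier G" "b \<in> carrier G" "x \<in> carrier G" "y \<in> carrier G"
    "a \<noteq> \<one>\<^bsub>G\<^esub>" "y \<noteq> \<one>\<^bsub>G\<^esub>" "a \<otimes>\<^bsub>G\<^esub> y = y \<otimes>\<^bsub>G\<^esub> a" "x \<otimes>\<^bsub>G\<^esub> b = a \<otimes>\<^bsub>G\<^esub> x"
    "b \<otimes>\<^bsub>G\<^esub> y = y \<otimes>\<^bsub>G\<^esub> b"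
  shows "a \<otimes>\<^bsub>G\<^esub> x = x \<otimes>\<^bsub>G\<^esub> a"
  using assms unfolding csa_law_def by blast

context group
begin

text \<open>
The inverse-free form of malnormality, which homomorphisms transport by multiplicativity alone.
\<close>

lemma malnormal_iff:
  "malnormal H G \<longleftrightarrow> subgroup H G \<and>
     (\<forall>x \<in> carrier G. \<forall>h \<in> H. \<forall>k \<in> H. h \<otimes> x = x \<otimes> k \<longrightarrow> h \<noteq> \<one> \<longrightarrow> x \<in> H)"
  (is "?L \<longleftrightarrow> ?R")
proof
  assume L: ?L
  then have H: "subgroup H G" by (simp add: malnormal_def)
  have "x \<in> H" if x: "x \<in> carrier G" and h: "h \<in> H" and k: "k \<in> H"
    and eq: "h \<otimes> x = x \<otimes> k" and "h \<noteq> \<one>" for x h k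
  proof (rule ccontr)
    assume "x \<notin> H"
    have c: "h \<in> carrier G" "k \<in> carrier G" using H h k by (auto dest: subgroup.mem_carrier)
    have "inv x \<otimes> h \<otimes> x = k"
      using eq x c by (metis inv_closed m_assoc l_inv l_one)
    then have "k \<in> inv x <# H #> x"
      using h by (auto simp: l_coset_def r_coset_def)
    then have "k = \<one>"
      using L k x \<open>x \<notin> H\<close> unfolding malnormal_def by blast
    then show False using eq c x \<open>h \<noteq> \<one>\<close> by (simp add: r_cancel_one)
  qed
  then show ?R using H by blast
next
  assume R: ?R
  then have H: "subgroup H G" by simp
  have "H \<inter> (inv x <# H #> x) = {\<one>}" if "x \<in> carrier G - H" for x
  proof -
    have x: "x \<in> carrier G" "x \<notin> H" using that by auto
    have "k = \<one>" if k: "k \<in> H" "k \<in> inv x <# H #> x" for k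
    proof -
      from k(2) obtain h where h: "h \<in> H" "k = inv x \<otimes> h \<otimes> x"
        by (auto simp: l_coset_def r_coset_def)
      have c: "h \<in> carrier G" "k \<in> carrier G" using H h k by (auto dest: subgroup.mem_carrier)
      have "h \<otimes> x = x \<otimes> k" using x c by (simp add: h(2) flip: m_assoc)
      then have "h = \<one>" using R x h k by blast
      then show "k = \<one>" using h x by simp
    qed
    moreover have "\<one> \<in> H" using H by (rule subgroup.one_closed)
    moreover have "\<one> \<in> inv x <# H #> x"
    proof -
      have "inv x \<otimes> \<one> \<in> inv x <# H" unfolding l_coset_def using \<open>\<one> \<in> H\<close> by blast
      then have "inv x \<otimes> \<one> \<otimes> x \<in> inv x <# H #> x" unfolding r_coset_def by blast
      then show ?thesis using x by simp
    qed
    ultimately show ?thesis by blast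
  qed
  then show ?L using H by (simp add: malnormal_def)
qed

lemma malnormalI:
  assumes "subgroup H G"
    and "\<And>x h k. x \<in> carrier G \<Longrightarrow> h \<in> H \<Longrightarrow> k \<in> H \<Longrightarrow> h \<otimes> x = x \<otimes> k \<Longrightarrow> h \<noteq> \<one> \<Longrightarrow> x \<in> H"
  shows "malnormal H G"
  using assms malnormal_iff by blast

lemma malnormalD:
  assumes "malnormal H G" "x \<in> carrier G" "h \<in> H" "k \<in> H" "h \<otimes> x = x \<otimes> k" "h \<noteq> \<one>"
  shows "x \<in> H"
  using assms malnormal_iff by blast

lemma abelian_subgroup_iff:
  "abelian_subgroup A G \<longleftrightarrow> subgroup A G \<and> (\<forall>x\<in>A. \<forall>y\<in>A. x \<otimes> y = y \<otimes> x)"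
proof
  assume "abelian_subgroup A G"
  then have "subgroup A G" and c: "comm_group (G\<lparr>carrier := A\<rparr>)"
    by (auto simp: abelian_subgroup_def)
  moreover from c have "x \<otimes> y = y \<otimes> x" if "x \<in> A" "y \<in> A" for x y
    using comm_groupE(4)[OF c, of x y] that by simp
  ultimately show "subgroup A G \<and> (\<forall>x\<in>A. \<forall>y\<in>A. x \<otimes> y = y \<otimes> x)" by blast
next
  assume R: "subgroup A G \<and> (\<forall>x\<in>A. \<forall>y\<in>A. x \<otimes> y = y \<otimes> x)"
  then have "group (G\<lparr>carrier := A\<rparr>)" using subgroup.subgroup_is_group is_group by blast
  then have "comm_group (G\<lparr>carrier := A\<rparr>)"
    using R by (intro group.group_comm_groupI) auto
  then show "abelian_subgroup A G" using R by (simp add: abelian_subgroup_def)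
qed

text \<open>
Zorn's lemma is applied to sets of commuting elements rather than to abelian subgroups: a maximal
such set equals its own centralizer and is therefore a subgroup, so no generated subgroups are
needed.
\<close>

lemma commuting_set_in_maximal_abelian:
  assumes "S \<subseteq> carrier G" "\<And>x y. x \<in> S \<Longrightarrow> y \<in> S \<Longrightarrow> x \<otimes> y = y \<otimes> x"
  obtains A where "maximal_abelian_subgroup A G" "S \<subseteq> A"
proof -
  define Z where "Z = {T. S \<subseteq> T \<and> T \<subseteq> carrier G \<and> (\<forall>x\<in>T. \<forall>y\<in>T. x \<otimes> y = y \<otimes> x)}"
  have ZI: "T \<in> Z"
    if "S \<subseteq> T" "T \<subseteq> carrier G" "\<And>x y. x \<in> T \<Longrightarrow> y \<in> T \<Longrightarrow> x \<otimes> y = y \<otimes> x" for T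
    using that unfolding Z_def by blast
  have ZD: "S \<subseteq> T" "T \<subseteq> carrier G" "\<And>x y. x \<in> T \<Longrightarrow> y \<in> T \<Longrightarrow> x \<otimes> y = y \<otimes> x"
    if "T \<in> Z" for T using that unfolding Z_def by blast+
  have "\<exists>M\<in>Z. \<forall>X\<in>Z. M \<subseteq> X \<longrightarrow> X = M"
  proof (rule subset_Zorn_nonempty)
    show "Z \<noteq> {}" using ZI[of S] assms by blast
  next
    fix \<C> assume "\<C> \<noteq> {}" and ch: "subset.chain Z \<C>"
    have Z: "\<And>T. T \<in> \<C> \<Longrightarrow> T \<in> Z" using ch by (auto simp: subset_chain_def)
    show "\<Union>\<C> \<in> Z"
    proof (rule ZI)
      show "S \<subseteq> \<Union>\<C>" using ZD(1)[OF Z] \<open>\<C> \<noteq> {}\<close> by blast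
      show "\<Union>\<C> \<subseteq> carrier G" using ZD(2)[OF Z] by blast
    next
      fix x y assume "x \<in> \<Union>\<C>" "y \<in> \<Union>\<C>"
      then obtain T U where "T \<in> \<C>" "U \<in> \<C>" "x \<in> T" "y \<in> U" by blast
      moreover then have "T \<subseteq> U \<or> U \<subseteq> T" using ch by (auto simp: subset_chain_def)
      ultimately obtain W where "W \<in> \<C>" "x \<in> W" "y \<in> W" by blast
      then show "x \<otimes> y = y \<otimes> x" using ZD(3)[OF Z] by blast
    qed
  qed
  then obtain M where M: "M \<in> Z" and max: "\<And>X. X \<in> Z \<Longrightarrow> M \<subseteq> X \<Longrightarrow> X = M" by blast
  note MD = ZD[OF M]
  have cent: "z \<in> M" if z: "z \<in> carrier G" "\<And>m. m \<in> M \<Longrightarrow> z \<otimes> m = m \<otimes> z" for z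
  proof -
    have "insert z M \<in> Z"
    proof (rule ZI)
      fix x y assume "x \<in> insert z M" "y \<in> insert z M"
      then show "x \<otimes> y = y \<otimes> x" using z(2) MD(3) by (metis insert_iff)
    qed (use MD z in auto)
    then show ?thesis using max[of "insert z M"] by blast
  qed
  have sub: "subgroup M G"
  proof (rule subgroupI)
    show "M \<subseteq> carrier G" by (rule MD)
    have "\<one> \<in> M"
    proof (rule cent)
      fix m assume "m \<in> M"
      then have "m \<in> carrier G" using MD by blast
      then show "\<one> \<otimes> m = m \<otimes> \<one>" by simp
    qed simp
    then show "M \<noteq> {}" by blast
  next
    fix a assume a: "a \<in> M"
    then have ac: "a \<in> carrier G" using MD by blast
    show "inv a \<in> M"
    proof (rule cent)
      show "inv a \<in> carrier G" using ac by simp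
      fix m assume m: "m \<in> M"
      then have mc: "m \<in> carrier G" using MD by blast
      have "a \<otimes> (inv a \<otimes> m) = m"
        using m_assoc[of a "inv a" m] ac mc by simp
      moreover have "a \<otimes> (m \<otimes> inv a) = m"
        using MD(3)[OF a m] m_assoc[of a m "inv a"] m_assoc[of m a "inv a"] ac mc by simp
      ultimately show "inv a \<otimes> m = m \<otimes> inv a"
        using Units_l_cancel[of a "inv a \<otimes> m" "m \<otimes> inv a"] ac mc by simp
    qed
  next
    fix a b assume a: "a \<in> M" "b \<in> M"
    then have ac: "a \<in> carrier G" "b \<in> carrier G" using MD by blast+
    show "a \<otimes> b \<in> M"
    proof (rule cent)
      show "a \<otimes> b \<in> carrier G" using ac by simp
      fix m assume m: "m \<in> M"
      then have mc: "m \<in> carrier G" using MD by blast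
      have "a \<otimes> b \<otimes> m = a \<otimes> m \<otimes> b"
        using m_assoc[OF ac mc] MD(3)[OF a(2) m] m_assoc[OF ac(1) mc ac(2)] by simp
      then show "a \<otimes> b \<otimes> m = m \<otimes> (a \<otimes> b)"
        using MD(3)[OF a(1) m] m_assoc[OF mc ac] by simp
    qed
  qed
  have "maximal_abelian_subgroup M G"
    unfolding maximal_abelian_subgroup_def
  proof (intro conjI allI impI)
    show "abelian_subgroup M G" using sub MD(3) by (auto simp only: abelian_subgroup_iff)
    fix B assume B: "abelian_subgroup B G \<and> M \<subseteq> B"
    then have B': "subgroup B G" "\<And>x y. x \<in> B \<Longrightarrow> y \<in> B \<Longrightarrow> x \<otimes> y = y \<otimes> x"
      unfolding abelian_subgroup_iff by blast+
    have "B \<in> Z"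
      using MD(1) B subgroup.subset[OF B'(1)] B'(2) by (intro ZI) auto
    then show "B = M" using max B by blast
  qed
  then show thesis using that MD(1) by blast
qed

text \<open>
Maximal abelian subgroups around \<open>a, y\<close> and around \<open>b, y\<close> share \<open>y\<close>. Malnormality forces everything
that commutes with \<open>y\<close> into the first one, so the two coincide; then \<open>x\<close> conjugates a nontrivial
element of this subgroup into it and belongs to it, by malnormality again.
\<close>

lemma csa_law_if_csa_group:
  assumes "csa_group G"
  shows "csa_law G"
  unfolding csa_law_def
proof (intro ballI impI)
  fix a b x y
  assume car: "a \<in> carrier G" "b \<in> carrier G" "x \<in> carrier G" "y \<in> carrier G"
    and ne: "a \<noteq> \<one>" "y \<noteq> \<one>" and ay: "a \<otimes> y = y \<otimes> a" and xb: "x \<otimes> b = a \<otimes> x"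
    and bY: "b \<otimes> y = y \<otimes> b"
  obtain A where A: "maximal_abelian_subgroup A G" "{a, y} \<subseteq> A"
    using commuting_set_in_maximal_abelian[of "{a, y}"] car ay by (metis empty_iff insert_iff insert_subset empty_subsetI)
  obtain B where B: "maximal_abelian_subgroup B G" "{b, y} \<subseteq> B"
    using commuting_set_in_maximal_abelian[of "{b, y}"] car bY by (metis empty_iff insert_iff insert_subset empty_subsetI)
  have mal: "malnormal A G" using A assms by (simp add: csa_group_def)
  have abA: "abelian_subgroup A G" and abB: "abelian_subgroup B G"
    using A B by (simp_all add: maximal_abelian_subgroup_def)
  have "B \<subseteq> A"
  proof
    fix z assume z: "z \<in> B"
    then have "y \<otimes> z = z \<otimes> y" "z \<in> carrier G"
      using abB B by (auto simp: abelian_subgroup_iff dest: subgroup.mem_carrier)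
    then show "z \<in> A" using malnormalD[OF mal, of z y y] A ne by auto
  qed
  then have "A = B" using B(1) abA by (auto simp: maximal_abelian_subgroup_def)
  then have "x \<in> A" using malnormalD[OF mal, of x a b] A B car ne xb by auto
  then show "a \<otimes> x = x \<otimes> a" using abA A by (auto simp: abelian_subgroup_iff)
qed

text \<open>
If \<open>x\<close> conjugates \<open>a\<close> to another element of the abelian subgroup, the law makes \<open>x\<close> commute with \<open>a\<close>.
A second use of the law spreads this to the whole subgroup, and maximality puts \<open>x\<close> into it.
\<close>

lemma csa_group_if_csa_law:
  assumes law: "csa_law G"
  shows "csa_group G"
  unfolding csa_group_def
proof (intro conjI allI impI)
  show "group G" by (rule is_group)
  fix A assume A: "maximal_abelian_subgroup A G"
  then have sub: "subgroup A G" and ab: "\<And>x y. x \<in> A \<Longrightarrow> y \<in> A \<Longrightarrow> x \<otimes> y = y \<otimes> x"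
    by (auto simp: maximal_abelian_subgroup_def abelian_subgroup_iff)
  have car: "\<And>z. z \<in> A \<Longrightarrow> z \<in> carrier G" using sub by (auto dest: subgroup.mem_carrier)
  show "malnormal A G"
  proof (rule malnormalI[OF sub])
    fix x a b
    assume x: "x \<in> carrier G" and a: "a \<in> A" and b: "b \<in> A" and eq: "a \<otimes> x = x \<otimes> b"
      and ne: "a \<noteq> \<one>"
    have "b \<noteq> \<one>" using eq ne x car[OF a] by (auto simp: r_cancel_one)
    then have ax: "a \<otimes> x = x \<otimes> a"
      using csa_lawD[OF law, of a b x b] x car a b eq ne ab by auto
    \<comment> \<open>The law applied to \<open>c\<close> and its conjugate by \<open>x\<close>, both of which commute with \<open>a\<close>.\<close>
    have cx: "c \<otimes> x = x \<otimes> c" if c: "c \<in> A" for c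
    proof (cases "c = \<one>")
      case True then show ?thesis using x by simp
    next
      case False
      let ?d = "inv x \<otimes> (c \<otimes> x)"
      have 1: "x \<otimes> ?d = c \<otimes> x" using x car[OF c] by (simp flip: m_assoc)
      have d: "?d \<in> carrier G" using x car[OF c] by simp
      have "x \<otimes> (?d \<otimes> a) = c \<otimes> (x \<otimes> a)"
        using m_assoc[OF x d car[OF a]] m_assoc[OF car[OF c] x car[OF a]] 1 by simp
      also have "\<dots> = a \<otimes> (c \<otimes> x)"
        using ax ab[OF a c] m_assoc[OF car[OF c] car[OF a] x] m_assoc[OF car[OF a] car[OF c] x] by simp
      also have "\<dots> = x \<otimes> (a \<otimes> ?d)"
        using ax 1 m_assoc[OF car[OF a] x d] m_assoc[OF x car[OF a] d] by simp
      finally have "?d \<otimes> a = a \<otimes> ?d" using x d car[OF a] by simp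
      then show ?thesis
        using csa_lawD[OF law, of c ?d x a] 1 x car[OF c] car[OF a] False ne ab[OF c a] by auto
    qed
    obtain B where B: "maximal_abelian_subgroup B G" "insert x A \<subseteq> B"
      using commuting_set_in_maximal_abelian[of "insert x A"] x car ab cx
      by (metis insert_iff subsetI)
    then have "B = A" using A by (auto simp: maximal_abelian_subgroup_def)
    then show "x \<in> A" using B by blast
  qed
qed

lemma ord_eq_2_iff:
  assumes g: "g \<in> carrier G"
  shows "ord g = 2 \<longleftrightarrow> g \<otimes> g = \<one> \<and> g \<noteq> \<one>"
proof -
  have "g \<otimes> g = g [^] (2::nat)" using g by (simp add: numeral_2_eq_2)
  then have 1: "g \<otimes> g = \<one> \<longleftrightarrow> ord g dvd 2" using pow_eq_id[OF g] by simp
  have "ord g dvd 2 \<longleftrightarrow> ord g = 1 \<or> ord g = 2"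
    using dvd_imp_le[of "ord g" 2] by (cases "ord g = 0") auto
  then show ?thesis using 1 ord_eq_1[OF g] by auto
qed

lemma csa_star_group_iff:
  "csa_star_group G \<longleftrightarrow> csa_law G \<and> involution_free G"
  unfolding csa_star_group_def involution_free_def
  using csa_law_if_csa_group csa_group_if_csa_law ord_eq_2_iff by blast

end

text \<open>
Both properties are universal sentences, hence pass to subgroups.
\<close>

lemma csa_law_involution_free_mono:
  assumes "group G" "group H" and h: "h \<in> hom G H" and inj: "inj_on h (carrier G)"
    and law: "csa_law H" "involution_free H"
  shows "csa_law G \<and> involution_free G"
proof -
  interpret h: group_hom G H h using assms by (simp add: group_hom_def group_hom_axioms_def)
  have eq: "\<And>x y. x \<in> carrier G \<Longrightarrow> y \<in> carrier G \<Longrightarrow> h x = h y \<longleftrightarrow> x = y"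
    using inj by (auto dest: inj_onD)
  have one: "\<And>x. x \<in> carrier G \<Longrightarrow> h x = \<one>\<^bsub>H\<^esub> \<longleftrightarrow> x = \<one>\<^bsub>G\<^esub>"
    using eq[of _ "\<one>\<^bsub>G\<^esub>"] by simp
  have "csa_law G"
    unfolding csa_law_def
  proof (intro ballI impI)
    fix a b x y
    assume c: "a \<in> carrier G" "b \<in> carrier G" "x \<in> carrier G" "y \<in> carrier G"
      and "a \<noteq> \<one>\<^bsub>G\<^esub>" "y \<noteq> \<one>\<^bsub>G\<^esub>" "a \<otimes>\<^bsub>G\<^esub> y = y \<otimes>\<^bsub>G\<^esub> a"
        "x \<otimes>\<^bsub>G\<^esub> b = a \<otimes>\<^bsub>G\<^esub> x" "b \<otimes>\<^bsub>G\<^esub> y = y \<otimes>\<^bsub>G\<^esub> b"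
    then have "h a \<otimes>\<^bsub>H\<^esub> h x = h x \<otimes>\<^bsub>H\<^esub> h a"
      using csa_lawD[OF law(1), of "h a" "h b" "h x" "h y"] by (simp add: one flip: h.hom_mult)
    then show "a \<otimes>\<^bsub>G\<^esub> x = x \<otimes>\<^bsub>G\<^esub> a" using c by (simp add: eq flip: h.hom_mult)
  qed
  moreover have "involution_free G"
    unfolding involution_free_def
  proof (intro ballI impI)
    fix g assume g: "g \<in> carrier G" "g \<otimes>\<^bsub>G\<^esub> g = \<one>\<^bsub>G\<^esub>"
    then have "h g \<otimes>\<^bsub>H\<^esub> h g = \<one>\<^bsub>H\<^esub>" by (simp flip: h.hom_mult)
    then have "h g = \<one>\<^bsub>H\<^esub>" 
      using law(2) h.hom_closed[OF g(1)] unfolding involution_free_def by blast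
    then show "g = \<one>\<^bsub>G\<^esub>" using one g by blast
  qed
  ultimately show ?thesis by blast
qed

lemma csa_law_image:
  assumes "group G" "group H" "h \<in> hom G H" "inj_on h (carrier G)" "csa_law G" "involution_free G"
  shows "csa_law (H\<lparr>carrier := h ` carrier G\<rparr>) \<and> involution_free (H\<lparr>carrier := h ` carrier G\<rparr>)"
proof -
  interpret h: group_hom G H h using assms by (simp add: group_hom_def group_hom_axioms_def)
  have "h \<in> iso G (H\<lparr>carrier := h ` carrier G\<rparr>)"
    using assms by (auto simp: iso_def hom_def bij_betw_def)
  then have "inv_into (carrier G) h \<in> iso (H\<lparr>carrier := h ` carrier G\<rparr>) G"
    using assms(1) by (rule group.iso_set_sym[rotated])
  then have k: "inv_into (carrier G) h \<in> hom (H\<lparr>carrier := h ` carrier G\<rparr>) G"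
    "inj_on (inv_into (carrier G) h) (carrier (H\<lparr>carrier := h ` carrier G\<rparr>))"
    by (auto simp: iso_def bij_betw_def)
  have "group (H\<lparr>carrier := h ` carrier G\<rparr>)"
    using h.img_is_subgroup by (rule h.H.subgroup_imp_group)
  then show ?thesis using csa_law_involution_free_mono[OF _ assms(1) k] assms by blast
qed

lemma malnormal_image:
  assumes "group G" "group H" "h \<in> hom G H" "inj_on h (carrier G)" "malnormal M G"
  shows "malnormal (h ` M) (H\<lparr>carrier := h ` carrier G\<rparr>)"
proof -
  interpret G: group G by fact
  interpret h: group_hom G H h using assms by (simp add: group_hom_def group_hom_axioms_def)
  interpret I: group "H\<lparr>carrier := h ` carrier G\<rparr>"
    using h.img_is_subgroup by (rule h.H.subgroup_imp_group)
  have M: "subgroup M G" using assms(5) G.malnormal_iff by blast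
  have Mc: "\<And>m. m \<in> M \<Longrightarrow> m \<in> carrier G" using M by (rule subgroup.mem_carrier)
  have "subgroup (h ` M) H" using M by (rule h.subgroup_img_is_subgroup)
  then have "subgroup (h ` M) (H\<lparr>carrier := h ` carrier G\<rparr>)"
    using Mc h.img_is_subgroup by (intro h.H.subgroup_incl) auto
  moreover have mem: "x \<in> h ` M"
    if x: "x \<in> h ` carrier G" and abM: "a \<in> h ` M" "b \<in> h ` M" and eq: "a \<otimes>\<^bsub>H\<^esub> x = x \<otimes>\<^bsub>H\<^esub> b"
      and ne: "a \<noteq> \<one>\<^bsub>H\<^esub>" for x a b
  proof -
    obtain x' where x': "x = h x'" "x' \<in> carrier G" using x by blast
    obtain a' b' where a': "a = h a'" "a' \<in> M" and b': "b = h b'" "b' \<in> M" using abM by blast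
    have "h (a' \<otimes>\<^bsub>G\<^esub> x') = h (x' \<otimes>\<^bsub>G\<^esub> b')" using eq x' a' b' Mc by simp
    then have "a' \<otimes>\<^bsub>G\<^esub> x' = x' \<otimes>\<^bsub>G\<^esub> b'" using assms(4) x' a' b' Mc by (simp add: inj_on_def)
    moreover have "a' \<noteq> \<one>\<^bsub>G\<^esub>" using ne a' by auto
    ultimately have "x' \<in> M" using G.malnormalD[OF assms(5)] x' a' b' by blast
    then show ?thesis using x' by blast
  qed
  ultimately show ?thesis
  proof (intro I.malnormalI)
    fix x a b
    let ?I = "H\<lparr>carrier := h ` carrier G\<rparr>"
    assume "x \<in> carrier ?I" "a \<in> h ` M" "b \<in> h ` M" "a \<otimes>\<^bsub>?I\<^esub> x = x \<otimes>\<^bsub>?I\<^esub> b" "a \<noteq> \<one>\<^bsub>?I\<^esub>"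
    then show "x \<in> h ` M" using mem[of x a b] by simp
  qed
qed

text \<open>
A conjugation within \<open>M\<close> is one within \<open>H\<close>; so the conjugating element lies in \<open>H\<close>, then in \<open>M\<close>.
\<close>

lemma malnormal_trans:
  assumes "group G" "malnormal H G" "malnormal M (G\<lparr>carrier := H\<rparr>)"
  shows "malnormal M G"
proof -
  interpret G: group G by fact
  have H: "subgroup H G" using assms(2) G.malnormal_iff by blast
  interpret H: group "G\<lparr>carrier := H\<rparr>" using H by (rule G.subgroup_imp_group)
  have M: "subgroup M (G\<lparr>carrier := H\<rparr>)" using assms(3) H.malnormal_iff by blast
  then have MH: "M \<subseteq> H" using subgroup.subset by fastforce
  show ?thesis
  proof (rule G.malnormalI)
    show "subgroup M G" using G.incl_subgroup[OF H M] .
    fix x h k assume x: "x \<in> carrier G" and hk: "h \<in> M" "k \<in> M" "h \<otimes>\<^bsub>G\<^esub> x = x \<otimes>\<^bsub>G\<^esub> k" "h \<noteq> \<one>\<^bsub>G\<^esub>"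
    then have "x \<in> H" using G.malnormalD[OF assms(2)] MH by blast
    then show "x \<in> M" using H.malnormalD[OF assms(3), of x h k] hk by simp
  qed
qed

section \<open>Reduced walks and lines\<close>

text \<open>
Walks are lists of vertices; reduced means that no step is undone by the next one.
\<close>

fun reduced :: "('v \<Rightarrow> 'v \<Rightarrow> bool) \<Rightarrow> 'v list \<Rightarrow> bool" where
  "reduced adj [] = True"
| "reduced adj [u] = True"
| "reduced adj [u, v] = adj u v"
| "reduced adj (u # v # w # p) = (adj u v \<and> u \<noteq> w \<and> reduced adj (v # w # p))"

lemma reduced_first: "reduced adj (u # v # p) \<Longrightarrow> adj u v"
  by (cases p) auto

lemma reduced_Cons: "reduced adj (u # p) \<Longrightarrow> reduced adj p"
  by (cases p; cases "tl p") auto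

text \<open>
Being reduced concerns three consecutive vertices, so it may be checked separately on two pieces that
overlap in a whole edge; an overlap in a vertex would not suffice.
\<close>

lemma reduced_overlap:
  "reduced adj (p @ u # v # q) \<longleftrightarrow> reduced adj (p @ [u, v]) \<and> reduced adj (u # v # q)"
proof (induction p)
  case Nil then show ?case by (auto dest: reduced_first)
next
  case (Cons a p)
  show ?case
  proof (cases p)
    case Nil then show ?thesis by (auto dest: reduced_first)
  next
    case (Cons b p')
    then show ?thesis using Cons.IH by (cases p') auto
  qed
qed

lemma reduced_rev:
  assumes "\<And>u v. adj u v \<Longrightarrow> adj v u"
  shows "reduced adj p \<Longrightarrow> reduced adj (rev (p :: 'v list))"
proof (induction p rule: induct_list012)
  case (3 u v p)
  show ?case
  proof (cases p)
    case (Cons w q)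
    then show ?thesis using 3 reduced_overlap[of adj "rev q" w v "[u]"] assms
      by (auto dest: reduced_first)
  qed (use 3 assms in auto)
qed (auto intro: assms)

lemma reduced_append_left: "reduced adj (p @ q) \<Longrightarrow> reduced adj p"
proof (induction p)
  case (Cons a p)
  then have "reduced adj p" using reduced_Cons by fastforce
  then show ?case using Cons.prems by (cases p; cases "tl p") (auto dest: reduced_first)
qed simp

lemma reduced_join:
  assumes "reduced adj p" "reduced adj q" "2 \<le> length p" "2 \<le> length q" "last p = hd q"
    and "last (butlast p) \<noteq> hd (tl q)"
  shows "reduced adj (p @ tl q)"
proof -
  obtain x b q' where q: "q = x # b # q'"
    using assms(4) by (cases q; cases "tl q") auto
  have "p \<noteq> []" "butlast p \<noteq> []" using assms(3) by (cases p; cases "tl p"; auto)+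
  then obtain p' a where "butlast p = p' @ [a]" by (metis append_butlast_last_id)
  then have p: "p = p' @ [a, x]" using \<open>p \<noteq> []\<close> assms(5) q
    by (metis append_Cons append_Nil append_assoc append_butlast_last_id list.sel(1))
  have "a \<noteq> b" using assms(6) p q by (simp add: butlast_append)
  have "reduced adj [a, x]" using assms(1) p reduced_overlap[of adj p' a x "[]"] by auto
  then have "reduced adj (a # x # b # q')" using \<open>a \<noteq> b\<close> assms(2) q by auto
  then show ?thesis using assms(1) p q reduced_overlap[of adj p' a x "b # q'"] by auto
qed

lemma reduced_nth:
  assumes "reduced adj p"
  shows "Suc i < length p \<Longrightarrow> adj (p ! i) (p ! Suc i)"
    and "Suc (Suc i) < length p \<Longrightarrow> p ! i \<noteq> p ! Suc (Suc i)"
proof -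
  have "reduced adj (drop i p)" for i
  proof (induction i)
    case (Suc i)
    then show ?case
      by (cases "drop i p") (auto simp: drop_Suc drop_tl dest: reduced_Cons)
  qed (use assms in simp)
  then have r: "reduced adj (drop i p)" .
  show "adj (p ! i) (p ! Suc i)" if "Suc i < length p"
    using r that by (metis Cons_nth_drop_Suc Suc_lessD reduced_first)
  show "p ! i \<noteq> p ! Suc (Suc i)" if "Suc (Suc i) < length p"
    using r that by (metis Cons_nth_drop_Suc Suc_lessD reduced.simps(4))
qed

definition line :: "('v \<Rightarrow> 'v \<Rightarrow> bool) \<Rightarrow> (int \<Rightarrow> 'v) \<Rightarrow> bool" where
  "line adj l \<longleftrightarrow> (\<forall>i. adj (l i) (l (i + 1)) \<and> l i \<noteq> l (i + 2))"

fun segment :: "(int \<Rightarrow> 'v) \<Rightarrow> int \<Rightarrow> nat \<Rightarrow> 'v list" where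
  "segment l i 0 = [l i]"
| "segment l i (Suc n) = l i # segment l (i + 1) n"

lemma length_segment [simp]: "length (segment l i n) = Suc n"
  by (induction n arbitrary: i) auto

lemma segment_neq_Nil [simp]: "segment l i n \<noteq> []"
  by (cases n) auto

lemma hd_segment [simp]: "hd (segment l i n) = l i"
  by (cases n) auto

lemma last_segment [simp]: "last (segment l i n) = l (i + int n)"
  by (induction n arbitrary: i) (auto simp: algebra_simps)

lemma segment_snoc: "segment l i (Suc n) = segment l i n @ [l (i + int (Suc n))]"
proof (induction n arbitrary: i)
  case (Suc n)
  then show ?case using Suc.IH[of "i + 1"] by (simp add: algebra_simps)
qed simp

lemma reduced_segment:
  assumes "line adj l" shows "reduced adj (segment l i n)"
proof (induction n arbitrary: i)
  case (Suc n)
  have l: "adj (l i) (l (i + 1))" "l i \<noteq> l (i + 1 + 1)" for i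
    using assms by (simp_all add: line_def add.assoc)
  show ?case
  proof (cases n)
    case 0 then show ?thesis using l(1)[of i] by (simp add: add.commute)
  next
    case (Suc m)
    then show ?thesis using l Suc.IH[of "i + 1"] by (cases m) auto
  qed
qed simp

section \<open>Groups acting on bipartite trees\<close>

text \<open>
Trees are connected graphs without reduced closed walks. The group preserves the two sides of the
bipartition, so that no element can invert an edge.
\<close>

locale tree_action = group G for G (structure) +
  fixes V :: "'v set" and adj :: "'v \<Rightarrow> 'v \<Rightarrow> bool" and side :: "'v \<Rightarrow> bool"
    and act :: "'a \<Rightarrow> 'v \<Rightarrow> 'v"
  assumes adj_vertex: "adj u v \<Longrightarrow> u \<in> V"
    and adj_sym: "adj u v \<Longrightarrow> adj v u"
    and adj_side: "adj u v \<Longrightarrow> side u \<noteq> side v"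
    and connected: "u \<in> V \<Longrightarrow> v \<in> V \<Longrightarrow> adj\<^sup>*\<^sup>* u v"
    and nonempty: "V \<noteq> {}"
    and no_circuit: "reduced adj p \<Longrightarrow> 2 \<le> length p \<Longrightarrow> hd p \<noteq> last p"
    and act_closed: "g \<in> carrier G \<Longrightarrow> v \<in> V \<Longrightarrow> act g v \<in> V"
    and act_one: "v \<in> V \<Longrightarrow> act \<one> v = v"
    and act_mult: "g \<in> carrier G \<Longrightarrow> h \<in> carrier G \<Longrightarrow> v \<in> V \<Longrightarrow> act (g \<otimes> h) v = act g (act h v)"
    and act_adj: "g \<in> carrier G \<Longrightarrow> adj u v \<Longrightarrow> adj (act g u) (act g v)"
    and act_side: "g \<in> carrier G \<Longrightarrow> v \<in> V \<Longrightarrow> side (act g v) = side v"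
begin

lemma act_inj:
  assumes "g \<in> carrier G" "u \<in> V" "v \<in> V" shows "act g u = act g v \<longleftrightarrow> u = v"
  using assms act_mult[of "inv g" g] act_one by (metis inv_closed l_inv)

lemma reduced_reverse: "reduced adj p \<Longrightarrow> reduced adj (rev p)"
  by (rule reduced_rev[OF adj_sym])

lemma reduced_vertices: "reduced adj p \<Longrightarrow> 2 \<le> length p \<Longrightarrow> set p \<subseteq> V"
proof (induction p rule: induct_list012)
  case (3 u v p)
  show ?case
  proof (cases p)
    case Nil
    then show ?thesis using 3 adj_vertex adj_vertex[OF adj_sym, of u v] by simp
  next
    case (Cons w q)
    then show ?thesis using 3 adj_vertex[of u v] by simp
  qed
qed auto

lemma reduced_map_act:
  "g \<in> carrier G \<Longrightarrow> reduced adj p \<Longrightarrow> reduced adj (map (act g) p)"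
proof (induction p rule: induct_list012)
  case (3 u v p)
  show ?case
  proof (cases p)
    case Nil
    then show ?thesis using 3 act_adj by simp
  next
    case (Cons w q)
    then have "w \<in> V" "u \<in> V" using reduced_vertices[of "u # v # p"] 3 by auto
    then show ?thesis using 3 Cons act_adj act_inj by simp
  qed
qed auto

text \<open>
Where two reduced walks with the same ends diverge, going back along one and forward along the other
is a reduced closed walk.
\<close>

lemma reduced_unique:
  assumes "reduced adj p" "reduced adj q" "p \<noteq> []" "q \<noteq> []" "hd p = hd q" "last p = last q"
  shows "p = q"
  using assms
proof (induction p arbitrary: q)
  case Nil then show ?case by simp
next
  case (Cons u p)
  obtain q' where q: "q = u # q'" using Cons.prems by (cases q) auto
  show ?case
  proof (cases p)
    case Nil
    then show ?thesis using q Cons.prems no_circuit[of q]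
      by (cases q') (auto simp: Suc_le_eq split: if_splits)
  next
    case p: (Cons v p')
    show ?thesis
    proof (cases q')
      case Nil
      then show ?thesis using q p Cons.prems no_circuit[of "u # p"] by auto
    next
      case q': (Cons v' q'')
      show ?thesis
      proof (cases "v = v'")
        case True
        then have "p = q'" using Cons.IH[of q'] Cons.prems q q' p by (auto dest: reduced_Cons)
        then show ?thesis using q by simp
      next
        case False
        have "reduced adj (rev (u # p) @ tl q)"
          using False Cons.prems q q' p
          by (intro reduced_join reduced_reverse) (auto simp: butlast_append)
        moreover have "hd (rev (u # p) @ tl q) = last (rev (u # p) @ tl q)"
        proof -
          have "hd (rev (u # p) @ tl q) = last (u # p)" using p by (simp add: hd_append hd_rev)
          moreover have "last (rev (u # p) @ tl q) = last q" using q q' by simp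
          ultimately show ?thesis using Cons.prems(6) by simp
        qed
        ultimately show ?thesis using no_circuit[of "rev (u # p) @ tl q"] p by auto
      qed
    qed
  qed
qed

lemma reduced_exists:
  assumes "u \<in> V" "v \<in> V"
  shows "\<exists>p. reduced adj p \<and> p \<noteq> [] \<and> hd p = u \<and> last p = v"
  using connected[OF assms]
proof (induction rule: converse_rtranclp_induct)
  case base
  show ?case by (rule exI[of _ "[v]"]) simp
next
  case (step u u')
  then obtain p where p: "reduced adj p" "p \<noteq> []" "hd p = u'" "last p = v" by blast
  then obtain p' where p': "p = u' # p'" by (cases p) auto
  show ?case
  proof (cases p')
    case Nil
    then show ?thesis using p p' step by (intro exI[of _ "[u, v]"]) auto
  next
    case (Cons w q)
    show ?thesis
    proof (cases "w = u")
      case True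
      then show ?thesis using p p' Cons by (intro exI[of _ p']) (auto dest: reduced_Cons)
    next
      case False
      then show ?thesis using p p' Cons step by (intro exI[of _ "u # p"]) auto
    qed
  qed
qed

lemma fixes_walk:
  assumes "g \<in> carrier G" "reduced adj p" "p \<noteq> []" "act g (hd p) = hd p" "act g (last p) = last p"
    and "w \<in> set p"
  shows "act g w = w"
proof -
  have "map (act g) p = p"
    using assms by (intro reduced_unique reduced_map_act) (auto simp: hd_map last_map)
  then show ?thesis using assms(6) by (metis map_eq_conv map_idI map_ident)
qed

lemma line_vertex: "line adj l \<Longrightarrow> l i \<in> V"
  using adj_vertex by (auto simp: line_def)

lemma line_neq: 
  assumes "line adj l" "i < j" shows "l i \<noteq> l j"
proof -
  have "reduced adj (segment l i (nat (j - i)))" using assms by (simp add: reduced_segment)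
  then show ?thesis using no_circuit[of "segment l i (nat (j - i))"] assms by auto
qed

lemma line_inj: "line adj l \<Longrightarrow> l i = l j \<longleftrightarrow> i = j"
  by (metis line_neq linorder_neqE)

text \<open>
Lines are geodesic: an edge between two of their vertices and the segment between them are reduced
walks with the same ends, hence equal.
\<close>

lemma line_adj:
  assumes "line adj l" "adj (l i) (l j)" shows "\<bar>j - i\<bar> = 1"
proof -
  have *: "j - i = 1" if "i < j" "adj (l i) (l j)" for i j
  proof -
    have "[l i, l j] = segment l i (nat (j - i))"
      using that assms(1) by (intro reduced_unique reduced_segment) auto
    then have "length [l i, l j] = length (segment l i (nat (j - i)))" by simp
    then show ?thesis using that by simp
  qed
  have "i \<noteq> j" using assms adj_side by auto
  then show ?thesis using *[of i j] *[of j i] assms(2) adj_sym by (cases "i < j") auto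
qed

lemma line_act: "line adj l \<Longrightarrow> g \<in> carrier G \<Longrightarrow> line adj (\<lambda>i. act g (l i))"
  using act_adj act_inj line_vertex by (simp add: line_def)

lemma line_reverse: "line adj l \<Longrightarrow> line adj (\<lambda>i. l (- i))"
  unfolding line_def
proof
  fix i assume "\<forall>i. adj (l i) (l (i + 1)) \<and> l i \<noteq> l (i + 2)"
  then have "adj (l (- i - 1)) (l (- i - 1 + 1)) \<and> l (- i - 2) \<noteq> l (- i - 2 + 2)" by blast
  then show "adj (l (- i)) (l (- (i + 1))) \<and> l (- i) \<noteq> l (- (i + 2))"
  proof -
    have "- (i + 1) = - i - 1" "- (i + 2) = - i - 2" "- i - 1 + 1 = - i" "- i - 2 + 2 = - i" by simp_all
    then show ?thesis using \<open>adj _ _ \<and> _\<close> adj_sym[of "l (- i - 1)" "l (- i)"] by metis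
  qed
qed

definition axis :: "'a \<Rightarrow> (int \<Rightarrow> 'v) \<Rightarrow> int \<Rightarrow> bool" where
  "axis g l n \<longleftrightarrow> line adj l \<and> n \<noteq> 0 \<and> (\<forall>i. act g (l i) = l (i + n))"

lemma axis_reverse: "axis g l n \<Longrightarrow> axis g (\<lambda>i. l (- i)) (- n)"
  unfolding axis_def using line_reverse by auto

text \<open>
Take a reduced walk of least length from some vertex to its image. Minimality means that the walk
continues without backtracking into its own translate, so its translates by the powers of \<open>g\<close>
form a line. A walk of length one is impossible because its ends lie on different sides.
\<close>

lemma axis_exists:
  assumes g: "g \<in> carrier G" and nofix: "\<And>v. v \<in> V \<Longrightarrow> act g v \<noteq> v"
  shows "\<exists>l n. axis g l n"
proof -
  let ?P = "\<lambda>p. reduced adj p \<and> p \<noteq> [] \<and> hd p \<in> V \<and> last p = act g (hd p)"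
  have "\<exists>p. ?P p" using nonempty reduced_exists act_closed g by (metis ex_in_conv)
  then obtain p where p: "?P p" and min: "\<And>q. ?P q \<Longrightarrow> length p \<le> length q"
    using ex_has_least_nat[of ?P _ length] by blast
  define N where "N = length p - 1"
  have len: "length p = Suc N" using p by (simp add: N_def)
  have "N \<noteq> 0"
    using p nofix[of "hd p"] len by (cases p) auto
  have "N \<noteq> 1"
  proof
    assume "N = 1"
    then obtain u v where uv: "p = [u, v]" using len
      by (metis One_nat_def length_0_conv length_Suc_conv)
    then show False using p act_side g adj_side by auto
  qed
  with \<open>N \<noteq> 0\<close> have N: "N \<ge> 2" by simp
  have pV: "p ! r \<in> V" if "r \<le> N" for r
    using reduced_vertices[of p] p len N that nth_mem[of r p] by auto
  have p0: "p ! 0 = hd p" using p by (simp add: hd_conv_nth)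
  have pN: "p ! N = act g (p ! 0)" using last_conv_nth[of p] p len p0 by simp
  have joint: "p ! (N - 1) \<noteq> act g (p ! 1)"
  proof
    assume eq: "p ! (N - 1) = act g (p ! 1)"
    let ?q = "tl (butlast p)"
    have "length ?q = N - 1" using len by simp
    then have "length ?q > 0" using N by linarith
    then have "?q \<noteq> []" by (rule length_greater_0_conv[THEN iffD1])
    have bl: "butlast p \<noteq> []" using len N by (metis \<open>tl (butlast p) \<noteq> []\<close> list.sel(2))
    have "reduced adj (butlast p)" using p by (metis append_butlast_last_id reduced_append_left)
    then have "reduced adj ?q" using bl by (metis list.exhaust_sel reduced_Cons)
    moreover have "hd ?q = p ! 1" using \<open>?q \<noteq> []\<close> len N
      by (simp add: hd_conv_nth nth_tl nth_butlast)
    moreover have "last ?q = p ! (N - 1)" using \<open>?q \<noteq> []\<close> len N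
      by (simp add: last_conv_nth nth_tl nth_butlast Suc_diff_Suc numeral_2_eq_2)
    ultimately have "?P ?q" using eq \<open>?q \<noteq> []\<close> pV N by simp
    then show False using min[of ?q] len by simp
  qed
  define l where "l i = act (g [^] (i div int N)) (p ! nat (i mod int N))" for i :: int
  have pow: "g [^] (d + 1) = g [^] d \<otimes> g" for d :: int
    using g by (simp add: int_pow_mult)
  have pow': "g [^] (d + 1) = g \<otimes> g [^] d" for d :: int
    using g int_pow_mult[of g 1 d] by (simp add: add.commute)
  have shift: "act g (l i) = l (i + int N)" for i
    using N pV[of "nat (i mod int N)"] g
    by (simp add: l_def pow' act_mult nat_le_iff order.strict_implies_order)
  have val: "l (d * int N + int r) = act (g [^] d) (p ! r)" if "r \<le> N" for d r
  proof (cases "r = N")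
    case False
    then have "(d * int N + int r) div int N = d" "(d * int N + int r) mod int N = int r"
      using that N by auto
    then show ?thesis by (simp add: l_def)
  next
    case True
    have "(d * int N + int N) div int N = d + 1" "(d * int N + int N) mod int N = 0"
      using N by auto
    then have "l (d * int N + int N) = act (g [^] (d + 1)) (p ! 0)" by (simp add: l_def)
    then show ?thesis using True pN g pow pV[of 0] by (simp add: act_mult)
  qed
  have "adj (l i) (l (i + 1)) \<and> l i \<noteq> l (i + 2)" for i
  proof -
    define d r where "d = i div int N" and "r = nat (i mod int N)"
    have r: "r < N" using N by (simp add: r_def nat_less_iff)
    have i: "i = d * int N + int r" using N by (simp add: d_def r_def)
    have gd: "g [^] d \<in> carrier G" using g by simp
    have 0: "l i = act (g [^] d) (p ! r)" using val[of r d] r i by simp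
    have 1: "l (i + 1) = act (g [^] d) (p ! Suc r)" using val[of "Suc r" d] r i by (simp add: add_ac)
    have "adj (p ! r) (p ! Suc r)" using reduced_nth(1)[of adj p r] p len r by simp
    then have A: "adj (l i) (l (i + 1))" using 0 1 act_adj gd by simp
    have "l i \<noteq> l (i + 2)"
    proof (cases "Suc r < N")
      case True
      then have "l (i + 2) = act (g [^] d) (p ! Suc (Suc r))"
        using val[of "Suc (Suc r)" d] i by (simp add: add_ac)
      then show ?thesis using 0 reduced_nth(2)[of adj p r] p len True pV act_inj gd by simp
    next
      case False
      then have rN: "r = N - 1" using r by simp
      have "i + 2 = (d + 1) * int N + int 1" using i rN N by (simp add: algebra_simps of_nat_diff)
      then have "l (i + 2) = l ((d + 1) * int N + int 1)" by (rule arg_cong)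
      also have "\<dots> = act (g [^] (d + 1)) (p ! 1)" using N by (intro val) simp
      also have "\<dots> = act (g [^] d) (act g (p ! 1))" using pow g pV[of 1] N by (simp add: act_mult)
      finally show ?thesis using 0 joint rN pV[of 1] pV[of r] act_inj gd act_closed g N by simp
    qed
    then show ?thesis using A by blast
  qed
  then have "axis g l (int N)" using shift N by (simp add: axis_def line_def)
  then show ?thesis by blast
qed

text \<open>
From a vertex off the axis of \<open>g\<close>, the reduced walk to its image goes to the axis, along it, and
back out along the translated way.
\<close>

lemma reduced_detour:
  assumes g: "g \<in> carrier G" and l: "axis g l n" and n: "n > 0"
    and w: "reduced adj w" "length w \<ge> 2" "hd w = l i" "hd (tl w) \<noteq> l (i + 1)" "hd (tl w) \<noteq> l (i - 1)"
  shows "reduced adj (rev w @ tl (segment l i (nat n)) @ tl (map (act g) w))"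
proof -
  have ln: "line adj l" and sh: "\<And>i. act g (l i) = l (i + n)" using l by (auto simp: axis_def)
  obtain m where m: "nat n = Suc m" using n by (metis gr0_implies_Suc zero_less_nat_eq)
  have nm: "n = int m + 1" using m n by simp
  obtain a b w' where w': "w = a # b # w'" using w(2) by (cases w; cases "tl w") auto
  let ?s = "segment l i (nat n)"
  have s: "reduced adj ?s" using ln by (rule reduced_segment)
  have 1: "reduced adj (rev w @ tl ?s)"
    using w w' s m by (intro reduced_join reduced_reverse) (auto simp: butlast_append)
  have 2: "last (butlast (rev w @ tl ?s)) = l (i + n - 1)"
  proof (cases m)
    case 0 then show ?thesis using m nm w w' by (simp add: butlast_append)
  next
    case (Suc k)
    then show ?thesis using m nm segment_snoc[of l "i + 1" k] by (simp add: butlast_append algebra_simps)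
  qed
  have 3: "act g b \<noteq> l (i + n - 1)"
  proof
    assume "act g b = l (i + n - 1)"
    then have "act g b = act g (l (i - 1))" using sh[of "i - 1"] by (simp add: algebra_simps)
    moreover have "b \<in> V" using reduced_vertices[of w] w w' by auto
    ultimately show False using w w' act_inj[OF g _ line_vertex[OF ln]] by auto
  qed
  have 4: "last (rev w @ tl ?s) = act g (l i)" using m sh[of i] nm by (simp add: algebra_simps)
  have "reduced adj ((rev w @ tl ?s) @ tl (map (act g) w))"
  proof (rule reduced_join[OF 1])
    show "reduced adj (map (act g) w)" by (rule reduced_map_act[OF g w(1)])
    show "last (rev w @ tl ?s) = hd (map (act g) w)"
      unfolding 4 using w w' by simp
    show "last (butlast (rev w @ tl ?s)) \<noteq> hd (tl (map (act g) w))" using 2 3 w' by simp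
  qed (use w' in auto)
  then show ?thesis by simp
qed

text \<open>
Otherwise a shortest walk \<open>w\<close> joins the first line to a vertex \<open>v\<close> of the second. The reduced walk from
\<open>v\<close> to its image along \<open>w\<close>, the first line and the image of \<open>w\<close> must agree with the segment of the
second line. But it backtracks when followed by its own translate, and a line does not.
\<close>

lemma axis_subset:
  assumes g: "g \<in> carrier G" and l: "axis g l n" and n: "n > 0" and l': "axis g l' m" and m: "m > 0"
  shows "l' j \<in> range l"
proof (rule ccontr)
  assume out: "l' j \<notin> range l"
  have ln: "line adj l" "line adj l'" and sh: "\<And>i. act g (l' i) = l' (i + m)"
    using l l' by (auto simp: axis_def)
  let ?P = "\<lambda>w. reduced adj w \<and> w \<noteq> [] \<and> hd w \<in> range l \<and> last w = l' j"
  have "\<exists>w. ?P w" using reduced_exists line_vertex ln by (metis rangeI)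
  then obtain w where w: "?P w" and min: "\<And>q. ?P q \<Longrightarrow> length w \<le> length q"
    using ex_has_least_nat[of ?P _ length] by blast
  obtain i where i: "hd w = l i" using w by blast
  have "l i \<noteq> l' j" using out by (metis rangeI)
  then obtain a b w' where w': "w = a # b # w'" using w i by (cases w; cases "tl w") auto
  have "b \<notin> range l"
  proof
    assume "b \<in> range l"
    then have "?P (b # w')" using w w' by (auto dest: reduced_Cons split: if_splits)
    then show False using min w' by fastforce
  qed
  let ?p = "rev w @ tl (segment l i (nat n)) @ tl (map (act g) w)"
  let ?q = "segment l' j (nat m)"
  have "reduced adj ?p"
    using reduced_detour[OF g l n, of w i] w w' i \<open>b \<notin> range l\<close> by auto
  moreover have "hd ?p = l' j"
  proof -
    have "hd ?p = last w" using w' by (simp add: hd_append hd_rev)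
    then show ?thesis using w by simp
  qed
  moreover have "last ?p = act g (l' j)"
  proof -
    have "last ?p = last (map (act g) w)" using w' by simp
    then show ?thesis using w by (simp add: last_map)
  qed
  ultimately have pq: "?p = ?q"
    using m sh[of j] ln w' by (intro reduced_unique reduced_segment) auto
  obtain k where k: "nat m = Suc k" using m by (metis gr0_implies_Suc zero_less_nat_eq)
  have mk: "m = int k + 1" using k m by simp
  \<comment> \<open>\<open>z\<close> is the neighbour of the end of \<open>w\<close>; the walk \<open>?p\<close> backtracks when it is
    continued by its own \<open>g\<close>-translate, and the segment of a line does not.\<close>
  obtain u z where uz: "w = u @ [z, l' j]"
  proof -
    have "w = butlast w @ [l' j]" using w by (metis append_butlast_last_id)
    moreover have "butlast w = butlast (butlast w) @ [last (butlast w)]" using w' by simp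
    ultimately show thesis using that by (metis append.assoc append_Cons append_Nil)
  qed
  have "hd (tl ?p) = z" using uz by simp
  moreover have "hd (tl ?q) = l' (j + 1)" using k by simp
  ultimately have z1: "z = l' (j + 1)" using pq by simp
  have "last (butlast ?p) = act g z"
  proof (cases u)
    case Nil
    have "last (segment l i (nat n)) = act g (l i)" using l n by (simp add: axis_def)
    moreover have "tl (segment l i (nat n)) \<noteq> []"
      using n by (metis length_0_conv length_segment length_tl diff_Suc_1 zero_less_nat_eq less_numeral_extra(3))
    ultimately have "last (tl (segment l i (nat n))) = act g (l i)" by (simp add: last_tl)
    then show ?thesis
      using Nil uz i \<open>tl (segment l i (nat n)) \<noteq> []\<close> by (simp add: butlast_append)
  next
    case (Cons c u')
    then show ?thesis using uz by (simp add: butlast_append)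
  qed
  moreover have "last (butlast ?q) = l' (j + m - 1)"
    using segment_snoc[of l' j k] k mk by (simp add: algebra_simps del: segment.simps)
  ultimately have "act g z = l' (j + m - 1)" using pq by simp
  then have "l' (j + 1 + m) = l' (j + m - 1)" using z1 sh by simp
  then show False using line_inj[OF ln(2)] by simp
qed

text \<open>
A line contained in another one runs through it in steps of one and without turning back.
\<close>

lemma axis_unique:
  assumes g: "g \<in> carrier G" and l: "axis g l n" and l': "axis g l' m"
  shows "\<exists>c e. \<bar>e\<bar> = 1 \<and> (\<forall>i. l' i = l (c + e * i))"
proof -
  have ln: "line adj l" "line adj l'" using l l' by (auto simp: axis_def)
  have pos: "\<exists>k h. axis g k h \<and> h > 0 \<and> range k = range l" if "axis g l n" for l n
  proof (cases "n > 0")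
    case False
    have "range (\<lambda>i. l (- i)) = range l" by (auto simp: image_iff) (metis add.inverse_inverse)
    then show ?thesis using axis_reverse[OF that] that False
      by (intro exI[of _ "\<lambda>i. l (- i)"] exI[of _ "- n"]) (auto simp: axis_def)
  qed (use that in blast)
  obtain k h where k: "axis g k h" "h > 0" "range k = range l" using pos[OF l] by blast
  obtain k' h' where k': "axis g k' h'" "h' > 0" "range k' = range l'" using pos[OF l'] by blast
  have "k' j \<in> range k" for j using axis_subset[OF g k(1,2) k'(1,2)] .
  then have "range l' \<subseteq> range l" unfolding k(3)[symmetric] k'(3)[symmetric] by blast
  then have "\<forall>i. \<exists>j. l' i = l j" by blast
  then obtain f where f: "\<And>i. l' i = l (f i)" by metis
  have step: "\<bar>f (i + 1) - f i\<bar> = 1" for i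
    using line_adj[OF ln(1), of "f i" "f (i + 1)"] f ln(2) by (metis line_def)
  have nb: "f (i + 2) \<noteq> f i" for i using f ln(2) by (metis line_def)
  define e where "e = f 1 - f 0"
  have "f (i + 1) - f i = e" for i
  proof (induction i rule: int_induct[of _ 0])
    case base then show ?case by (simp add: e_def)
  next
    case (step1 i)
    then show ?case using step[of i] step[of "i + 1"] nb[of i] by (auto simp: add.assoc)
  next
    case (step2 i)
    then show ?case using step[of i] step[of "i - 1"] nb[of "i - 1"] by (auto simp: algebra_simps)
  qed
  then have d: "\<And>i. f (i + 1) = f i + e" by (simp add: algebra_simps)
  have fi: "f i = f 0 + e * i" for i
  proof (induction i rule: int_induct[of _ 0])
    case (step1 i) then show ?case using d[of i] by (simp add: algebra_simps)
  next
    case (step2 i) then show ?case using d[of "i - 1"] by (simp add: algebra_simps)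
  qed simp
  have "l' i = l (f 0 + e * i)" for i unfolding f fi[of i] ..
  moreover have "\<bar>e\<bar> = 1" using step[of 0] by (simp add: e_def)
  ultimately show ?thesis by blast
qed

text \<open>
An element commuting with \<open>g\<close> maps the axis of \<open>g\<close> to an axis of \<open>g\<close>, hence to itself. It cannot
reverse the axis, since a reversal does not commute with a nontrivial shift.
\<close>

lemma axis_centralizer:
  assumes g: "g \<in> carrier G" "h \<in> carrier G" "g \<otimes> h = h \<otimes> g" and l: "axis g l n"
  shows "\<exists>c. \<forall>i. act h (l i) = l (i + c)"
proof -
  have ln: "line adj l" and sh: "\<And>i. act g (l i) = l (i + n)" and n: "n \<noteq> 0"
    using l by (auto simp: axis_def)
  have com: "act g (act h v) = act h (act g v)" if "v \<in> V" for v
    using g that by (metis act_mult)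
  have "axis g (\<lambda>i. act h (l i)) n"
    unfolding axis_def using line_act ln g n com line_vertex sh by simp
  then obtain c e where e: "\<bar>e\<bar> = 1" and c: "\<And>i. act h (l i) = l (c + e * i)"
    using axis_unique[OF g(1) l] by blast
  have "act g (act h (l 0)) = act h (act g (l 0))" using com line_vertex ln by blast
  then have "l (c + n) = l (c + e * n)" using c sh by simp
  then have "e = 1" using line_inj[OF ln] n by auto
  then show ?thesis using c by (intro exI[of _ c]) (simp add: add.commute)
qed

text \<open>
  A nontrivial element fixing a vertex fixes a distinguished one: its fixed tree is a star around
  its only vertex on the side \<open>False\<close>, or else a single vertex.
\<close>

definition center :: "'a \<Rightarrow> 'v \<Rightarrow> bool" where
  "center g v \<longleftrightarrow> v \<in> V \<and> act g v = v \<and> (side v \<longrightarrow> (\<forall>w\<in>V. act g w = w \<longrightarrow> side w))"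

text \<open>
The trace of the malnormality of the edge group in the group of type \<open>True\<close>.
\<close>

definition fixes_one_edge :: bool where
  "fixes_one_edge \<longleftrightarrow> (\<forall>g\<in>carrier G. \<forall>u v w. g \<noteq> \<one> \<longrightarrow> side u \<longrightarrow> adj u v \<longrightarrow> adj u w \<longrightarrow>
     act g u = u \<longrightarrow> act g v = v \<longrightarrow> act g w = w \<longrightarrow> v = w)"

text \<open>
The walk between two fixed vertices is fixed. If both lie on the side \<open>False\<close>, its second vertex lies
on the side \<open>True\<close> and has two different fixed edges.
\<close>

lemma fixed_unique_False_side:
  assumes one_edge: fixes_one_edge and g: "g \<in> carrier G" "g \<noteq> \<one>"
    and uv: "u \<in> V" "v \<in> V" "act g u = u" "act g v = v" "\<not> side u" "\<not> side v"
  shows "u = v"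
proof (rule ccontr)
  assume "u \<noteq> v"
  obtain p where p: "reduced adj p" "p \<noteq> []" "hd p = u" "last p = v"
    using reduced_exists[OF uv(1,2)] by blast
  then obtain w p' where w: "p = u # w # p'" using \<open>u \<noteq> v\<close> by (cases p; cases "tl p") auto
  have a: "adj u w" using reduced_first[of adj u w p'] p w by simp
  then have "side w" using adj_side uv by blast
  then obtain x p'' where x: "p' = x # p''" using p w uv by (cases p') auto
  have "adj w x" "u \<noteq> x" using p w x by (auto dest: reduced_first)
  moreover have "act g w = w" "act g x = x"
    using fixes_walk[OF g(1) p(1,2)] p uv w x by auto
  ultimately show False
    using one_edge g \<open>side w\<close> adj_sym[OF a] uv(3) unfolding fixes_one_edge_def by blast
qed

lemma fixed_unique_True_side:
  assumes g: "g \<in> carrier G" and only: "\<And>w. w \<in> V \<Longrightarrow> act g w = w \<Longrightarrow> side w"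
    and uv: "u \<in> V" "v \<in> V" "act g u = u" "act g v = v"
  shows "u = v"
proof (rule ccontr)
  assume "u \<noteq> v"
  obtain p where p: "reduced adj p" "p \<noteq> []" "hd p = u" "last p = v"
    using reduced_exists[OF uv(1,2)] by blast
  then obtain w p' where w: "p = u # w # p'" using \<open>u \<noteq> v\<close> by (cases p; cases "tl p") auto
  have a: "adj u w" using reduced_first[of adj u w p'] p w by simp
  have "act g w = w" using fixes_walk[OF g p(1,2)] p uv w by auto
  then have "side w" using only adj_vertex adj_sym a by blast
  moreover have "side u" using only uv by blast
  ultimately show False using adj_side[OF a] by blast
qed

lemma center_unique:
  assumes "fixes_one_edge" "g \<in> carrier G" "g \<noteq> \<one>" "center g u" "center g v"
  shows "u = v"
proof (cases "\<exists>w\<in>V. act g w = w \<and> \<not> side w")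
  case True
  then show ?thesis using assms fixed_unique_False_side[OF assms(1-3)] by (metis center_def)
next
  case False
  then show ?thesis using assms fixed_unique_True_side[OF assms(2)] by (metis center_def)
qed

lemma center_exists:
  assumes "v \<in> V" "act g v = v" shows "\<exists>w. center g w"
  using assms unfolding center_def by metis

lemma center_conjugate:
  assumes "fixes_one_edge" "a \<in> carrier G" "b \<in> carrier G" "x \<in> carrier G" "b \<noteq> \<one>"
    and eq: "x \<otimes> b = a \<otimes> x" and b: "center b v"
  shows "center a (act x v)"
proof -
  have v: "v \<in> V" "act b v = v" using b by (auto simp: center_def)
  have "act a (act x v) = act x (act b v)" using assms v by (metis act_mult)
  then have 1: "act a (act x v) = act x v" using v by simp
  have "side w" if "side (act x v)" "w \<in> V" "act a w = w" for w
  proof -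
    let ?u = "act (inv x) w"
    have u: "?u \<in> V" "act x ?u = w"
      using that assms(4) act_closed act_mult[of x "inv x" w] act_one by auto
    have "act x (act b ?u) = act a (act x ?u)" using assms u by (metis act_mult)
    then have "act b ?u = ?u" using u that act_inj[OF assms(4)] act_closed[OF assms(3)] by metis
    then have "side ?u" using b that u v act_side[OF assms(4)] by (metis center_def)
    then show ?thesis using u act_side[OF assms(4)] by metis
  qed
  then show ?thesis using 1 v act_closed[OF assms(4)] by (auto simp: center_def)
qed

text \<open>
The case of \<open>center_conjugate\<close> in which \<open>h\<close> conjugates \<open>g\<close> to itself.
\<close>

lemma center_centralizer:
  assumes "fixes_one_edge" "g \<in> carrier G" "h \<in> carrier G" "g \<noteq> \<one>" "g \<otimes> h = h \<otimes> g" "center g v"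
  shows "act h v = v"
  using center_unique[OF assms(1,2,4) _ assms(6)]
    center_conjugate[OF assms(1,2,2,3,4) assms(5)[symmetric] assms(6)] by blast

lemma center_commuting:
  assumes one: "fixes_one_edge" and g: "g \<in> carrier G" "h \<in> carrier G" "g \<noteq> \<one>" "h \<noteq> \<one>"
    "g \<otimes> h = h \<otimes> g" and c: "center g v"
  shows "center h v"
proof -
  have v: "v \<in> V" "act g v = v" using c by (auto simp: center_def)
  have hv: "act h v = v" using center_centralizer[OF one g(1,2,3,5) c] .
  have "side w" if "side v" "w \<in> V" "act h w = w" for w
  proof (rule ccontr)
    assume "\<not> side w"
    then have "center h w" using that by (simp add: center_def)
    then have "act g w = w" using center_centralizer[OF one g(2,1,4)] g(5) by simp
    then show False using c that \<open>\<not> side w\<close> by (auto simp: center_def)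
  qed
  then show ?thesis using v hv by (auto simp: center_def)
qed

text \<open>
Among any four consecutive vertices of a line two distinct ones lie on the side \<open>False\<close>.
\<close>

lemma fixes_line_imp_one:
  assumes one: "fixes_one_edge" and g: "g \<in> carrier G" and l: "line adj l"
    and fixed: "\<And>i. act g (l i) = l i"
  shows "g = \<one>"
proof (rule ccontr)
  assume ne: "g \<noteq> \<one>"
  have a: "adj (l 0) (l 1)" "adj (l 1) (l 2)" "adj (l 2) (l 3)" "l 0 \<noteq> l 2"
  proof -
    have "adj (l i) (l (i + 1))" for i using l by (simp add: line_def)
    from this[of 0] this[of 1] this[of 2]
    show "adj (l 0) (l 1)" "adj (l 1) (l 2)" "adj (l 2) (l 3)" by simp_all
  qed (use line_inj[OF l] in simp)
  have V: "l i \<in> V" for i using line_vertex[OF l] .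
  show False
  proof (cases "side (l 0)")
    case True
    then have "\<not> side (l 1)" "side (l 2)" using adj_side a by blast+
    then have "\<not> side (l 3)" using adj_side a by blast
    then have "l 1 = l 3"
      using fixed_unique_False_side[OF one g ne V V] fixed \<open>\<not> side (l 1)\<close> by blast
    then show False using line_inj[OF l] by simp
  next
    case False
    then have "\<not> side (l 2)" using adj_side a by blast
    then have "l 0 = l 2"
      using fixed_unique_False_side[OF one g ne V V] fixed False by blast
    then show False using a by simp
  qed
qed

definition stabilizer_monoid :: "'v \<Rightarrow> ('a, 'b) monoid_scheme" where
  "stabilizer_monoid v = G\<lparr>carrier := {g \<in> carrier G. act g v = v}\<rparr>"

text \<open>
An element without fixed vertices shifts its axis and so has infinite order.
\<close>

lemma involution_free_tree:
  assumes stab: "\<And>v. v \<in> V \<Longrightarrow> involution_free (stabilizer_monoid v)"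
  shows "involution_free G"
  unfolding involution_free_def
proof (intro ballI impI)
  fix g assume g: "g \<in> carrier G" "g \<otimes> g = \<one>"
  show "g = \<one>"
  proof (cases "\<exists>v\<in>V. act g v = v")
    case True
    then show ?thesis using stab g by (auto simp: involution_free_def stabilizer_monoid_def)
  next
    case False
    then obtain l n where "axis g l n" using axis_exists g by blast
    then have l: "line adj l" "n \<noteq> 0" "\<And>i. act g (l i) = l (i + n)" by (auto simp: axis_def)
    have "act (g \<otimes> g) (l 0) = l (n + n)" using g(1) l line_vertex[OF l(1)] by (simp add: act_mult)
    then have "l 0 = l (n + n)" using g(2) act_one line_vertex[OF l(1)] by simp
    then show ?thesis using line_inj[OF l(1)] l(2) by simp
  qed
qed

text \<open>
If \<open>a\<close> fixes a vertex, then \<open>a\<close>, \<open>y\<close> and \<open>b\<close> have the same distinguished fixed vertex and \<open>x\<close> fixes it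
too, so the law holds because it does in the stabilizer. Otherwise \<open>a\<close>, \<open>y\<close> and \<open>b\<close> have a common axis,
\<open>x\<close> preserves it, and an element that reverses it would be an involution.
\<close>

lemma csa_law_tree:
  assumes one: "fixes_one_edge"
    and stab: "\<And>v. v \<in> V \<Longrightarrow> csa_law (stabilizer_monoid v)"
    and inv: "involution_free G"
  shows "csa_law G"
  unfolding csa_law_def
proof (intro ballI impI)
  fix a b x y
  assume car: "a \<in> carrier G" "b \<in> carrier G" "x \<in> carrier G" "y \<in> carrier G"
    and ne: "a \<noteq> \<one>" "y \<noteq> \<one>" and ay: "a \<otimes> y = y \<otimes> a" and xb: "x \<otimes> b = a \<otimes> x"
    and by': "b \<otimes> y = y \<otimes> b"
  have "b \<noteq> \<one>" using xb ne car by auto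
  show "a \<otimes> x = x \<otimes> a"
  proof (cases "\<exists>v\<in>V. act a v = v")
    case True
    then obtain v where v: "center a v" using center_exists by blast
    then have y: "center y v" using center_commuting[OF one] car ne ay by blast
    then have b: "center b v" using center_commuting[OF one car(4,2)] ne \<open>b \<noteq> \<one>\<close> by' by simp
    then have "act x v = v"
      using center_conjugate[OF one car(1,2,3) \<open>b \<noteq> \<one>\<close> xb] center_unique[OF one car(1) ne(1)] v by blast
    moreover have "v \<in> V" "act a v = v" "act y v = v" "act b v = v"
      using v y b unfolding center_def by blast+
    ultimately show ?thesis
      using csa_lawD[OF stab, of v a b x y] car ne ay xb by' by (simp add: stabilizer_monoid_def)
  next
    case False
    then obtain l n where l: "axis a l n" using axis_exists car by blast
    have ln: "line adj l" and sh: "\<And>i. act a (l i) = l (i + n)" using l by (auto simp: axis_def)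
    have V: "l i \<in> V" for i using line_vertex[OF ln] .
    obtain c where c: "\<And>i. act y (l i) = l (i + c)"
      using axis_centralizer[OF car(1,4) ay l] by blast
    have "c \<noteq> 0" using fixes_line_imp_one[OF one car(4) ln] c ne by auto
    then have yl: "axis y l c" using ln c by (simp add: axis_def)
    obtain d where d: "\<And>i. act b (l i) = l (i + d)"
      using axis_centralizer[OF car(4,2) by'[symmetric] yl] by blast
    have "d \<noteq> 0" using fixes_line_imp_one[OF one car(2) ln] d \<open>b \<noteq> \<one>\<close> by auto
    then have bl: "axis b l d" using ln d by (simp add: axis_def)
    have a_xb: "act a (act x u) = act x (act b u)" if "u \<in> V" for u
      using that car xb by (metis act_mult)
    \<comment> \<open>\<open>x\<close> carries the axis of \<open>b\<close>, which is the axis of \<open>a\<close>, to the axis of \<open>a\<close>.\<close>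
    have "axis a (\<lambda>i. act x (l i)) d"
      using line_act[OF ln car(3)] a_xb V d \<open>d \<noteq> 0\<close> by (simp add: axis_def)
    then obtain s e where e: "\<bar>e\<bar> = 1" and s: "\<And>i. act x (l i) = l (s + e * i)"
      using axis_unique[OF car(1) l] by blast
    have e': "e = 1 \<or> e = - 1" using e by arith
    show ?thesis
    proof (cases "e = 1")
      case True
      let ?g = "inv (a \<otimes> x) \<otimes> (x \<otimes> a)"
      have "act (x \<otimes> a) (l i) = act (a \<otimes> x) (l i)" for i
        using car V s sh True by (simp add: act_mult algebra_simps)
      moreover have "act (inv (a \<otimes> x)) (act (a \<otimes> x) (l i)) = l i" for i
        using car V[of i] act_mult[of "inv (a \<otimes> x)" "a \<otimes> x" "l i"] act_one by simp
      ultimately have "act ?g (l i) = l i" for i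
        using car V[of i] act_mult[of "inv (a \<otimes> x)" "x \<otimes> a" "l i"] by simp
      then have "?g = \<one>" using fixes_line_imp_one[OF one _ ln, of ?g] car by simp
      then show ?thesis using car by (metis inv_equality inv_inv m_closed inv_closed)
    next
      case False
      then have "e = - 1" using e' by simp
      then have "act (x \<otimes> x) (l i) = l i" for i
        using car V s by (simp add: act_mult algebra_simps)
      then have "x \<otimes> x = \<one>" using fixes_line_imp_one[OF one _ ln, of "x \<otimes> x"] car by simp
      then have "x = \<one>" using inv car(3) unfolding involution_free_def by blast
      then show ?thesis using car by simp
    qed
  qed
qed

end

section \<open>Amalgams and their Bass-Serre trees\<close>

text \<open>
The letters lie in turn in \<open>K s\<close> and in \<open>K (\<not> s)\<close>, always outside \<open>C\<close>, beginning with \<open>K s\<close>. Indexing the two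
factors by truth values lets one statement serve both of them.
\<close>

fun alternating :: "(bool \<Rightarrow> 'a set) \<Rightarrow> 'a set \<Rightarrow> bool \<Rightarrow> 'a list \<Rightarrow> bool" where
  "alternating K C s [] = True"
| "alternating K C s (x # l) = (x \<in> K s - C \<and> alternating K C (\<not> s) l)"

text \<open>
An internal amalgam. The normal form theorem for amalgamated products serves as a definition:
no alternating product of positive length lies in the amalgamated subgroup.
\<close>

locale amalgam = group G for G (structure) +
  fixes K :: "bool \<Rightarrow> 'a set" and C :: "'a set"
  assumes factor: "subgroup (K s) G"
    and base: "C = K True \<inter> K False"
    and generated: "generate G (K True \<union> K False) = carrier G"
    and normal_form: "l \<noteq> [] \<Longrightarrow> alternating K C s l \<Longrightarrow> foldr (\<otimes>) l \<one> \<notin> C"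
begin

lemma factor_carrier: "k \<in> K s \<Longrightarrow> k \<in> carrier G"
  using factor by (rule subgroup.mem_carrier)

lemma in_base_iff: "k \<in> C \<longleftrightarrow> k \<in> K s \<and> k \<in> K (\<not> s)"
  using base by (cases s) auto

lemma coset_eq_iff:
  assumes "g \<in> carrier G" "h \<in> carrier G"
  shows "g <# K s = h <# K s \<longleftrightarrow> (\<exists>k\<in>K s. h = g \<otimes> k)"
proof
  assume eq: "g <# K s = h <# K s"
  have "h \<otimes> \<one> \<in> h <# K s" using subgroup.one_closed[OF factor] unfolding l_coset_def by blast
  then have "h \<in> g <# K s" using eq assms by simp
  then show "\<exists>k\<in>K s. h = g \<otimes> k" unfolding l_coset_def by blast
next
  assume "\<exists>k\<in>K s. h = g \<otimes> k"
  then have "h \<in> g <# K s" unfolding l_coset_def by blast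
  then show "g <# K s = h <# K s" using assms(1) factor by (rule l_repr_independence)
qed

text \<open>
The vertices of the Bass-Serre tree are the left cosets of the two factors, with a mark telling which
factor is meant. Its edges are the left cosets of \<open>C\<close>; the edge of \<open>g\<close> joins the two cosets that
contain \<open>g\<close>.
\<close>

definition vertices :: "(bool \<times> 'a set) set" where
  "vertices = {(s, g <# K s) | s g. g \<in> carrier G}"

definition adjacent :: "bool \<times> 'a set \<Rightarrow> bool \<times> 'a set \<Rightarrow> bool" where
  "adjacent u v \<longleftrightarrow> (\<exists>s. \<exists>g\<in>carrier G. u = (s, g <# K s) \<and> v = (\<not> s, g <# K (\<not> s)))"

definition translate :: "'a \<Rightarrow> bool \<times> 'a set \<Rightarrow> bool \<times> 'a set" where
  "translate g u = (fst u, g <# snd u)"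

lemma translate_vertex:
  "g \<in> carrier G \<Longrightarrow> x \<in> carrier G \<Longrightarrow> translate g (s, x <# K s) = (s, (g \<otimes> x) <# K s)"
  using lcos_m_assoc subgroup.subset[OF factor] by (simp add: translate_def)

lemma adjacent_sym: "adjacent u v \<Longrightarrow> adjacent v u"
  unfolding adjacent_def by force

lemma adjacent_vertices: "adjacent u v \<Longrightarrow> u \<in> vertices"
  unfolding adjacent_def vertices_def by blast

lemma adjacentI: "g \<in> carrier G \<Longrightarrow> adjacent (s, g <# K s) (\<not> s, g <# K (\<not> s))"
  unfolding adjacent_def by blast

lemma adjacentE:
  assumes "adjacent (s, X) v"
  obtains g where "g \<in> carrier G" "X = g <# K s" "v = (\<not> s, g <# K (\<not> s))"
  using assms unfolding adjacent_def by blast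

lemma translate_adjacent:
  "g \<in> carrier G \<Longrightarrow> adjacent u v \<Longrightarrow> adjacent (translate g u) (translate g v)"
  unfolding adjacent_def by (metis m_closed translate_vertex)

lemma alternating_carrier: "alternating K C s l \<Longrightarrow> foldr (\<otimes>) l \<one> \<in> carrier G"
  by (induction l arbitrary: s) (auto intro: factor_carrier)

text \<open>
Consecutive edges of a reduced walk differ by an element of a factor outside \<open>C\<close>, so walking
multiplies the first edge by an alternating product.
\<close>

lemma walk_product:
  assumes "reduced adjacent (u # v # p)" "u = (s, x <# K s)" "v = (\<not> s, x <# K (\<not> s))" "x \<in> carrier G"
  shows "\<exists>l. alternating K C (\<not> s) l \<and> length l = length p \<and>
    last (u # v # p) = (s = odd (length p), (x \<otimes> foldr (\<otimes>) l \<one>) <# K (s = odd (length p)))"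
  using assms
proof (induction p arbitrary: u v s x)
  case Nil
  then show ?case by (intro exI[of _ "[]"]) (auto simp: l_coset_def)
next
  case (Cons w p)
  have "adjacent (\<not> s, x <# K (\<not> s)) w" using Cons.prems reduced_first by force
  then obtain g where g: "g \<in> carrier G" "x <# K (\<not> s) = g <# K (\<not> s)" "w = (s, g <# K s)"
    by (auto elim: adjacentE)
  then obtain k where k: "k \<in> K (\<not> s)" "g = x \<otimes> k" using coset_eq_iff Cons.prems(4) by blast
  have "u \<noteq> w" using Cons.prems(1) by simp
  then have "x <# K s \<noteq> g <# K s" using g Cons.prems(2) by simp
  then have "k \<notin> K s" using coset_eq_iff[OF Cons.prems(4) g(1)] k(2) by blast
  then have kC: "k \<in> K (\<not> s) - C" using k in_base_iff by blast
  have red: "reduced adjacent (v # w # p)" by (rule reduced_Cons[OF Cons.prems(1)])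
  have "w = (\<not> \<not> s, g <# K (\<not> \<not> s))" "v = (\<not> s, g <# K (\<not> s))" using g Cons.prems(3) by simp_all
  from Cons.IH[OF red this(2,1) g(1)] obtain l
    where l: "alternating K C (\<not> \<not> s) l" "length l = length p"
      "last (v # w # p) = ((\<not> s) = odd (length p), (g \<otimes> foldr (\<otimes>) l \<one>) <# K ((\<not> s) = odd (length p)))"
    by blast
  have "x \<otimes> (k \<otimes> foldr (\<otimes>) l \<one>) = g \<otimes> foldr (\<otimes>) l \<one>"
    using k factor_carrier[OF k(1)] alternating_carrier[OF l(1)] Cons.prems(4) by (simp add: m_assoc)
  moreover have "((\<not> s) = odd (length p)) = (s = odd (length (w # p)))" by auto
  ultimately show ?case using l kC by (intro exI[of _ "k # l"]) simp
qed

text \<open>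
A reduced closed walk would give an alternating product in the factor \<open>K s\<close> that begins with a letter of
the other factor. Either it lies in \<open>C\<close>, or its inverse prolongs it to an alternating product with
value one.
\<close>

lemma no_reduced_circuit:
  assumes "reduced adjacent p" "2 \<le> length p" shows "hd p \<noteq> last p"
proof
  assume eq: "hd p = last p"
  obtain u v q where p: "p = u # v # q" using assms(2) by (cases p; cases "tl p") auto
  have "adjacent u v" using reduced_first[of adjacent u v q] p assms by simp
  then obtain s x where x: "x \<in> carrier G" "u = (s, x <# K s)" "v = (\<not> s, x <# K (\<not> s))"
    unfolding adjacent_def by blast
  obtain l where l: "alternating K C (\<not> s) l" "length l = length q"
    "last p = (s = odd (length q), (x \<otimes> foldr (\<otimes>) l \<one>) <# K (s = odd (length q)))"
    using walk_product[of u v q s x] assms p x by auto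
  have "odd (length q)" and co: "x <# K s = (x \<otimes> foldr (\<otimes>) l \<one>) <# K s" using eq l(3) p x by auto
  let ?k = "foldr (\<otimes>) l \<one>"
  have kc: "?k \<in> carrier G" using alternating_carrier[OF l(1)] .
  have "l \<noteq> []" using \<open>odd (length q)\<close> l(2) by auto
  then have kC: "?k \<notin> C" using normal_form l(1) by blast
  obtain k where "k \<in> K s" "x \<otimes> ?k = x \<otimes> k" using co coset_eq_iff[of x "x \<otimes> ?k" s] x(1) kc by auto
  then have "?k \<in> K s" using x(1) kc factor_carrier by simp
  then have "inv ?k \<in> K s" "?k \<in> K s" by (auto intro: subgroup.m_inv_closed[OF factor])
  moreover have "inv ?k \<notin> C"
    using kC in_base_iff[of _ s] \<open>?k \<in> K s\<close> subgroup.m_inv_closed[OF factor, of "inv ?k"] kc by fastforce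
  ultimately have "alternating K C s (inv ?k # l)" using l(1) by simp
  then have "foldr (\<otimes>) (inv ?k # l) \<one> \<notin> C" using normal_form by blast
  moreover have "\<one> \<in> C" using base subgroup.one_closed[OF factor] by simp
  ultimately show False using kc by simp
qed

lemma rtranclp_adjacent_translate:
  "adjacent\<^sup>*\<^sup>* u v \<Longrightarrow> g \<in> carrier G \<Longrightarrow> adjacent\<^sup>*\<^sup>* (translate g u) (translate g v)"
  by (induction rule: rtranclp_induct) (auto intro: rtranclp.rtrancl_into_rtrancl translate_adjacent)

lemma rtranclp_adjacent_sym: "adjacent\<^sup>*\<^sup>* u v \<Longrightarrow> adjacent\<^sup>*\<^sup>* v u"
  using adjacent_sym by (metis sympD sympI symp_rtranclp)

text \<open>
The elements that move the base vertex within its component form a subgroup. It contains both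
factors, since each of them fixes an end of the base edge.
\<close>

lemma tree_connected:
  assumes "u \<in> vertices" "v \<in> vertices" shows "adjacent\<^sup>*\<^sup>* u v"
proof -
  let ?o = "(True, \<one> <# K True)"
  define R where "R = {g \<in> carrier G. adjacent\<^sup>*\<^sup>* ?o (True, g <# K True)}"
  have T: "translate g (True, h <# K True) = (True, (g \<otimes> h) <# K True)"
    if "g \<in> carrier G" "h \<in> carrier G" for g h using that by (rule translate_vertex)
  have "subgroup R G"
  proof (rule subgroupI)
    show "R \<subseteq> carrier G" by (auto simp: R_def)
    have "\<one> \<in> R" by (simp add: R_def)
    then show "R \<noteq> {}" by blast
  next
    fix g assume g: "g \<in> R"
    then have "adjacent\<^sup>*\<^sup>* (translate (inv g) ?o) (translate (inv g) (True, g <# K True))"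
      by (intro rtranclp_adjacent_translate) (auto simp: R_def)
    then show "inv g \<in> R" using g T by (auto simp: R_def intro: rtranclp_adjacent_sym)
  next
    fix g h assume g: "g \<in> R" "h \<in> R"
    then have "adjacent\<^sup>*\<^sup>* (translate g ?o) (translate g (True, h <# K True))"
      by (intro rtranclp_adjacent_translate) (auto simp: R_def)
    then show "g \<otimes> h \<in> R" using g T by (auto simp: R_def intro: rtranclp_trans)
  qed
  moreover have "K s \<subseteq> R" for s
  proof
    fix k assume k: "k \<in> K s"
    then have kc: "k \<in> carrier G" by (rule factor_carrier)
    have eq: "\<one> <# K s = k <# K s" using coset_eq_iff[of \<one> k s] k kc by (metis l_one one_closed)
    show "k \<in> R"
    proof (cases s)
      case True then show ?thesis using eq kc by (simp add: R_def)
    next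
      case False
      have "adjacent ?o (False, \<one> <# K False)" using adjacentI[of \<one> True] by simp
      moreover have "adjacent (False, k <# K False) (True, k <# K True)" using adjacentI[OF kc, of False] by simp
      ultimately show ?thesis using eq kc False
        by (auto simp: R_def intro: converse_rtranclp_into_rtranclp)
    qed
  qed
  ultimately have "generate G (K True \<union> K False) \<subseteq> R" by (intro generate_subgroup_incl) auto
  then have R: "carrier G \<subseteq> R" using generated by simp
  have "adjacent\<^sup>*\<^sup>* ?o w" if "w \<in> vertices" for w
  proof -
    obtain s g where w: "w = (s, g <# K s)" "g \<in> carrier G" using \<open>w \<in> vertices\<close> by (auto simp: vertices_def)
    then have 1: "adjacent\<^sup>*\<^sup>* ?o (True, g <# K True)" using R by (auto simp: R_def)
    show ?thesis
    proof (cases s)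
      case True then show ?thesis using 1 w by simp
    next
      case False
      then show ?thesis using 1 w adjacentI[of g True] by (auto intro: rtranclp.rtrancl_into_rtrancl)
    qed
  qed
  then show ?thesis using assms rtranclp_adjacent_sym by (meson rtranclp_trans)
qed

sublocale tree: tree_action G vertices adjacent fst translate
proof
  show "adjacent u v \<Longrightarrow> fst u \<noteq> fst v" for u v by (auto simp: adjacent_def)
  show "vertices \<noteq> {}" by (auto simp: vertices_def)
  show "g \<in> carrier G \<Longrightarrow> v \<in> vertices \<Longrightarrow> translate g v \<in> vertices" for g v
    unfolding vertices_def using translate_vertex by force
  show "v \<in> vertices \<Longrightarrow> translate \<one> v = v" for v
    unfolding vertices_def using translate_vertex by force
  show "g \<in> carrier G \<Longrightarrow> h \<in> carrier G \<Longrightarrow> v \<in> vertices \<Longrightarrow> translate (g \<otimes> h) v = translate g (translate h v)" for g h v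
    unfolding vertices_def using translate_vertex m_assoc by force
  show "fst (translate g v) = fst v" for g v by (simp add: translate_def)
qed (fact adjacent_vertices adjacent_sym tree_connected no_reduced_circuit translate_adjacent)+

lemma translate_fixes_iff:
  assumes "g \<in> carrier G" "x \<in> carrier G"
  shows "translate g (s, x <# K s) = (s, x <# K s) \<longleftrightarrow> inv x \<otimes> (g \<otimes> x) \<in> K s"
proof -
  have "translate g (s, x <# K s) = (s, x <# K s) \<longleftrightarrow> x <# K s = (g \<otimes> x) <# K s"
    using assms translate_vertex by auto
  also have "\<dots> \<longleftrightarrow> (\<exists>k\<in>K s. g \<otimes> x = x \<otimes> k)" using assms coset_eq_iff by simp
  also have "\<dots> \<longleftrightarrow> inv x \<otimes> (g \<otimes> x) \<in> K s"
    using assms factor_carrier by (metis inv_solve_left m_closed)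
  finally show ?thesis .
qed

text \<open>
Two edges at a vertex of type \<open>True\<close> differ by some \<open>k\<close> in this factor. An element fixing both is, up to
conjugation, an element of \<open>C\<close> whose conjugate by \<open>k\<close> is in \<open>C\<close> again, so \<open>k\<close> is in \<open>C\<close> and the
edges are equal.
\<close>

lemma fixes_one_edge:
  assumes mal: "malnormal C (G\<lparr>carrier := K True\<rparr>)"
  shows "tree.fixes_one_edge"
  unfolding tree.fixes_one_edge_def
proof (intro ballI allI impI)
  fix g u v w
  assume g: "g \<in> carrier G" "g \<noteq> \<one>" and u: "fst u" and uv: "adjacent u v" and uw: "adjacent u w"
    and fixed: "translate g u = u" "translate g v = v" "translate g w = w"
  interpret A: group "G\<lparr>carrier := K True\<rparr>" using factor by (rule subgroup_imp_group)
  obtain X where X: "u = (True, X)" using u by (cases u) auto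
  obtain x where x: "x \<in> carrier G" "X = x <# K True" "v = (False, x <# K False)"
    using adjacentE[of True X v] uv X by auto
  obtain y where y: "y \<in> carrier G" "X = y <# K True" "w = (False, y <# K False)"
    using adjacentE[of True X w] uw X by auto
  obtain k where k: "k \<in> K True" "y = x \<otimes> k" using coset_eq_iff[OF x(1) y(1)] x y by metis
  have kc: "k \<in> carrier G" using k factor_carrier by blast
  let ?h = "inv x \<otimes> (g \<otimes> x)" and ?h' = "inv y \<otimes> (g \<otimes> y)"
  have h: "?h \<in> C"
    using fixed(1,2) X x translate_fixes_iff[OF g(1) x(1)] by (simp add: base)
  have h': "?h' \<in> C"
    using fixed(1,3) X y translate_fixes_iff[OF g(1) y(1)] by (simp add: base)
  have "?h \<otimes> k = k \<otimes> ?h'"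
    using g x y k kc by (simp add: m_assoc inv_mult_group)
      (simp add: m_assoc[symmetric])
  moreover have "?h \<noteq> \<one>"
  proof
    assume "?h = \<one>"
    then have "g \<otimes> x = x" using g x by (metis inv_solve_left m_closed one_closed r_one)
    then show False using g x by simp
  qed
  ultimately have "k \<in> C" using A.malnormalD[OF mal, of k ?h ?h'] h h' k by simp
  then have "k \<in> K False" by (simp add: base)
  then show "v = w" using x y k coset_eq_iff[OF x(1) y(1)] by auto
qed

lemma stabilizer_law:
  assumes "v \<in> vertices" and law: "\<And>s. csa_law (G\<lparr>carrier := K s\<rparr>) \<and> involution_free (G\<lparr>carrier := K s\<rparr>)"
  shows "csa_law (tree.stabilizer_monoid v) \<and> involution_free (tree.stabilizer_monoid v)"
proof -
  obtain s x where v: "v = (s, x <# K s)" and x: "x \<in> carrier G"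
    using assms(1) by (auto simp: vertices_def)
  have car: "carrier (tree.stabilizer_monoid v) = {g \<in> carrier G. inv x \<otimes> (g \<otimes> x) \<in> K s}"
    using v x translate_fixes_iff by (auto simp: tree.stabilizer_monoid_def)
  have conj_mult: "inv x \<otimes> (g \<otimes> h \<otimes> x) = inv x \<otimes> (g \<otimes> x) \<otimes> (inv x \<otimes> (h \<otimes> x))"
    if "g \<in> carrier G" "h \<in> carrier G" for g h
  proof -
    have "inv x \<otimes> (g \<otimes> x) \<otimes> (inv x \<otimes> (h \<otimes> x)) = inv x \<otimes> (g \<otimes> (x \<otimes> inv x \<otimes> (h \<otimes> x)))"
      using that x by (simp only: m_assoc m_closed inv_closed)
    then show ?thesis using that x by (simp add: m_assoc)
  qed
  have conj_inj: "g = h" if "inv x \<otimes> (g \<otimes> x) = inv x \<otimes> (h \<otimes> x)" "g \<in> carrier G" "h \<in> carrier G" for g h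
    using that x by simp
  have "subgroup (carrier (tree.stabilizer_monoid v)) G"
  proof (rule subgroupI)
    show "carrier (tree.stabilizer_monoid v) \<noteq> {}"
      unfolding car using x subgroup.one_closed[OF factor, of s] by (intro ex_in_conv[THEN iffD1] exI[of _ \<one>]) simp
    fix g assume "g \<in> carrier (tree.stabilizer_monoid v)"
    then have g: "g \<in> carrier G" "translate g v = v" by (auto simp: tree.stabilizer_monoid_def)
    have "translate (inv g) (translate g v) = v"
      using tree.act_mult[of "inv g" g v] tree.act_one assms(1) g by simp
    then show "inv g \<in> carrier (tree.stabilizer_monoid v)" using g by (simp add: tree.stabilizer_monoid_def)
  next
    fix g h assume "g \<in> carrier (tree.stabilizer_monoid v)" "h \<in> carrier (tree.stabilizer_monoid v)"
    then show "g \<otimes> h \<in> carrier (tree.stabilizer_monoid v)"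
      using assms(1) by (auto simp: tree.stabilizer_monoid_def tree.act_mult)
  qed (auto simp: car)
  then have "group (tree.stabilizer_monoid v)"
    using subgroup_imp_group by (simp add: tree.stabilizer_monoid_def)
  moreover have "(\<lambda>g. inv x \<otimes> (g \<otimes> x)) \<in> hom (tree.stabilizer_monoid v) (G\<lparr>carrier := K s\<rparr>)"
  proof (rule homI)
    fix g h assume gh: "g \<in> carrier (tree.stabilizer_monoid v)" "h \<in> carrier (tree.stabilizer_monoid v)"
    then show "inv x \<otimes> (g \<otimes> x) \<in> carrier (G\<lparr>carrier := K s\<rparr>)" by (simp add: car)
    have "g \<otimes>\<^bsub>tree.stabilizer_monoid v\<^esub> h = g \<otimes> h" by (simp add: tree.stabilizer_monoid_def)
    then show "inv x \<otimes> (g \<otimes>\<^bsub>tree.stabilizer_monoid v\<^esub> h \<otimes> x) =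
      inv x \<otimes> (g \<otimes> x) \<otimes>\<^bsub>G\<lparr>carrier := K s\<rparr>\<^esub> (inv x \<otimes> (h \<otimes> x))"
      using gh conj_mult by (simp add: car)
  qed
  moreover have "inj_on (\<lambda>g. inv x \<otimes> (g \<otimes> x)) (carrier (tree.stabilizer_monoid v))"
    using conj_inj by (intro inj_onI) (auto simp: car)
  ultimately show ?thesis
    using csa_law_involution_free_mono subgroup_imp_group[OF factor] law by blast
qed

theorem csa_law_amalgam:
  assumes "malnormal C (G\<lparr>carrier := K True\<rparr>)"
    and "\<And>s. csa_law (G\<lparr>carrier := K s\<rparr>) \<and> involution_free (G\<lparr>carrier := K s\<rparr>)"
  shows "csa_law G \<and> involution_free G"
  using tree.csa_law_tree[OF fixes_one_edge[OF assms(1)]] tree.involution_free_tree stabilizer_law assms(2)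
  by blast

text \<open>
An element of this factor and of a conjugate of it fixes two vertices on the side \<open>False\<close>.
\<close>

theorem malnormal_factor_False:
  assumes "malnormal C (G\<lparr>carrier := K True\<rparr>)"
  shows "malnormal (K False) G"
proof (rule malnormalI[OF factor])
  fix x h k
  assume x: "x \<in> carrier G" and h: "h \<in> K False" "k \<in> K False" "h \<otimes> x = x \<otimes> k" "h \<noteq> \<one>"
  have c: "h \<in> carrier G" "k \<in> carrier G" using h factor_carrier by blast+
  have V: "(False, y <# K False) \<in> vertices" if "y \<in> carrier G" for y using that by (auto simp: vertices_def)
  have "translate h (False, x <# K False) = (False, x <# K False)"
    using translate_fixes_iff[OF c(1) x] h x c by (simp add: m_assoc[symmetric])
  moreover have "translate h (False, \<one> <# K False) = (False, \<one> <# K False)"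
    using translate_fixes_iff[OF c(1) one_closed] h c by simp
  ultimately have "(False, \<one> <# K False) = (False, x <# K False)"
    using tree.fixed_unique_False_side[OF fixes_one_edge[OF assms] c(1) h(4) V V] x by simp
  then obtain k' where "k' \<in> K False" "x = \<one> \<otimes> k'" using coset_eq_iff[of \<one> x False] x by auto
  then show "x \<in> K False" using factor_carrier by simp
qed

lemma amalgam_swap: "amalgam G (\<lambda>s. K (\<not> s)) C"
proof (intro amalgam.intro amalgam_axioms.intro)
  show "group G" by (rule is_group)
  show "subgroup (K (\<not> s)) G" for s by (rule factor)
  show "C = K (\<not> True) \<inter> K (\<not> False)" using base by auto
  show "generate G (K (\<not> True) \<union> K (\<not> False)) = carrier G" using generated by (simp add: Un_commute)
next
  fix l s assume l: "l \<noteq> []" "alternating (\<lambda>s. K (\<not> s)) C s l"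
  have "alternating (\<lambda>s. K (\<not> s)) C s l = alternating K C (\<not> s) l" for s
    by (induction l arbitrary: s) auto
  then show "foldr (\<otimes>) l \<one> \<notin> C" using normal_form l by blast
qed

theorem malnormal_factor:
  assumes "\<And>s. malnormal C (G\<lparr>carrier := K s\<rparr>)"
  shows "malnormal (K s) G"
proof (cases s)
  case True
  then show ?thesis using amalgam.malnormal_factor_False[OF amalgam_swap] assms by simp
next
  case False
  then show ?thesis using malnormal_factor_False assms by simp
qed

end

section \<open>Normal forms in pushouts\<close>

definition perm_group :: "('x \<Rightarrow> 'x) monoid" where
  "perm_group = \<lparr>carrier = {p. bij p}, monoid.mult = (\<circ>), one = id\<rparr>"

lemma group_perm_group: "group perm_group"
proof (rule groupI)
  fix p :: "'a \<Rightarrow> 'a" assume p: "p \<in> carrier perm_group"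
  then have "inv_into UNIV p \<circ> p = id" by (simp add: perm_group_def bij_is_inj)
  then show "\<exists>q\<in>carrier perm_group. q \<otimes>\<^bsub>perm_group\<^esub> p = \<one>\<^bsub>perm_group\<^esub>"
    using p by (intro bexI[of _ "inv_into UNIV p"]) (auto simp: perm_group_def bij_imp_bij_inv)
qed (auto simp: perm_group_def bij_comp comp_assoc)

text \<open>
Two groups containing copies of \<open>C\<close>. Each factor is cut into cosets of its copy of \<open>C\<close>, with
representatives \<open>rep\<close>, the one of \<open>C\<close> being the unit; every element is uniquely the product of its part
\<open>cpart\<close> in \<open>C\<close> and a representative.
\<close>

locale span =
  fixes K :: "bool \<Rightarrow> 'a monoid" and C :: "'c monoid" and f :: "bool \<Rightarrow> 'c \<Rightarrow> 'a"
  assumes group_factor: "group (K s)" and group_base: "group C"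
    and hom_base: "f s \<in> hom C (K s)" and inj_base: "inj_on (f s) (carrier C)"
begin

abbreviation base_image :: "bool \<Rightarrow> 'a set" where "base_image s \<equiv> f s ` carrier C"

definition rep :: "bool \<Rightarrow> 'a \<Rightarrow> 'a" where
  "rep s k = (if k \<in> base_image s then \<one>\<^bsub>K s\<^esub>
     else SOME t. t \<in> base_image s #>\<^bsub>K s\<^esub> k)"

definition cpart :: "bool \<Rightarrow> 'a \<Rightarrow> 'c" where
  "cpart s k = (SOME c. c \<in> carrier C \<and> k = f s c \<otimes>\<^bsub>K s\<^esub> rep s k)"

lemma f_closed: "c \<in> carrier C \<Longrightarrow> f s c \<in> carrier (K s)"
  using hom_base by (rule hom_in_carrier)

lemma f_mult: "c \<in> carrier C \<Longrightarrow> d \<in> carrier C \<Longrightarrow> f s (c \<otimes>\<^bsub>C\<^esub> d) = f s c \<otimes>\<^bsub>K s\<^esub> f s d"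
  using hom_base by (rule hom_mult)

lemma f_one: "f s \<one>\<^bsub>C\<^esub> = \<one>\<^bsub>K s\<^esub>"
  using hom_one hom_base group_base group_factor by blast

lemma subgroup_base_image: "subgroup (base_image s) (K s)"
  using group_hom.img_is_subgroup[of C "K s" "f s"] hom_base group_base group_factor
  by (simp add: group_hom_def group_hom_axioms_def)

lemma rep_in_coset:
  assumes "k \<in> carrier (K s)"
  shows "rep s k \<in> base_image s #>\<^bsub>K s\<^esub> k"
proof -
  interpret K: group "K s" by (rule group_factor)
  show ?thesis
  proof (cases "k \<in> base_image s")
    case True
    then show ?thesis
      using K.coset_join2[OF assms subgroup_base_image] subgroup.one_closed[OF subgroup_base_image]
      by (simp add: rep_def)
  next
    case False
    have "k \<in> base_image s #>\<^bsub>K s\<^esub> k" using K.rcos_self[OF assms subgroup_base_image] .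
    then show ?thesis using False by (auto simp: rep_def intro: someI)
  qed
qed

lemma rep_closed: "k \<in> carrier (K s) \<Longrightarrow> rep s k \<in> carrier (K s)"
  using rep_in_coset monoid.r_coset_subset_G[OF group.is_monoid[OF group_factor]] subgroup.subset[OF subgroup_base_image]
  by blast

lemma rep_eq_one_iff:
  assumes "k \<in> carrier (K s)" shows "rep s k = \<one>\<^bsub>K s\<^esub> \<longleftrightarrow> k \<in> base_image s"
proof -
  interpret K: group "K s" by (rule group_factor)
  have "k \<in> base_image s" if "rep s k = \<one>\<^bsub>K s\<^esub>"
  proof -
    have "base_image s #>\<^bsub>K s\<^esub> k = base_image s #>\<^bsub>K s\<^esub> \<one>\<^bsub>K s\<^esub>"
      using K.repr_independence[OF _ assms subgroup_base_image] rep_in_coset[OF assms] that by simp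
    then show ?thesis
      using K.rcos_self[OF assms subgroup_base_image] K.coset_mult_one[OF subgroup.subset[OF subgroup_base_image]]
      by simp
  qed
  then show ?thesis by (auto simp: rep_def)
qed

lemma rep_coset:
  assumes "c \<in> carrier C" "k \<in> carrier (K s)" shows "rep s (f s c \<otimes>\<^bsub>K s\<^esub> k) = rep s k"
proof -
  interpret K: group "K s" by (rule group_factor)
  have c: "f s c \<in> base_image s" using assms by blast
  have "base_image s #>\<^bsub>K s\<^esub> (f s c \<otimes>\<^bsub>K s\<^esub> k) = base_image s #>\<^bsub>K s\<^esub> k"
    using K.coset_mult_assoc[OF subgroup.subset[OF subgroup_base_image] f_closed assms(2)]
      K.coset_join2[OF f_closed subgroup_base_image c] assms(1) by metis
  moreover have "f s c \<otimes>\<^bsub>K s\<^esub> k \<in> base_image s \<longleftrightarrow> k \<in> base_image s"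
  proof
    assume "f s c \<otimes>\<^bsub>K s\<^esub> k \<in> base_image s"
    then have "inv\<^bsub>K s\<^esub> (f s c) \<otimes>\<^bsub>K s\<^esub> (f s c \<otimes>\<^bsub>K s\<^esub> k) \<in> base_image s"
      using subgroup.m_closed[OF subgroup_base_image] subgroup.m_inv_closed[OF subgroup_base_image c] by blast
    then show "k \<in> base_image s" using assms f_closed by (simp add: K.m_assoc[symmetric])
  qed (use c subgroup.m_closed[OF subgroup_base_image] in blast)
  ultimately show ?thesis by (simp add: rep_def)
qed

lemma cpart:
  assumes "k \<in> carrier (K s)"
  shows "cpart s k \<in> carrier C" "f s (cpart s k) \<otimes>\<^bsub>K s\<^esub> rep s k = k"
proof -
  interpret K: group "K s" by (rule group_factor)
  obtain c where c: "c \<in> carrier C" "rep s k = f s c \<otimes>\<^bsub>K s\<^esub> k"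
    using rep_in_coset[OF assms] by (auto simp: r_coset_def)
  have "f s (inv\<^bsub>C\<^esub> c) = inv\<^bsub>K s\<^esub> (f s c)"
    using group_hom.hom_inv[of C "K s" "f s" c] c hom_base group_base group_factor
    by (simp add: group_hom_def group_hom_axioms_def)
  then have "f s (inv\<^bsub>C\<^esub> c) \<otimes>\<^bsub>K s\<^esub> rep s k = k"
    using c f_closed assms by (simp add: K.m_assoc[symmetric])
  then have "\<exists>c. c \<in> carrier C \<and> k = f s c \<otimes>\<^bsub>K s\<^esub> rep s k"
    using group.inv_closed[OF group_base] c by metis
  from someI_ex[OF this] show "cpart s k \<in> carrier C" "f s (cpart s k) \<otimes>\<^bsub>K s\<^esub> rep s k = k"
    by (simp_all add: cpart_def)
qed

lemma cpart_coset:
  assumes "c \<in> carrier C" "t \<in> carrier (K s)" "rep s t = t"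
  shows "cpart s (f s c \<otimes>\<^bsub>K s\<^esub> t) = c"
proof -
  interpret K: group "K s" by (rule group_factor)
  have kc: "f s c \<otimes>\<^bsub>K s\<^esub> t \<in> carrier (K s)" using assms f_closed by simp
  have "f s (cpart s (f s c \<otimes>\<^bsub>K s\<^esub> t)) \<otimes>\<^bsub>K s\<^esub> t = f s c \<otimes>\<^bsub>K s\<^esub> t"
    using cpart(2)[OF kc] rep_coset[OF assms(1,2)] assms(3) by simp
  then have "f s (cpart s (f s c \<otimes>\<^bsub>K s\<^esub> t)) = f s c"
    using assms f_closed cpart(1)[OF kc] by simp
  then show ?thesis using inj_base assms(1) cpart(1)[OF kc] by (auto dest: inj_onD)
qed

lemma rep_rep: "k \<in> carrier (K s) \<Longrightarrow> rep s (rep s k) = rep s k"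
  using rep_coset[OF cpart(1) rep_closed] cpart(2) by metis

lemma rep_one: "rep s \<one>\<^bsub>K s\<^esub> = \<one>\<^bsub>K s\<^esub>"
  using rep_eq_one_iff group.is_monoid[OF group_factor] subgroup.one_closed[OF subgroup_base_image] 
  by (metis monoid.one_closed)

fun starts_with :: "bool \<Rightarrow> (bool \<times> 'a) list \<Rightarrow> bool" where
  "starts_with s [] = False"
| "starts_with s ((s', t) # w) = (s' = s)"

fun normal_word :: "(bool \<times> 'a) list \<Rightarrow> bool" where
  "normal_word [] = True"
| "normal_word ((s, t) # w) =
     (t \<in> carrier (K s) \<and> rep s t = t \<and> t \<noteq> \<one>\<^bsub>K s\<^esub> \<and> \<not> starts_with s w \<and> normal_word w)"

text \<open>
The normal forms of the elements of the amalgam: an element of \<open>C\<close> followed by nontrivial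
representatives taken alternately from the two factors. Seen from the factor \<open>s\<close>, a normal form is an
element of \<open>K s\<close> followed by a normal word that does not start in \<open>K s\<close>; \<open>split_state\<close> and \<open>join_state\<close>
translate between these two views, and \<open>K s\<close> acts by left multiplication in the second one.
\<close>

definition states :: "('c \<times> (bool \<times> 'a) list) set" where
  "states = {(c, w). c \<in> carrier C \<and> normal_word w}"

fun split_state :: "bool \<Rightarrow> 'c \<times> (bool \<times> 'a) list \<Rightarrow> 'a \<times> (bool \<times> 'a) list" where
  "split_state s (c, []) = (f s c, [])"
| "split_state s (c, (s', t) # w) =
     (if s' = s then (f s c \<otimes>\<^bsub>K s\<^esub> t, w) else (f s c, (s', t) # w))"

definition join_state :: "bool \<Rightarrow> 'a \<times> (bool \<times> 'a) list \<Rightarrow> 'c \<times> (bool \<times> 'a) list" where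
  "join_state s = (\<lambda>(k, w). (cpart s k, if k \<in> base_image s then w else (s, rep s k) # w))"

definition split_states :: "bool \<Rightarrow> ('a \<times> (bool \<times> 'a) list) set" where
  "split_states s = {(k, w). k \<in> carrier (K s) \<and> normal_word w \<and> \<not> starts_with s w}"

lemma split_state_closed: "x \<in> states \<Longrightarrow> split_state s x \<in> split_states s"
  using f_closed monoid.m_closed[OF group.is_monoid[OF group_factor]]
  by (cases "(s, x)" rule: split_state.cases) (auto simp: states_def split_states_def)

lemma join_state_closed: "y \<in> split_states s \<Longrightarrow> join_state s y \<in> states"
  using cpart rep_closed rep_rep rep_eq_one_iff
  by (auto simp: states_def split_states_def join_state_def)

lemma join_split_state:
  assumes "x \<in> states" shows "join_state s (split_state s x) = x"
proof -
  have one: "cpart s (f s c) = c" if "c \<in> carrier C" for c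
    using cpart_coset[OF that _ rep_one] f_closed[OF that] group.is_monoid[OF group_factor]
    by (metis monoid.one_closed monoid.r_one)
  show ?thesis
  proof (cases "(s, x)" rule: split_state.cases)
    case (1 s c)
    then show ?thesis using assms one by (auto simp: states_def join_state_def)
  next
    case (2 s'' c s' t w)
    then have x: "x = (c, (s', t) # w)" "s'' = s" by simp_all
    show ?thesis
    proof (cases "s' = s")
      case False
      then show ?thesis using assms x one by (auto simp: states_def join_state_def)
    next
      case True
      then have t: "c \<in> carrier C" "t \<in> carrier (K s)" "rep s t = t" "t \<noteq> \<one>\<^bsub>K s\<^esub>"
        using assms x by (auto simp: states_def)
      let ?k = "f s c \<otimes>\<^bsub>K s\<^esub> t"
      have kc: "?k \<in> carrier (K s)" using t f_closed monoid.m_closed[OF group.is_monoid[OF group_factor]] by blast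
      have "rep s ?k = t" using rep_coset t by metis
      moreover then have "?k \<notin> base_image s" using rep_eq_one_iff[OF kc] t by metis
      ultimately show ?thesis using True x cpart_coset t by (simp add: join_state_def)
    qed
  qed
qed

lemma split_join_state:
  assumes "y \<in> split_states s" shows "split_state s (join_state s y) = y"
proof -
  obtain k w where y: "y = (k, w)" "k \<in> carrier (K s)" "\<not> starts_with s w"
    using assms by (auto simp: split_states_def)
  show ?thesis
  proof (cases "k \<in> base_image s")
    case True
    then have "f s (cpart s k) = k"
      using cpart[OF y(2)] rep_eq_one_iff[OF y(2)] f_closed group.is_monoid[OF group_factor]
      by (metis monoid.r_one)
    then show ?thesis using True y by (cases w) (auto simp: join_state_def)
  next
    case False
    then show ?thesis using y cpart by (simp add: join_state_def)
  qed
qed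

definition act :: "bool \<Rightarrow> 'a \<Rightarrow> 'c \<times> (bool \<times> 'a) list \<Rightarrow> 'c \<times> (bool \<times> 'a) list" where
  "act s k x = (if x \<in> states
     then join_state s (map_prod (\<lambda>k'. k \<otimes>\<^bsub>K s\<^esub> k') id (split_state s x)) else x)"

lemma translate_split_states:
  "k \<in> carrier (K s) \<Longrightarrow> y \<in> split_states s \<Longrightarrow> map_prod (\<lambda>k'. k \<otimes>\<^bsub>K s\<^esub> k') id y \<in> split_states s"
  using monoid.m_closed[OF group.is_monoid[OF group_factor]] by (auto simp: split_states_def)

lemma act_closed: "k \<in> carrier (K s) \<Longrightarrow> x \<in> states \<Longrightarrow> act s k x \<in> states"
  by (simp add: act_def join_state_closed translate_split_states split_state_closed)

lemma act_one: "act s \<one>\<^bsub>K s\<^esub> = id"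
proof
  interpret K: group "K s" by (rule group_factor)
  fix x
  have "map_prod (\<lambda>k'. \<one>\<^bsub>K s\<^esub> \<otimes>\<^bsub>K s\<^esub> k') id y = y" if "y \<in> split_states s" for y
    using that by (auto simp: split_states_def)
  then show "act s \<one>\<^bsub>K s\<^esub> x = id x" by (simp add: act_def join_split_state split_state_closed)
qed

lemma act_mult:
  assumes "k \<in> carrier (K s)" "h \<in> carrier (K s)"
  shows "act s (k \<otimes>\<^bsub>K s\<^esub> h) = act s k \<circ> act s h"
proof
  interpret K: group "K s" by (rule group_factor)
  fix x
  have "map_prod (\<lambda>k'. k \<otimes>\<^bsub>K s\<^esub> h \<otimes>\<^bsub>K s\<^esub> k') id y =
      map_prod (\<lambda>k'. k \<otimes>\<^bsub>K s\<^esub> k') id (map_prod (\<lambda>k'. h \<otimes>\<^bsub>K s\<^esub> k') id y)"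
    if "y \<in> split_states s" for y
    using that assms by (auto simp: split_states_def K.m_assoc)
  then show "act s (k \<otimes>\<^bsub>K s\<^esub> h) x = (act s k \<circ> act s h) x"
    using assms by (simp add: act_def join_state_closed translate_split_states split_state_closed split_join_state)
qed

lemma act_hom: "act s \<in> hom (K s) perm_group"
proof (rule homI)
  interpret K: group "K s" by (rule group_factor)
  fix k assume k: "k \<in> carrier (K s)"
  have "act s (inv\<^bsub>K s\<^esub> k) \<circ> act s k = id" "act s k \<circ> act s (inv\<^bsub>K s\<^esub> k) = id"
    using k act_mult[of "inv\<^bsub>K s\<^esub> k" s k] act_mult[of k s "inv\<^bsub>K s\<^esub> k"] act_one by simp_all
  then show "act s k \<in> carrier perm_group" by (simp add: perm_group_def o_bij)
qed (simp add: perm_group_def act_mult)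

text \<open>
Both factors act in the same way through \<open>C\<close>, since the part in \<open>C\<close> comes first.
\<close>

lemma act_base:
  assumes "c \<in> carrier C" "x \<in> states"
  shows "act s (f s c) x = (c \<otimes>\<^bsub>C\<^esub> fst x, snd x)"
proof -
  interpret K: group "K s" by (rule group_factor)
  interpret C: group C by (rule group_base)
  have x': "(c \<otimes>\<^bsub>C\<^esub> fst x, snd x) \<in> states" using assms by (auto simp: states_def)
  have "map_prod (\<lambda>k'. f s c \<otimes>\<^bsub>K s\<^esub> k') id (split_state s x) = split_state s (c \<otimes>\<^bsub>C\<^esub> fst x, snd x)"
    using assms by (cases "(s, x)" rule: split_state.cases)
      (auto simp: states_def f_mult f_closed K.m_assoc)
  then show ?thesis using assms x' by (simp add: act_def join_split_state)
qed

text \<open>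
A letter outside \<open>C\<close> leaves a mark on a normal form that does not start in its factor.
\<close>

lemma act_letter:
  assumes "k \<in> carrier (K s)" "k \<notin> base_image s" "x \<in> states" "\<not> starts_with s (snd x)"
  shows "starts_with s (snd (act s k x))"
proof -
  interpret K: group "K s" by (rule group_factor)
  obtain c where c: "c \<in> carrier C" "split_state s x = (f s c, snd x)"
    using assms(3,4) by (cases "(s, x)" rule: split_state.cases) (auto simp: states_def)
  have "k \<otimes>\<^bsub>K s\<^esub> f s c \<notin> base_image s"
  proof
    assume "k \<otimes>\<^bsub>K s\<^esub> f s c \<in> base_image s"
    then have "k \<otimes>\<^bsub>K s\<^esub> f s c \<otimes>\<^bsub>K s\<^esub> inv\<^bsub>K s\<^esub> (f s c) \<in> base_image s"
      using c subgroup.m_closed[OF subgroup_base_image] subgroup.m_inv_closed[OF subgroup_base_image] by blast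
    then show False using assms c f_closed by (simp add: K.m_assoc)
  qed
  then show ?thesis using assms c by (simp add: act_def join_state_def)
qed

end

text \<open>
The universal property is required for one target only, the permutations of the normal forms: it is
the only one that the normal form theorem needs, and a universal property for all targets could not
be stated within one locale, as it would range over types.
\<close>

locale pushout = span K C f + group Q
  for K :: "bool \<Rightarrow> 'a monoid" and C :: "'c monoid" and f and Q :: "'q monoid" (structure) +
  fixes i :: "bool \<Rightarrow> 'a \<Rightarrow> 'q"
  assumes hom_factor: "i s \<in> hom (K s) Q"
    and square: "c \<in> carrier C \<Longrightarrow> i True (f True c) = i False (f False c)"
    and generated: "generate Q (i True ` carrier (K True) \<union> i False ` carrier (K False)) = carrier Q"
    and universal: "\<lbrakk>\<And>s. \<rho> s \<in> hom (K s) (perm_group :: ('c \<times> (bool \<times> 'a) list \<Rightarrow> _) monoid);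
        \<And>c. c \<in> carrier C \<Longrightarrow> \<rho> True (f True c) = \<rho> False (f False c)\<rbrakk> \<Longrightarrow>
      \<exists>\<phi> \<in> hom Q perm_group. \<forall>s. \<forall>k \<in> carrier (K s). \<phi> (i s k) = \<rho> s k"
begin

definition start :: "'c \<times> (bool \<times> 'a) list" where "start = (\<one>\<^bsub>C\<^esub>, [])"

lemma start_state: "start \<in> states"
  using monoid.one_closed[OF group.is_monoid[OF group_base]] by (simp add: start_def states_def)

definition \<phi> :: "'q \<Rightarrow> 'c \<times> (bool \<times> 'a) list \<Rightarrow> 'c \<times> (bool \<times> 'a) list" where
  "\<phi> = (SOME \<phi>. \<phi> \<in> hom Q perm_group \<and> (\<forall>s. \<forall>k \<in> carrier (K s). \<phi> (i s k) = act s k))"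

lemma \<phi>: "\<phi> \<in> hom Q perm_group" "k \<in> carrier (K s) \<Longrightarrow> \<phi> (i s k) = act s k"
proof -
  have "act True (f True c) x = act False (f False c) x" if "c \<in> carrier C" for c x
    using act_base[OF that] by (cases "x \<in> states") (auto simp: act_def)
  then have "\<exists>\<phi> \<in> hom Q perm_group. \<forall>s. \<forall>k \<in> carrier (K s). \<phi> (i s k) = act s k"
    by (intro universal act_hom ext)
  then have "\<exists>\<phi>. \<phi> \<in> hom Q perm_group \<and> (\<forall>s. \<forall>k \<in> carrier (K s). \<phi> (i s k) = act s k)"
    unfolding Bex_def .
  from someI_ex[OF this, folded \<phi>_def] show "\<phi> \<in> hom Q perm_group" "k \<in> carrier (K s) \<Longrightarrow> \<phi> (i s k) = act s k" by auto
qed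

lemma i_closed: "k \<in> carrier (K s) \<Longrightarrow> i s k \<in> carrier Q"
  using hom_factor by (rule hom_in_carrier)

lemma \<phi>_mult: "g \<in> carrier Q \<Longrightarrow> h \<in> carrier Q \<Longrightarrow> \<phi> (g \<otimes> h) x = \<phi> g (\<phi> h x)"
  using hom_mult[OF \<phi>(1)] by (simp add: perm_group_def)

lemma i_inj: "inj_on (i s) (carrier (K s))"
proof (rule inj_onI)
  interpret K: group "K s" by (rule group_factor)
  fix k h assume kh: "k \<in> carrier (K s)" "h \<in> carrier (K s)" "i s k = i s h"
  have *: "act s k start = join_state s (k, [])" if "k \<in> carrier (K s)" for k
    using start_state that by (simp add: act_def start_def f_one)
  have "act s k = act s h" using \<phi>(2)[OF kh(1)] \<phi>(2)[OF kh(2)] kh(3) by simp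
  then have eq: "join_state s (k, []) = join_state s (h, [])" using *[OF kh(1)] *[OF kh(2)] by simp
  have "(k, []) \<in> split_states s" "(h, []) \<in> split_states s" 
    using kh(1,2) by (simp_all add: split_states_def)
  then have "(k, []) = split_state s (join_state s (k, []))" "(h, []) = split_state s (join_state s (h, []))"
    by (simp_all only: split_join_state)
  then have "(k, [] :: (bool \<times> 'a) list) = (h, [])" by (simp only: eq)
  then show "k = h" by simp
qed

abbreviation factor_image :: "bool \<Rightarrow> 'q set" where "factor_image s \<equiv> i s ` carrier (K s)"
abbreviation base_group :: "'q set" where "base_group \<equiv> i True ` f True ` carrier C"

lemma base_group_eq: "base_group = i s ` base_image s"
  using square by (cases s) (auto simp: image_image)

lemma \<phi>_base: "g \<in> base_group \<Longrightarrow> snd (\<phi> g start) = []"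
  using \<phi>(2) f_closed act_base start_state by (auto simp: start_def)

lemma \<phi>_letter:
  assumes "g \<in> factor_image s" "g \<notin> base_group" "x \<in> states" "\<not> starts_with s (snd x)"
  shows "\<phi> g x \<in> states \<and> starts_with s (snd (\<phi> g x))"
proof -
  obtain k where k: "g = i s k" "k \<in> carrier (K s)" using assms by blast
  then have "k \<notin> base_image s" using assms base_group_eq by blast
  then show ?thesis using act_letter act_closed k assms \<phi>(2) by metis
qed

text \<open>
Applied to the empty normal form, an alternating product of positive length gives a nonempty normal
form beginning in the factor of its first letter, whereas elements of \<open>C\<close> keep the word empty.
\<close>

lemma \<phi>_alternating:
  assumes "alternating factor_image base_group s l"
  shows "foldr (\<otimes>) l \<one> \<in> carrier Q \<and> \<phi> (foldr (\<otimes>) l \<one>) start \<in> states \<and>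
    (if l = [] then snd (\<phi> (foldr (\<otimes>) l \<one>) start) = []
     else starts_with s (snd (\<phi> (foldr (\<otimes>) l \<one>) start)))"
  using assms
proof (induction l arbitrary: s)
  case Nil
  have "\<phi> \<one> = id" using hom_one[OF \<phi>(1) is_group group_perm_group] by (simp add: perm_group_def)
  then show ?case using start_state by (simp add: start_def)
next
  case (Cons g l)
  let ?g = "foldr (\<otimes>) l \<one>"
  have g: "g \<in> factor_image s" "g \<notin> base_group" and l: "alternating factor_image base_group (\<not> s) l"
    using Cons.prems by auto
  have gc: "g \<in> carrier Q" using g i_closed by blast
  note IH = Cons.IH[OF l]
  have "\<not> starts_with s (snd (\<phi> ?g start))"
    using IH by (cases "snd (\<phi> ?g start)"; cases "l = []") (auto split: prod.splits)
  then show ?case using IH \<phi>_letter[OF g] gc by (simp add: \<phi>_mult)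
qed

theorem amalgam: "amalgam Q factor_image base_group"
proof (intro amalgam.intro amalgam_axioms.intro)
  show "group Q" by (rule is_group)
  show "subgroup (factor_image s) Q" for s
    using group_hom.img_is_subgroup[of "K s" Q "i s"] hom_factor group_factor is_group
    by (simp add: group_hom_def group_hom_axioms_def)
  show "generate Q (factor_image True \<union> factor_image False) = carrier Q" by (rule generated)
  show "foldr (\<otimes>) l \<one> \<notin> base_group" if "l \<noteq> []" "alternating factor_image base_group s l" for l s
    using \<phi>_alternating[OF that(2)] \<phi>_base[of "foldr (\<otimes>) l \<one>"] that(1) by auto
  show "base_group = factor_image True \<inter> factor_image False"
  proof
    show "base_group \<subseteq> factor_image True \<inter> factor_image False"
      using base_group_eq[of True] base_group_eq[of False] f_closed by blast
    show "factor_image True \<inter> factor_image False \<subseteq> base_group"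
    proof
      fix g assume g: "g \<in> factor_image True \<inter> factor_image False"
      show "g \<in> base_group"
      proof (rule ccontr)
        assume out: "g \<notin> base_group"
        have "starts_with s (snd (\<phi> g start))" for s
          using \<phi>_letter[OF _ out start_state, of s] g by (cases s) (auto simp: start_def)
        from this[of True] this[of False] show False by (cases "snd (\<phi> g start)") auto
      qed
    qed
  qed
qed

theorem csa_law_pushout:
  assumes "\<And>s. csa_law (K s) \<and> involution_free (K s)" "malnormal (base_image True) (K True)"
  shows "csa_law Q \<and> involution_free Q"
proof (rule amalgam.csa_law_amalgam[OF amalgam])
  show "malnormal base_group (Q\<lparr>carrier := factor_image True\<rparr>)"
    using malnormal_image[OF group_factor is_group hom_factor i_inj assms(2)] .
  show "csa_law (Q\<lparr>carrier := factor_image s\<rparr>) \<and> involution_free (Q\<lparr>carrier := factor_image s\<rparr>)" for s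
    using csa_law_image[OF group_factor is_group hom_factor i_inj] assms(1) by blast
qed

theorem malnormal_factor_pushout:
  assumes "\<And>s. malnormal (base_image s) (K s)"
  shows "malnormal (factor_image s) Q"
proof (rule amalgam.malnormal_factor[OF amalgam])
  fix s
  show "malnormal base_group (Q\<lparr>carrier := factor_image s\<rparr>)"
    using malnormal_image[OF group_factor is_group hom_factor i_inj assms[of s]] by (simp add: base_group_eq[of s])
qed

end

section \<open>Groups of words modulo a congruence\<close>

text \<open>
One construction covers the free product and its quotients: only the congruence varies.
\<close>

definition word_group ::
    "'i set \<Rightarrow> ('i \<Rightarrow> 'g monoid) \<Rightarrow> (('i \<times> 'g) list \<times> ('i \<times> 'g) list) set \<Rightarrow> ('i \<times> 'g) list set monoid" where
  "word_group I G R =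
     \<lparr>carrier = fp_words I G // R,
      monoid.mult = (\<lambda>X Y. \<Union>u \<in> X. \<Union>w \<in> Y. R `` {u @ w}),
      one = R `` {[]}\<rparr>"

definition word_eval :: "('h, 'm) monoid_scheme \<Rightarrow> ('i \<Rightarrow> 'g \<Rightarrow> 'h) \<Rightarrow> ('i \<times> 'g) list \<Rightarrow> 'h" where
  "word_eval H h w = foldr (\<lambda>(i, x) y. h i x \<otimes>\<^bsub>H\<^esub> y) w \<one>\<^bsub>H\<^esub>"

lemma word_eval_simps [simp]:
  "word_eval H h [] = \<one>\<^bsub>H\<^esub>"
  "word_eval H h ((i, x) # w) = h i x \<otimes>\<^bsub>H\<^esub> word_eval H h w"
  by (simp_all add: word_eval_def)

lemma fp_words_simps [simp]:
  "[] \<in> fp_words I G"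
  "(i, x) # w \<in> fp_words I G \<longleftrightarrow> i \<in> I \<and> x \<in> carrier (G i) \<and> w \<in> fp_words I G"
  "u @ w \<in> fp_words I G \<longleftrightarrow> u \<in> fp_words I G \<and> w \<in> fp_words I G"
  by (auto simp: fp_words_def)

lemma fp_words_induct [consumes 1, case_names Nil Cons]:
  assumes "w \<in> fp_words I G" "P []"
    "\<And>i x w. i \<in> I \<Longrightarrow> x \<in> carrier (G i) \<Longrightarrow> w \<in> fp_words I G \<Longrightarrow> P w \<Longrightarrow> P ((i, x) # w)"
  shows "P w"
  using assms(1)
proof (induction w)
  case (Cons a w) then show ?case using assms(3) by (cases a) auto
qed (rule assms(2))

lemma fp_words_mono: "I \<subseteq> J \<Longrightarrow> fp_words I G \<subseteq> fp_words J G"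
  by (auto simp: fp_words_def)

lemma word_eval_closed:
  assumes "group H" "\<And>i. i \<in> I \<Longrightarrow> h i \<in> hom (G i) H" "w \<in> fp_words I G"
  shows "word_eval H h w \<in> carrier H"
  using assms(3)
proof (induction w rule: fp_words_induct)
  case Nil then show ?case using group.is_monoid[OF assms(1)] by (simp add: monoid.one_closed)
next
  case (Cons i x w)
  then show ?case
    using group.is_monoid[OF assms(1)] hom_in_carrier[OF assms(2)] by (simp add: monoid.m_closed)
qed

lemma word_eval_append:
  assumes "group H" "\<And>i. i \<in> I \<Longrightarrow> h i \<in> hom (G i) H" "u \<in> fp_words I G" "w \<in> fp_words I G"
  shows "word_eval H h (u @ w) = word_eval H h u \<otimes>\<^bsub>H\<^esub> word_eval H h w"
proof -
  interpret H: group H by fact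
  have cl: "word_eval H h v \<in> carrier H" if "v \<in> fp_words I G" for v
    using assms(1,2) that by (rule word_eval_closed)
  show ?thesis using assms(3)
  proof (induction u rule: fp_words_induct)
    case (Cons i x u)
    then show ?case using cl assms(4) hom_in_carrier[OF assms(2)] by (simp add: H.m_assoc)
  qed (simp add: cl[OF assms(4)])
qed

locale word_congruence =
  fixes I :: "'i set" and G :: "'i \<Rightarrow> 'g monoid" and R :: "(('i \<times> 'g) list \<times> ('i \<times> 'g) list) set"
  assumes group_letters: "i \<in> I \<Longrightarrow> group (G i)"
    and equivalence: "equiv (fp_words I G) R"
    and append: "(u, u') \<in> R \<Longrightarrow> (w, w') \<in> R \<Longrightarrow> (u @ w, u' @ w') \<in> R"
    and mult: "i \<in> I \<Longrightarrow> x \<in> carrier (G i) \<Longrightarrow> y \<in> carrier (G i) \<Longrightarrow>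
      ([(i, x), (i, y)], [(i, x \<otimes>\<^bsub>G i\<^esub> y)]) \<in> R"
    and one: "i \<in> I \<Longrightarrow> ([(i, \<one>\<^bsub>G i\<^esub>)], []) \<in> R"
begin

abbreviation W :: "('i \<times> 'g) list set monoid" where "W \<equiv> word_group I G R"
abbreviation cls :: "('i \<times> 'g) list \<Rightarrow> ('i \<times> 'g) list set" where "cls u \<equiv> R `` {u}"

lemma cls_eq_iff: "u \<in> fp_words I G \<Longrightarrow> w \<in> fp_words I G \<Longrightarrow> cls u = cls w \<longleftrightarrow> (u, w) \<in> R"
  by (rule eq_equiv_class_iff[OF equivalence])

lemma cls_cong: "(u, w) \<in> R \<Longrightarrow> cls u = cls w"
  by (rule equiv_class_eq[OF equivalence])

lemma cls_closed: "u \<in> fp_words I G \<Longrightarrow> cls u \<in> carrier W"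
  by (simp add: word_group_def quotientI)

lemma cls_cases:
  assumes "X \<in> carrier W" obtains u where "u \<in> fp_words I G" "X = cls u"
  using assms by (auto simp: word_group_def elim: quotientE)

lemma cls_one: "\<one>\<^bsub>W\<^esub> = cls []"
  by (simp add: word_group_def)

lemma cls_mult:
  assumes "u \<in> fp_words I G" "w \<in> fp_words I G"
  shows "cls u \<otimes>\<^bsub>W\<^esub> cls w = cls (u @ w)"
proof -
  have "congruent2 R R (\<lambda>u w. cls (u @ w))"
    by (intro congruent2I' cls_cong append)
  then have "(\<Union>u' \<in> cls u. \<Union>w' \<in> cls w. cls (u' @ w')) = cls (u @ w)"
    by (rule UN_equiv_class2[OF equivalence equivalence _ assms])
  then show ?thesis by (simp add: word_group_def)
qed

lemma left_inverse_word:
  assumes "u \<in> fp_words I G"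
  shows "\<exists>w \<in> fp_words I G. (w @ u, []) \<in> R"
  using assms
proof (induction u rule: fp_words_induct)
  case Nil
  then show ?case using equivalence by (intro bexI[of _ "[]"]) (auto simp: equiv_def refl_on_def)
next
  case (Cons i x u)
  then obtain w where w: "w \<in> fp_words I G" "(w @ u, []) \<in> R" by blast
  interpret Gi: group "G i" using Cons group_letters by blast
  let ?y = "inv\<^bsub>G i\<^esub> x"
  have refl: "(v, v) \<in> R" if "v \<in> fp_words I G" for v
    using equivalence that by (auto simp: equiv_def refl_on_def)
  have "([(i, ?y), (i, x)], [(i, \<one>\<^bsub>G i\<^esub>)]) \<in> R" using mult[of i ?y x] Cons by simp
  then have "([(i, ?y), (i, x)], []) \<in> R" using one Cons equivalence by (meson equivE transE)
  then have "(w @ [(i, ?y), (i, x)] @ u, w @ [] @ u) \<in> R"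
    using w Cons refl by (intro append) auto
  then have "(w @ [(i, ?y), (i, x)] @ u, []) \<in> R" using w equivalence by simp (meson equivE transE)
  then show ?case using w Cons by (intro bexI[of _ "w @ [(i, ?y)]"]) auto
qed

lemma group_W: "group W"
proof (rule groupI)
  fix X Y Z assume "X \<in> carrier W" "Y \<in> carrier W" "Z \<in> carrier W"
  then obtain u v w where "u \<in> fp_words I G" "X = cls u" "v \<in> fp_words I G" "Y = cls v"
    "w \<in> fp_words I G" "Z = cls w" by (metis cls_cases)
  then show "X \<otimes>\<^bsub>W\<^esub> Y \<otimes>\<^bsub>W\<^esub> Z = X \<otimes>\<^bsub>W\<^esub> (Y \<otimes>\<^bsub>W\<^esub> Z)" by (simp add: cls_mult)
next
  fix X Y assume "X \<in> carrier W" "Y \<in> carrier W"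
  then obtain u v where "u \<in> fp_words I G" "X = cls u" "v \<in> fp_words I G" "Y = cls v"
    by (metis cls_cases)
  then show "X \<otimes>\<^bsub>W\<^esub> Y \<in> carrier W" by (simp add: cls_mult cls_closed)
next
  show "\<one>\<^bsub>W\<^esub> \<in> carrier W" by (simp add: cls_one cls_closed)
next
  fix X assume "X \<in> carrier W"
  then obtain u where u: "u \<in> fp_words I G" "X = cls u" by (metis cls_cases)
  then show "\<one>\<^bsub>W\<^esub> \<otimes>\<^bsub>W\<^esub> X = X" by (simp add: cls_one cls_mult)
  obtain w where "w \<in> fp_words I G" "(w @ u, []) \<in> R" using left_inverse_word u by blast
  then show "\<exists>Y\<in>carrier W. Y \<otimes>\<^bsub>W\<^esub> X = \<one>\<^bsub>W\<^esub>"
    using u cls_cong[of "w @ u" "[]"] by (intro bexI[of _ "cls w"]) (simp_all add: cls_mult cls_one cls_closed)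
qed

lemma letter_hom: "i \<in> I \<Longrightarrow> (\<lambda>x. cls [(i, x)]) \<in> hom (G i) W"
  by (intro homI) (auto simp: cls_closed cls_mult cls_cong[OF mult])

lemma universal_hom:
  assumes "group H" "\<And>i. i \<in> I \<Longrightarrow> h i \<in> hom (G i) H"
    and "\<And>u w. (u, w) \<in> R \<Longrightarrow> word_eval H h u = word_eval H h w"
  shows "\<exists>\<psi> \<in> hom W H. \<forall>u \<in> fp_words I G. \<psi> (cls u) = word_eval H h u"
proof -
  define \<psi> where "\<psi> X = word_eval H h (SOME u. u \<in> X)" for X
  have \<psi>: "\<psi> (cls u) = word_eval H h u" if "u \<in> fp_words I G" for u
  proof -
    have "u \<in> cls u" using equivalence that by (rule equiv_class_self)
    then have "(SOME w. w \<in> cls u) \<in> cls u" by (rule someI)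
    then show ?thesis using assms(3)[of u] by (simp add: \<psi>_def)
  qed
  have "\<psi> \<in> hom W H"
  proof (rule homI)
    fix X Y assume "X \<in> carrier W" "Y \<in> carrier W"
    then obtain u v where uv: "u \<in> fp_words I G" "X = cls u" "v \<in> fp_words I G" "Y = cls v"
      by (metis cls_cases)
    then show "\<psi> X \<in> carrier H" using \<psi> word_eval_closed[OF assms(1,2)] by simp
    show "\<psi> (X \<otimes>\<^bsub>W\<^esub> Y) = \<psi> X \<otimes>\<^bsub>H\<^esub> \<psi> Y"
      using uv \<psi> word_eval_append[OF assms(1,2)] by (simp add: cls_mult)
  qed
  then show ?thesis using \<psi> by blast
qed

end

lemma hom_eq_on_letters:
  assumes "word_congruence I G R" "group H" "\<psi> \<in> hom (word_group I G R) H" "\<phi> \<in> hom (word_group I G R) H"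
    and "\<And>i x. i \<in> I \<Longrightarrow> x \<in> carrier (G i) \<Longrightarrow> \<psi> (R `` {[(i, x)]}) = \<phi> (R `` {[(i, x)]})"
    and "X \<in> carrier (word_group I G R)"
  shows "\<psi> X = \<phi> X"
proof -
  interpret word_congruence I G R by fact
  obtain u where u: "u \<in> fp_words I G" "X = cls u" using assms(6) by (rule cls_cases)
  have one: "\<psi> \<one>\<^bsub>W\<^esub> = \<one>\<^bsub>H\<^esub>" "\<phi> \<one>\<^bsub>W\<^esub> = \<one>\<^bsub>H\<^esub>"
    using hom_one[OF _ group_W assms(2)] assms(3,4) by blast+
  have "\<psi> (cls u) = \<phi> (cls u)" using u(1)
  proof (induction u rule: fp_words_induct)
    case Nil then show ?case using one by (simp add: cls_one)
  next
    case (Cons i x w)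
    have eq: "cls ((i, x) # w) = cls [(i, x)] \<otimes>\<^bsub>W\<^esub> cls w" using Cons cls_mult[of "[(i, x)]" w] by simp
    show ?case
      unfolding eq using Cons assms(5) hom_mult[OF assms(3)] hom_mult[OF assms(4)] cls_closed
      by simp
  qed
  then show ?thesis using u by simp
qed

section \<open>The group of a subgraph\<close>

text \<open>
The relations of the subgraph spanned by \<open>V\<close>: an edge counts if both its ends are in \<open>V\<close>. As the edge
relation is a rewriting step instead of a relator, a derivation visibly involves finitely many
vertices.
\<close>

inductive_set graph_rel ::
    "('v, 'e, 'g) graph_of_groups \<Rightarrow> 'v set \<Rightarrow> (('v \<times> 'g) list \<times> ('v \<times> 'g) list) set"
  for \<G> :: "('v, 'e, 'g) graph_of_groups" and V :: "'v set" where
  refl: "w \<in> fp_words V (vertex_group \<G>) \<Longrightarrow> (w, w) \<in> graph_rel \<G> V"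
| sym: "(u, w) \<in> graph_rel \<G> V \<Longrightarrow> (w, u) \<in> graph_rel \<G> V"
| trans: "(u, v) \<in> graph_rel \<G> V \<Longrightarrow> (v, w) \<in> graph_rel \<G> V \<Longrightarrow> (u, w) \<in> graph_rel \<G> V"
| mult: "u \<in> fp_words V (vertex_group \<G>) \<Longrightarrow> w \<in> fp_words V (vertex_group \<G>) \<Longrightarrow> v \<in> V \<Longrightarrow>
    x \<in> carrier (vertex_group \<G> v) \<Longrightarrow> y \<in> carrier (vertex_group \<G> v) \<Longrightarrow>
    (u @ [(v, x), (v, y)] @ w, u @ [(v, x \<otimes>\<^bsub>vertex_group \<G> v\<^esub> y)] @ w) \<in> graph_rel \<G> V"
| one: "u \<in> fp_words V (vertex_group \<G>) \<Longrightarrow> w \<in> fp_words V (vertex_group \<G>) \<Longrightarrow> v \<in> V \<Longrightarrow>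
    (u @ [(v, \<one>\<^bsub>vertex_group \<G> v\<^esub>)] @ w, u @ w) \<in> graph_rel \<G> V"
| edge: "u \<in> fp_words V (vertex_group \<G>) \<Longrightarrow> w \<in> fp_words V (vertex_group \<G>) \<Longrightarrow>
    e \<in> arcs (base_graph \<G>) \<Longrightarrow> tail (base_graph \<G>) e \<in> V \<Longrightarrow> head (base_graph \<G>) e \<in> V \<Longrightarrow>
    g \<in> edge_group \<G> e \<Longrightarrow>
    (u @ [(tail (base_graph \<G>) e, g)] @ w, u @ [(head (base_graph \<G>) e, edge_map \<G> e g)] @ w)
      \<in> graph_rel \<G> V"

lemma graph_rel_mono:
  assumes "V \<subseteq> V'" shows "graph_rel \<G> V \<subseteq> graph_rel \<G> V'"
proof
  fix p assume "p \<in> graph_rel \<G> V"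
  then have "(fst p, snd p) \<in> graph_rel \<G> V" by simp
  then have "(fst p, snd p) \<in> graph_rel \<G> V'"
  proof (induction rule: graph_rel.induct)
    case (trans u v w) then show ?case by (blast intro: graph_rel.trans)
  qed (use fp_words_mono[OF assms, of "vertex_group \<G>"] assms in \<open>blast intro: graph_rel.intros\<close>)+
  then show "p \<in> graph_rel \<G> V'" by simp
qed

lemma fp_words_finite_support: "w \<in> fp_words V G \<Longrightarrow> w \<in> fp_words (fst ` set w) G"
  by (force simp: fp_words_def lists_eq_set)

lemma fp_words_support: "w \<in> fp_words V G \<Longrightarrow> fst ` set w \<subseteq> V"
  by (auto simp: fp_words_def lists_eq_set)

lemma graph_rel_finite_support:
  assumes "(u, w) \<in> graph_rel \<G> V"
  shows "\<exists>F. finite F \<and> F \<subseteq> V \<and> (u, w) \<in> graph_rel \<G> F"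
  using assms
proof (induction rule: graph_rel.induct)
  case (refl w)
  then show ?case
    by (intro exI[of _ "fst ` set w"])
      (auto intro: graph_rel.refl fp_words_finite_support dest: fp_words_support)
next
  case (sym u w) then show ?case by (blast intro: graph_rel.sym)
next
  case (trans u v w)
  then obtain F F' where F: "finite F" "F \<subseteq> V" "(u, v) \<in> graph_rel \<G> F"
    "finite F'" "F' \<subseteq> V" "(v, w) \<in> graph_rel \<G> F'" by blast
  then have "(u, w) \<in> graph_rel \<G> (F \<union> F')"
    using graph_rel_mono[of F "F \<union> F'" \<G>] graph_rel_mono[of F' "F \<union> F'" \<G>] by (blast intro: graph_rel.trans)
  then show ?case using F by (intro exI[of _ "F \<union> F'"]) auto
next
  case (mult u w v x y)
  let ?F = "insert v (fst ` set u \<union> fst ` set w)"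
  have "u \<in> fp_words ?F (vertex_group \<G>)" "w \<in> fp_words ?F (vertex_group \<G>)"
    using mult fp_words_finite_support fp_words_mono[of "fst ` set u" ?F] fp_words_mono[of "fst ` set w" ?F]
    by blast+
  then have "(u @ [(v, x), (v, y)] @ w, u @ [(v, x \<otimes>\<^bsub>vertex_group \<G> v\<^esub> y)] @ w) \<in> graph_rel \<G> ?F"
    using mult by (intro graph_rel.mult) auto
  moreover have "finite ?F" "?F \<subseteq> V" using mult fp_words_support[OF mult(1)] fp_words_support[OF mult(2)] by auto
  ultimately show ?case by blast
next
  case (one u w v)
  let ?F = "insert v (fst ` set u \<union> fst ` set w)"
  have "u \<in> fp_words ?F (vertex_group \<G>)" "w \<in> fp_words ?F (vertex_group \<G>)"
    using one fp_words_finite_support fp_words_mono[of "fst ` set u" ?F] fp_words_mono[of "fst ` set w" ?F]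
    by blast+
  then have "(u @ [(v, \<one>\<^bsub>vertex_group \<G> v\<^esub>)] @ w, u @ w) \<in> graph_rel \<G> ?F"
    using one by (intro graph_rel.one) auto
  moreover have "finite ?F" "?F \<subseteq> V" using one fp_words_support[OF one(1)] fp_words_support[OF one(2)] by auto
  ultimately show ?case by blast
next
  case (edge u w e g)
  let ?F = "insert (tail (base_graph \<G>) e) (insert (head (base_graph \<G>) e) (fst ` set u \<union> fst ` set w))"
  have "u \<in> fp_words ?F (vertex_group \<G>)" "w \<in> fp_words ?F (vertex_group \<G>)"
    using edge fp_words_finite_support fp_words_mono[of "fst ` set u" ?F] fp_words_mono[of "fst ` set w" ?F]
    by blast+
  then have "(u @ [(tail (base_graph \<G>) e, g)] @ w, u @ [(head (base_graph \<G>) e, edge_map \<G> e g)] @ w)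
      \<in> graph_rel \<G> ?F"
    using edge by (intro graph_rel.edge) auto
  moreover have "finite ?F" "?F \<subseteq> V" using edge fp_words_support[OF edge(1)] fp_words_support[OF edge(2)] by auto
  ultimately show ?case by blast
qed

context oriented_graph_of_groups
begin

abbreviation all_vertices :: "'v set" where "all_vertices \<equiv> verts (base_graph \<G>)"
abbreviation edges :: "'e set" where "edges \<equiv> arcs (base_graph \<G>)"
abbreviation initial_vertex :: "'e \<Rightarrow> 'v" ("\<iota>") where "\<iota> \<equiv> tail (base_graph \<G>)"
abbreviation terminal_vertex :: "'e \<Rightarrow> 'v" ("\<tau>") where "\<tau> \<equiv> head (base_graph \<G>)"

abbreviation words :: "'v set \<Rightarrow> ('v \<times> 'g) list set" where
  "words V \<equiv> fp_words V (vertex_group \<G>)"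

abbreviation rel :: "'v set \<Rightarrow> (('v \<times> 'g) list \<times> ('v \<times> 'g) list) set" where
  "rel V \<equiv> graph_rel \<G> V"

definition subgraph_group :: "'v set \<Rightarrow> ('v \<times> 'g) list set monoid" where
  "subgraph_group V = word_group V (vertex_group \<G>) (rel V)"

abbreviation letter :: "'v set \<Rightarrow> 'v \<Rightarrow> 'g \<Rightarrow> ('v \<times> 'g) list set" where
  "letter V v x \<equiv> rel V `` {[(v, x)]}"

lemma edge_closed:
  assumes "e \<in> edges" "g \<in> edge_group \<G> e"
  shows "g \<in> carrier (tail_group \<G> e)" "edge_map \<G> e g \<in> carrier (head_group \<G> e)"
  using subgroup.mem_carrier[OF edge_group[OF assms(1)] assms(2)] edge_map[OF assms(1)] assms(2)
  by (auto simp: mon_def hom_def)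

lemma rel_words: "(u, w) \<in> rel V \<Longrightarrow> V \<subseteq> all_vertices \<Longrightarrow> u \<in> words V \<and> w \<in> words V"
proof (induction rule: graph_rel.induct)
  case (mult u w v x y)
  then interpret group "vertex_group \<G> v" using vertex_group by blast
  show ?case using mult by simp
next
  case (one u w v)
  then interpret group "vertex_group \<G> v" using vertex_group by blast
  show ?case using one by simp
qed (auto simp: edge_closed)

lemma rel_context:
  "(u, w) \<in> rel V \<Longrightarrow> p \<in> words V \<Longrightarrow> q \<in> words V \<Longrightarrow> (p @ u @ q, p @ w @ q) \<in> rel V"
proof (induction rule: graph_rel.induct)
  case (mult u w v x y)
  then show ?case using graph_rel.mult[of "p @ u" V \<G> "w @ q" v x y] by simp
next
  case (one u w v)
  then show ?case using graph_rel.one[of "p @ u" V \<G> "w @ q" v] by simp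
next
  case (edge u w e g)
  then show ?case using graph_rel.edge[of "p @ u" V \<G> "w @ q" e g] by simp
next
  case (trans u v w) then show ?case by (blast intro: graph_rel.trans)
next
  case (sym u w) then show ?case by (blast intro: graph_rel.sym)
next
  case (refl w) then show ?case by (intro graph_rel.refl) simp
qed

lemma word_congruence_rel:
  assumes V: "V \<subseteq> all_vertices"
  shows "word_congruence V (vertex_group \<G>) (rel V)"
proof (rule word_congruence.intro)
  show "group (vertex_group \<G> v)" if "v \<in> V" for v using that V vertex_group by blast
  show "equiv (words V) (rel V)"
  proof (rule equivI)
    show "rel V \<subseteq> words V \<times> words V" using rel_words[OF _ V] by auto
    show "refl_on (words V) (rel V)" by (intro refl_onI graph_rel.refl)
    show "sym (rel V)" by (rule symI) (rule graph_rel.sym)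
    show "trans (rel V)" by (rule transI) (rule graph_rel.trans)
  qed
  show "(u @ w, u' @ w') \<in> rel V" if uw: "(u, u') \<in> rel V" "(w, w') \<in> rel V" for u u' w w'
  proof -
    have "(u @ w, u' @ w) \<in> rel V" using rel_context[OF uw(1), of "[]" w] rel_words[OF uw(2) V] by simp
    moreover have "(u' @ w, u' @ w') \<in> rel V" using rel_context[OF uw(2), of u' "[]"] rel_words[OF uw(1) V] by simp
    ultimately show ?thesis by (rule graph_rel.trans)
  qed
  show "([(v, x), (v, y)], [(v, x \<otimes>\<^bsub>vertex_group \<G> v\<^esub> y)]) \<in> rel V"
    if "v \<in> V" "x \<in> carrier (vertex_group \<G> v)" "y \<in> carrier (vertex_group \<G> v)" for v x y
    using graph_rel.mult[of "[]" V \<G> "[]" v x y] that by simp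
  show "([(v, \<one>\<^bsub>vertex_group \<G> v\<^esub>)], []) \<in> rel V" if "v \<in> V" for v
    using graph_rel.one[of "[]" V \<G> "[]" v] that by simp
qed

lemma group_subgraph_group: "V \<subseteq> all_vertices \<Longrightarrow> group (subgraph_group V)"
  unfolding subgraph_group_def by (rule word_congruence.group_W[OF word_congruence_rel])

lemma letter_hom:
  "V \<subseteq> all_vertices \<Longrightarrow> v \<in> V \<Longrightarrow> letter V v \<in> hom (vertex_group \<G> v) (subgraph_group V)"
  unfolding subgraph_group_def by (rule word_congruence.letter_hom[OF word_congruence_rel])

lemma letter_edge:
  assumes "V \<subseteq> all_vertices" "e \<in> edges"
    "\<iota> e \<in> V" "\<tau> e \<in> V" "g \<in> edge_group \<G> e"
  shows "letter V (\<iota> e) g = letter V (\<tau> e) (edge_map \<G> e g)"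
  using word_congruence.cls_cong[OF word_congruence_rel[OF assms(1)]]
    graph_rel.edge[of "[]" V \<G> "[]" e g] assms by simp

lemma subgraph_group_universal:
  assumes V: "V \<subseteq> all_vertices" and H: "group H"
    and h: "\<And>v. v \<in> V \<Longrightarrow> h v \<in> hom (vertex_group \<G> v) H"
    and comp: "\<And>e g. e \<in> edges \<Longrightarrow> \<iota> e \<in> V \<Longrightarrow>
      \<tau> e \<in> V \<Longrightarrow> g \<in> edge_group \<G> e \<Longrightarrow>
      h (\<iota> e) g = h (\<tau> e) (edge_map \<G> e g)"
  shows "\<exists>\<psi> \<in> hom (subgraph_group V) H. \<forall>u \<in> words V. \<psi> (rel V `` {u}) = word_eval H h u"
proof -
  interpret word_congruence V "vertex_group \<G>" "rel V" using V by (rule word_congruence_rel)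
  interpret H: group H by (rule H)
  have cl: "word_eval H h w \<in> carrier H" if "w \<in> words V" for w
    using H h that by (rule word_eval_closed)
  have app: "word_eval H h (u @ w) = word_eval H h u \<otimes>\<^bsub>H\<^esub> word_eval H h w"
    if "u \<in> words V" "w \<in> words V" for u w
    using H h that by (rule word_eval_append)
  have hcl: "h v x \<in> carrier H" if "v \<in> V" "x \<in> carrier (vertex_group \<G> v)" for v x
    using hom_in_carrier[OF h] that by blast
  have "word_eval H h u = word_eval H h w" if "(u, w) \<in> rel V" for u w
    using that
  proof (induction rule: graph_rel.induct)
    case (mult u w v x y)
    then interpret Gv: group "vertex_group \<G> v" using V vertex_group by blast
    show ?case using mult cl[OF mult(2)] hcl hom_mult[OF h] by (simp add: app H.m_assoc)
  next
    case (one u w v)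
    then interpret Gv: group "vertex_group \<G> v" using V vertex_group by blast
    have "h v \<one>\<^bsub>vertex_group \<G> v\<^esub> = \<one>\<^bsub>H\<^esub>" using hom_one[OF h] one Gv.is_group H by blast
    then show ?case using one cl[OF one(2)] by (simp add: app)
  next
    case (edge u w e g)
    then show ?case using comp edge_closed cl[OF edge(2)] by (simp add: app)
  qed auto
  then show ?thesis unfolding subgraph_group_def using universal_hom[OF H h] by blast
qed

text \<open>
The homomorphism between the groups of two nested vertex sets. Saturating a class under the larger
relation describes it without mentioning the smaller set.
\<close>

definition incl :: "'v set \<Rightarrow> ('v \<times> 'g) list set \<Rightarrow> ('v \<times> 'g) list set" where
  "incl V X = rel V `` X"

lemma incl_class:
  assumes "V \<subseteq> V'" "V' \<subseteq> all_vertices" "u \<in> words V"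
  shows "incl V' (rel V `` {u}) = rel V' `` {u}"
proof -
  have "u \<in> words V'" using fp_words_mono assms by blast
  then show ?thesis
    unfolding incl_def using graph_rel_mono[OF assms(1), of \<G>] assms(3)
    by (blast intro: graph_rel.trans graph_rel.refl)
qed

lemma incl_hom:
  assumes "V \<subseteq> V'" "V' \<subseteq> all_vertices"
  shows "incl V' \<in> hom (subgraph_group V) (subgraph_group V')"
proof -
  interpret V: word_congruence V "vertex_group \<G>" "rel V" using assms by (intro word_congruence_rel) auto
  interpret V': word_congruence V' "vertex_group \<G>" "rel V'" using assms by (intro word_congruence_rel) auto
  have w: "words V \<subseteq> words V'" using assms by (intro fp_words_mono)
  show ?thesis unfolding subgraph_group_def
  proof (rule homI)
    fix X Y assume "X \<in> carrier V.W" "Y \<in> carrier V.W"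
    then obtain u v where uv: "u \<in> words V" "X = V.cls u" "v \<in> words V" "Y = V.cls v"
      by (metis V.cls_cases)
    then show "incl V' X \<in> carrier V'.W" using w incl_class[OF assms] V'.cls_closed by auto
    show "incl V' (X \<otimes>\<^bsub>V.W\<^esub> Y) = incl V' X \<otimes>\<^bsub>V'.W\<^esub> incl V' Y"
      using uv w incl_class[OF assms] V.cls_mult[of u v] V'.cls_mult[of u v] by (simp add: subset_iff)
  qed
qed

lemma incl_letter:
  assumes "V \<subseteq> V'" "V' \<subseteq> all_vertices" "v \<in> V" "x \<in> carrier (vertex_group \<G> v)"
  shows "incl V' (letter V v x) = letter V' v x"
  using incl_class[OF assms(1,2), of "[(v, x)]"] assms(3,4) by simp

lemma letter_generate:
  assumes V: "V \<subseteq> all_vertices"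
    and S: "\<And>v x. v \<in> V \<Longrightarrow> x \<in> carrier (vertex_group \<G> v) \<Longrightarrow> letter V v x \<in> S"
    and SW: "S \<subseteq> carrier (subgraph_group V)"
  shows "generate (subgraph_group V) S = carrier (subgraph_group V)"
proof
  interpret word_congruence V "vertex_group \<G>" "rel V" using V by (rule word_congruence_rel)
  interpret W: group "subgraph_group V" using V by (rule group_subgraph_group)
  show "generate (subgraph_group V) S \<subseteq> carrier (subgraph_group V)" using SW by (rule W.generate_incl)
  show "carrier (subgraph_group V) \<subseteq> generate (subgraph_group V) S"
  proof
    fix X assume "X \<in> carrier (subgraph_group V)"
    then obtain u where u: "u \<in> words V" "X = cls u" unfolding subgraph_group_def by (rule cls_cases)
    have "cls u \<in> generate (subgraph_group V) S" using u(1)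
    proof (induction u rule: fp_words_induct)
      case Nil
      then show ?case using generate.one[of "subgraph_group V" S] by (simp add: subgraph_group_def cls_one)
    next
      case (Cons v x w)
      have "cls ((v, x) # w) = cls [(v, x)] \<otimes>\<^bsub>subgraph_group V\<^esub> cls w"
        using Cons cls_mult[of "[(v, x)]" w] by (simp add: subgraph_group_def)
      moreover have "cls [(v, x)] \<in> generate (subgraph_group V) S"
        using S Cons by (intro generate.incl)
      ultimately show ?case using Cons generate.eng[of _ "subgraph_group V" S] by metis
    qed
    then show "X \<in> generate (subgraph_group V) S" using u by simp
  qed
qed

end

section \<open>Joining two subgraphs along an edge\<close>

context oriented_graph_of_groups
begin

text \<open>
The first two conditions are the goal. That the vertex groups embed is part of the induction:
it makes the edge groups embed into both factors of the next amalgam.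
\<close>

definition csa_subgraph :: "'v set \<Rightarrow> bool" where
  "csa_subgraph V \<longleftrightarrow> csa_law (subgraph_group V) \<and> involution_free (subgraph_group V) \<and>
     (\<forall>v \<in> V. inj_on (letter V v) (carrier (vertex_group \<G> v)))"

definition malnormal_vertices :: "'v set \<Rightarrow> bool" where
  "malnormal_vertices V \<longleftrightarrow>
     (\<forall>v \<in> V. malnormal (letter V v ` carrier (vertex_group \<G> v)) (subgraph_group V))"

lemma malnormal_letter_image:
  assumes "V \<subseteq> all_vertices" "v \<in> V" "csa_subgraph V"
    and "malnormal (letter V v ` carrier (vertex_group \<G> v)) (subgraph_group V)"
    and "malnormal M (vertex_group \<G> v)"
  shows "malnormal (letter V v ` M) (subgraph_group V)"
proof -
  have "malnormal (letter V v ` M) (subgraph_group V\<lparr>carrier := letter V v ` carrier (vertex_group \<G> v)\<rparr>)"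
    using assms vertex_group letter_hom group_subgraph_group
    by (intro malnormal_image) (auto simp: csa_subgraph_def)
  then show ?thesis using malnormal_trans[OF group_subgraph_group] assms by blast
qed

end

text \<open>
Two disjoint vertex sets, with a group \<open>C\<close> that maps into the groups of both and accounts for
all edges crossing between them. Edges may cross in either direction, and \<open>C\<close> is trivial if none
does; this is why \<open>C\<close> is kept abstract.
\<close>

locale subgraph_union = oriented_graph_of_groups \<G>
  for \<G> :: "('v, 'e, 'g) graph_of_groups" +
  fixes Vs :: "bool \<Rightarrow> 'v set" and C :: "'c monoid" and f :: "bool \<Rightarrow> 'c \<Rightarrow> ('v \<times> 'g) list set"
  assumes Vs: "Vs s \<subseteq> all_vertices"
    and disjoint: "Vs True \<inter> Vs False = {}"
    and group_C: "group C"
    and f_hom: "f s \<in> hom C (subgraph_group (Vs s))"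
    and f_inj: "inj_on (f s) (carrier C)"
    and f_square: "c \<in> carrier C \<Longrightarrow>
      incl (Vs True \<union> Vs False) (f True c) = incl (Vs True \<union> Vs False) (f False c)"
    and crossing: "e \<in> edges \<Longrightarrow> \<iota> e \<in> Vs s \<Longrightarrow>
      \<tau> e \<in> Vs (\<not> s) \<Longrightarrow> g \<in> edge_group \<G> e \<Longrightarrow>
      \<exists>c \<in> carrier C. f s c = letter (Vs s) (\<iota> e) g \<and>
        f (\<not> s) c = letter (Vs (\<not> s)) (\<tau> e) (edge_map \<G> e g)"
begin

abbreviation V :: "'v set" where "V \<equiv> Vs True \<union> Vs False"

lemma V: "V \<subseteq> all_vertices" "Vs s \<subseteq> V"
  using Vs by (blast, cases s) auto

lemma side_of: "v \<in> Vs s \<Longrightarrow> (v \<in> Vs True) = s"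
  using disjoint by (cases s) auto

lemma in_side: "v \<in> V \<Longrightarrow> v \<in> Vs (v \<in> Vs True)"
  by (cases "v \<in> Vs True") auto

text \<open>
Homomorphisms from the two parts that agree on \<open>C\<close> agree along the crossing edges, so together they
respect all relations of the union.
\<close>

lemma pushout: "pushout (\<lambda>s. subgraph_group (Vs s)) C f (subgraph_group V) (\<lambda>s. incl V)"
proof (intro pushout.intro span.intro pushout_axioms.intro)
  show "group (subgraph_group (Vs s))" for s using group_subgraph_group[OF Vs] .
  show "group C" by (rule group_C)
  show "f s \<in> hom C (subgraph_group (Vs s))" for s by (rule f_hom)
  show "inj_on (f s) (carrier C)" for s by (rule f_inj)
  show "group (subgraph_group V)" using group_subgraph_group[OF V(1)] .
  show hom: "incl V \<in> hom (subgraph_group (Vs s)) (subgraph_group V)" for s using incl_hom[OF V(2,1)] .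
  show "incl V (f True c) = incl V (f False c)" if "c \<in> carrier C" for c using f_square[OF that] .
  let ?S = "incl V ` carrier (subgraph_group (Vs True)) \<union> incl V ` carrier (subgraph_group (Vs False))"
  show "generate (subgraph_group V) ?S = carrier (subgraph_group V)"
  proof (rule letter_generate[OF V(1)])
    fix v x assume v: "v \<in> V" and x: "x \<in> carrier (vertex_group \<G> v)"
    obtain s where s: "v \<in> Vs s" using in_side[OF v] by blast
    have "letter (Vs s) v x \<in> carrier (subgraph_group (Vs s))"
      using hom_in_carrier[OF letter_hom[OF Vs s] x] .
    then have "letter V v x \<in> incl V ` carrier (subgraph_group (Vs s))"
      using incl_letter[OF V(2,1) s x] by force
    then show "letter V v x \<in> ?S" by (cases s) auto
  next
    show "?S \<subseteq> carrier (subgraph_group V)" using hom_in_carrier[OF hom] by blast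
  qed
next
  fix \<rho> :: "bool \<Rightarrow> ('v \<times> 'g) list set \<Rightarrow>
    'c \<times> (bool \<times> ('v \<times> 'g) list set) list \<Rightarrow> 'c \<times> (bool \<times> ('v \<times> 'g) list set) list"
  assume \<rho>: "\<And>s. \<rho> s \<in> hom (subgraph_group (Vs s)) perm_group"
    and agree: "\<And>c. c \<in> carrier C \<Longrightarrow> \<rho> True (f True c) = \<rho> False (f False c)"
  define h where "h v x = \<rho> (v \<in> Vs True) (letter (Vs (v \<in> Vs True)) v x)" for v x
  have h: "h v x = \<rho> s (letter (Vs s) v x)" if "v \<in> Vs s" for v s x
    using side_of[OF that] by (simp add: h_def)
  have h_hom: "h v \<in> hom (vertex_group \<G> v) perm_group" if "v \<in> V" for v
  proof -
    from in_side[OF that] obtain s where s: "v \<in> Vs s" by blast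
    have "\<rho> s \<circ> letter (Vs s) v \<in> hom (vertex_group \<G> v) perm_group"
      using hom_compose[OF letter_hom[OF Vs s] \<rho>] .
    moreover have "h v = \<rho> s \<circ> letter (Vs s) v" using h[OF s] by (simp add: fun_eq_iff)
    ultimately show ?thesis by simp
  qed
  have agree': "\<rho> s (f s c) = \<rho> (\<not> s) (f (\<not> s) c)" if "c \<in> carrier C" for s c
    using agree[OF that] by (cases s) simp_all
  have "h (\<iota> e) g = h (\<tau> e) (edge_map \<G> e g)"
    if e: "e \<in> edges" "\<iota> e \<in> V" "\<tau> e \<in> V"
      "g \<in> edge_group \<G> e" for e g
  proof -
    obtain s where s: "\<iota> e \<in> Vs s" using in_side[OF e(2)] by blast
    show ?thesis
    proof (cases "\<tau> e \<in> Vs s")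
      case True
      then show ?thesis using h[OF s] h[OF True] letter_edge[OF Vs e(1) s True e(4)] by simp
    next
      case False
      then have head: "\<tau> e \<in> Vs (\<not> s)" using e(3) by (cases s) auto
      obtain c where "c \<in> carrier C" "f s c = letter (Vs s) (\<iota> e) g"
        "f (\<not> s) c = letter (Vs (\<not> s)) (\<tau> e) (edge_map \<G> e g)"
        using crossing[OF e(1) s head e(4)] by blast
      then show ?thesis using h[OF s] h[OF head] agree' by metis
    qed
  qed
  from subgraph_group_universal[OF V(1) group_perm_group h_hom this]
  obtain \<psi> where \<psi>: "\<psi> \<in> hom (subgraph_group V) perm_group"
    "\<And>u. u \<in> words V \<Longrightarrow> \<psi> (rel V `` {u}) = word_eval perm_group h u" by blast
  have "\<psi> (incl V X) = \<rho> s X" if "X \<in> carrier (subgraph_group (Vs s))" for s X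
  proof -
    have "(\<psi> \<circ> incl V) X = \<rho> s X"
    proof (rule hom_eq_on_letters[OF word_congruence_rel[OF Vs] group_perm_group])
      show "\<psi> \<circ> incl V \<in> hom (word_group (Vs s) (vertex_group \<G>) (rel (Vs s))) perm_group"
        using hom_compose[OF incl_hom[OF V(2,1)] \<psi>(1)] by (simp add: subgraph_group_def)
      show "\<rho> s \<in> hom (word_group (Vs s) (vertex_group \<G>) (rel (Vs s))) perm_group"
        using \<rho> by (simp add: subgraph_group_def)
      show "X \<in> carrier (word_group (Vs s) (vertex_group \<G>) (rel (Vs s)))"
        using that by (simp add: subgraph_group_def)
      fix v x assume v: "v \<in> Vs s" and x: "x \<in> carrier (vertex_group \<G> v)"
      have "\<psi> (letter V v x) = word_eval perm_group h [(v, x)]" using \<psi>(2) v x V(2) by force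
      also have "\<dots> = h v x" by (simp add: perm_group_def)
      finally show "(\<psi> \<circ> incl V) (letter (Vs s) v x) = \<rho> s (letter (Vs s) v x)"
        using h[OF v] incl_letter[OF V(2,1) v x] by simp
    qed
    then show ?thesis by simp
  qed
  then show "\<exists>\<psi> \<in> hom (subgraph_group V) perm_group.
      \<forall>s. \<forall>X \<in> carrier (subgraph_group (Vs s)). \<psi> (incl V X) = \<rho> s X"
    using \<psi>(1) by blast
qed

lemma incl_inj: "inj_on (incl V) (carrier (subgraph_group (Vs s)))"
  using pushout.i_inj[OF pushout] .

lemma letter_image:
  assumes "v \<in> Vs s" "M \<subseteq> carrier (vertex_group \<G> v)"
  shows "letter V v ` M = incl V ` letter (Vs s) v ` M"
  unfolding image_image using incl_letter[OF V(2,1) assms(1)] assms(2) by (intro image_cong) auto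

lemma csa_subgraph_union:
  assumes "\<And>s. csa_subgraph (Vs s)" "malnormal (f True ` carrier C) (subgraph_group (Vs True))"
  shows "csa_subgraph V"
proof -
  have "csa_law (subgraph_group V) \<and> involution_free (subgraph_group V)"
    using pushout.csa_law_pushout[OF pushout _ assms(2)] assms(1) by (simp add: csa_subgraph_def)
  moreover have "inj_on (letter V v) (carrier (vertex_group \<G> v))" if "v \<in> V" for v
  proof -
    from in_side[OF that] obtain s where s: "v \<in> Vs s" by blast
    have "inj_on (letter (Vs s) v) (carrier (vertex_group \<G> v))"
      using assms(1) s by (simp add: csa_subgraph_def)
    moreover have "letter (Vs s) v ` carrier (vertex_group \<G> v) \<subseteq> carrier (subgraph_group (Vs s))"
      using hom_in_carrier[OF letter_hom[OF Vs s]] by blast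
    ultimately have "inj_on (incl V \<circ> letter (Vs s) v) (carrier (vertex_group \<G> v))"
      using incl_inj by (intro comp_inj_on) (auto intro: inj_on_subset)
    then show ?thesis using incl_letter[OF V(2,1) s] by (simp cong: inj_on_cong)
  qed
  ultimately show ?thesis by (simp add: csa_subgraph_def)
qed

lemma malnormal_vertices_union:
  assumes "\<And>s. malnormal_vertices (Vs s)" "\<And>s. malnormal (f s ` carrier C) (subgraph_group (Vs s))"
  shows "malnormal_vertices V"
  unfolding malnormal_vertices_def
proof
  fix v assume "v \<in> V"
  then obtain s where s: "v \<in> Vs s" using in_side by blast
  have "malnormal (incl V ` letter (Vs s) v ` carrier (vertex_group \<G> v))
      (subgraph_group V\<lparr>carrier := incl V ` carrier (subgraph_group (Vs s))\<rparr>)"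
    using assms(1)[of s] s
    by (intro malnormal_image[OF group_subgraph_group[OF Vs] group_subgraph_group[OF V(1)] incl_hom[OF V(2,1)] incl_inj])
      (simp add: malnormal_vertices_def)
  moreover have "malnormal (incl V ` carrier (subgraph_group (Vs s))) (subgraph_group V)"
    using pushout.malnormal_factor_pushout[OF pushout] assms(2) by simp
  ultimately show "malnormal (letter V v ` carrier (vertex_group \<G> v)) (subgraph_group V)"
    using malnormal_trans[OF group_subgraph_group[OF V(1)]] letter_image[OF s] by simp
qed

end

lemma malnormal_one:
  assumes "group G" shows "malnormal {\<one>\<^bsub>G\<^esub>} G"
proof -
  interpret group G by fact
  show ?thesis by (intro malnormalI triv_subgroup) auto
qed

context oriented_graph_of_groups
begin

lemma free_union:
  assumes A: "A \<subseteq> all_vertices" and B: "B \<subseteq> all_vertices" and disj: "A \<inter> B = {}"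
    and none: "\<And>e. e \<in> edges \<Longrightarrow>
      \<not> (\<iota> e \<in> A \<and> \<tau> e \<in> B) \<and>
      \<not> (\<iota> e \<in> B \<and> \<tau> e \<in> A)"
    and csa: "csa_subgraph A" "csa_subgraph B"
  shows "csa_subgraph (A \<union> B) \<and>
    (malnormal_vertices A \<longrightarrow> malnormal_vertices B \<longrightarrow> malnormal_vertices (A \<union> B))"
proof -
  define Vs where "Vs s = (if s then A else B)" for s
  define T :: "unit monoid" where "T = \<lparr>carrier = {()}, monoid.mult = (\<lambda>_ _. ()), one = ()\<rparr>"
  define f where "f s c = \<one>\<^bsub>subgraph_group (Vs s)\<^esub>" for s and c :: unit
  have Vs: "Vs s \<subseteq> all_vertices" for s using A B by (simp add: Vs_def)
  have grp: "group (subgraph_group (Vs s))" for s using group_subgraph_group[OF Vs] .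
  have T: "group T" by (rule groupI) (auto simp: T_def)
  interpret subgraph_union \<G> Vs T f
  proof (intro subgraph_union.intro subgraph_union_axioms.intro)
    show "oriented_graph_of_groups \<G>" by (rule oriented_graph_of_groups_axioms)
    show "Vs s \<subseteq> all_vertices" for s by (rule Vs)
    show "Vs True \<inter> Vs False = {}" using disj by (simp add: Vs_def)
    show "group T" by (rule T)
    show "f s \<in> hom T (subgraph_group (Vs s))" for s
      using group.is_monoid[OF grp] by (intro homI) (simp_all add: f_def)
    show "inj_on (f s) (carrier T)" for s by (simp add: T_def)
    have "incl (Vs True \<union> Vs False) (f s c) = \<one>\<^bsub>subgraph_group (Vs True \<union> Vs False)\<^esub>" for s c
      unfolding f_def using Vs
      by (intro hom_one[OF incl_hom grp group_subgraph_group]) (cases s; auto)+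
    then show "incl (Vs True \<union> Vs False) (f True c) = incl (Vs True \<union> Vs False) (f False c)" for c by simp
    show "\<exists>c \<in> carrier T. f s c = letter (Vs s) (\<iota> e) g \<and>
        f (\<not> s) c = letter (Vs (\<not> s)) (\<tau> e) (edge_map \<G> e g)"
      if "e \<in> edges" "\<iota> e \<in> Vs s" "\<tau> e \<in> Vs (\<not> s)" for e s g
      using none[OF that(1)] that(2,3) by (cases s) (auto simp: Vs_def)
  qed
  have V: "Vs True \<union> Vs False = A \<union> B" by (simp add: Vs_def)
  have mal: "malnormal (f s ` carrier T) (subgraph_group (Vs s))" for s
    using malnormal_one[OF grp] by (simp add: T_def f_def)
  have "csa_subgraph (Vs s)" for s using csa by (simp add: Vs_def)
  then have "csa_subgraph (A \<union> B)" using csa_subgraph_union mal V by simp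
  moreover have "malnormal_vertices (A \<union> B)" if "malnormal_vertices A" "malnormal_vertices B"
  proof -
    have "malnormal_vertices (Vs s)" for s using that by (simp add: Vs_def)
    then show ?thesis using malnormal_vertices_union mal V by simp
  qed
  ultimately show ?thesis by blast
qed

lemma edge_union:
  assumes A: "A \<subseteq> all_vertices" and B: "B \<subseteq> all_vertices" and disj: "A \<inter> B = {}"
    and e: "e \<in> edges" "\<iota> e \<in> A" "\<tau> e \<in> B"
    and unique: "\<And>e'. e' \<in> edges \<Longrightarrow>
      \<iota> e' \<in> A \<and> \<tau> e' \<in> B \<or>
      \<iota> e' \<in> B \<and> \<tau> e' \<in> A \<Longrightarrow> e' = e"
    and csa: "csa_subgraph A" "csa_subgraph B"
    and mal: "malnormal (letter A (\<iota> e) ` edge_group \<G> e) (subgraph_group A)"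
  shows "csa_subgraph (A \<union> B) \<and>
    (malnormal_vertices A \<longrightarrow> malnormal_vertices B \<longrightarrow>
      malnormal (letter B (\<tau> e) ` edge_map \<G> e ` edge_group \<G> e) (subgraph_group B) \<longrightarrow>
      malnormal_vertices (A \<union> B))"
proof -
  let ?t = "\<iota> e" and ?h = "\<tau> e"
  define Vs where "Vs s = (if s then A else B)" for s
  define C where "C = (vertex_group \<G> ?t)\<lparr>carrier := edge_group \<G> e\<rparr>"
  define f where "f s = (if s then letter A ?t else letter B ?h \<circ> edge_map \<G> e)" for s
  have carC: "carrier C = edge_group \<G> e" by (simp add: C_def)
  have Vs: "Vs s \<subseteq> all_vertices" for s using A B by (simp add: Vs_def)
  have sub: "subgroup (edge_group \<G> e) (vertex_group \<G> ?t)" using edge_group[OF e(1)] .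
  have grp: "group (vertex_group \<G> ?t)" using vertex_group A e by blast
  have map: "edge_map \<G> e \<in> hom C (vertex_group \<G> ?h)" "inj_on (edge_map \<G> e) (carrier C)"
    using edge_map[OF e(1)] by (simp_all add: mon_def C_def)
  interpret subgraph_union \<G> Vs C f
  proof (intro subgraph_union.intro subgraph_union_axioms.intro)
    show "oriented_graph_of_groups \<G>" by (rule oriented_graph_of_groups_axioms)
    show "Vs s \<subseteq> all_vertices" for s by (rule Vs)
    show "Vs True \<inter> Vs False = {}" using disj by (simp add: Vs_def)
    show "group C" unfolding C_def using group.subgroup_imp_group[OF grp sub] .
    show "f s \<in> hom C (subgraph_group (Vs s))" for s
    proof (cases s)
      case True
      have "letter A ?t \<in> hom C (subgraph_group A)"
        using letter_hom[OF A e(2)] edge_closed(1)[OF e(1)] by (auto simp: hom_def C_def)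
      then show ?thesis using True by (simp add: f_def Vs_def)
    next
      case False
      then show ?thesis using hom_compose[OF map(1) letter_hom[OF B e(3)]] by (simp add: f_def Vs_def)
    qed
    show "inj_on (f s) (carrier C)" for s
    proof (cases s)
      case True
      have "edge_group \<G> e \<subseteq> carrier (vertex_group \<G> ?t)" using edge_closed(1)[OF e(1)] by blast
      then show ?thesis using True csa(1) e(2) by (auto simp: f_def carC csa_subgraph_def intro: inj_on_subset)
    next
      case False
      have "edge_map \<G> e ` carrier C \<subseteq> carrier (vertex_group \<G> ?h)"
        using edge_closed(2)[OF e(1)] by (auto simp: carC)
      then have "inj_on (letter B ?h) (edge_map \<G> e ` carrier C)"
        using csa(2) e(3) by (auto simp: csa_subgraph_def intro: inj_on_subset)
      then show ?thesis using False map(2) by (simp add: f_def comp_inj_on)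
    qed
    show "incl (Vs True \<union> Vs False) (f True c) = incl (Vs True \<union> Vs False) (f False c)"
      if "c \<in> carrier C" for c
    proof -
      have AB: "A \<union> B \<subseteq> all_vertices" "?t \<in> A \<union> B" "?h \<in> A \<union> B" using A B e by auto
      have c: "c \<in> edge_group \<G> e" using that by (simp add: carC)
      have "letter (A \<union> B) ?t c = letter (A \<union> B) ?h (edge_map \<G> e c)"
        using letter_edge[OF AB(1) e(1) AB(2,3) c] .
      then show ?thesis
        using incl_letter[of A "A \<union> B" ?t c] incl_letter[of B "A \<union> B" ?h "edge_map \<G> e c"]
          AB e edge_closed[OF e(1) c] by (simp add: f_def Vs_def)
    qed
    show "\<exists>c \<in> carrier C. f s c = letter (Vs s) (\<iota> e') g \<and>
        f (\<not> s) c = letter (Vs (\<not> s)) (\<tau> e') (edge_map \<G> e' g)"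
      if e': "e' \<in> edges" "\<iota> e' \<in> Vs s" "\<tau> e' \<in> Vs (\<not> s)"
        "g \<in> edge_group \<G> e'" for e' s g
    proof -
      have "e' = e" using unique[OF e'(1)] e'(2,3) by (cases s) (auto simp: Vs_def)
      moreover then have s using e'(2) e(2) disj by (auto simp: Vs_def split: if_splits)
      ultimately show ?thesis using e'(4) by (auto simp: f_def Vs_def carC)
    qed
  qed
  have V: "Vs True \<union> Vs False = A \<union> B" by (simp add: Vs_def)
  have "csa_subgraph (Vs s)" for s using csa by (simp add: Vs_def)
  moreover have malT: "malnormal (f True ` carrier C) (subgraph_group (Vs True))"
    using mal by (simp add: f_def Vs_def carC)
  ultimately have "csa_subgraph (A \<union> B)" using csa_subgraph_union V by simp
  moreover have "malnormal_vertices (A \<union> B)"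
    if "malnormal_vertices A" "malnormal_vertices B"
      and malF: "malnormal (letter B ?h ` edge_map \<G> e ` edge_group \<G> e) (subgraph_group B)"
  proof -
    have "malnormal_vertices (Vs s)" for s using that by (simp add: Vs_def)
    moreover have "malnormal (f s ` carrier C) (subgraph_group (Vs s))" for s
      using malT malF by (cases s) (simp_all add: f_def Vs_def carC image_comp)
    ultimately show ?thesis using malnormal_vertices_union V by simp
  qed
  ultimately show ?thesis by blast
qed

lemma csa_subgraph_empty: "csa_subgraph {}"
proof -
  interpret word_congruence "{}" "vertex_group \<G>" "rel {}" by (rule word_congruence_rel) simp
  have "X = \<one>\<^bsub>subgraph_group {}\<^esub>" if X: "X \<in> carrier (subgraph_group {})" for X
  proof -
    obtain u where u: "u \<in> words {}" "X = cls u" using X unfolding subgraph_group_def by (rule cls_cases)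
    then have "u = []" by (cases u) (auto simp: fp_words_def)
    then show ?thesis using u by (simp add: subgraph_group_def cls_one)
  qed
  then have "csa_law (subgraph_group {})" "involution_free (subgraph_group {})"
    unfolding csa_law_def involution_free_def by blast+
  then show ?thesis by (simp add: csa_subgraph_def)
qed

lemma csa_subgraph_singleton:
  assumes v: "v \<in> all_vertices" and csa: "csa_star_group (vertex_group \<G> v)"
    and no_loop: "\<And>e. e \<in> edges \<Longrightarrow> \<iota> e = v \<Longrightarrow> \<tau> e \<noteq> v"
  shows "csa_subgraph {v} \<and> malnormal_vertices {v}"
proof -
  let ?G = "vertex_group \<G> v" and ?W = "subgraph_group {v}"
  have sv: "{v} \<subseteq> all_vertices" using v by simp
  have hom: "letter {v} v \<in> hom ?G ?W" using letter_hom[OF sv] by simp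
  interpret G: group ?G using vertex_group v by blast
  interpret word_congruence "{v}" "vertex_group \<G>" "rel {v}" using sv by (rule word_congruence_rel)
  interpret W: group ?W using sv by (rule group_subgraph_group)
  have "(\<lambda>x. x) \<in> hom (vertex_group \<G> w) ?G" if "w \<in> {v}" for w using that by (simp add: hom_def)
  from subgraph_group_universal[OF sv G.is_group, of "\<lambda>_ x. x", OF this]
  obtain \<psi> where \<psi>: "\<psi> \<in> hom ?W ?G" "\<And>u. u \<in> words {v} \<Longrightarrow> \<psi> (rel {v} `` {u}) = word_eval ?G (\<lambda>_ x. x) u"
    using no_loop by blast
  have "\<psi> (letter {v} v x) = x" if "x \<in> carrier ?G" for x using \<psi>(2)[of "[(v, x)]"] that by simp
  then have inj: "inj_on (letter {v} v) (carrier ?G)" by (rule inj_on_inverseI)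
  have img: "rel {v} `` {u} \<in> letter {v} v ` carrier ?G" if "u \<in> words {v}" for u
    using that
  proof (induction u rule: fp_words_induct)
    case Nil
    have "letter {v} v \<one>\<^bsub>?G\<^esub> = rel {v} `` {[]}" using cls_cong[OF one] by simp
    from this[symmetric] show ?case by (rule rev_image_eqI[OF G.one_closed])
  next
    case (Cons w x u)
    then obtain y where y: "y \<in> carrier ?G" "rel {v} `` {u} = letter {v} v y" by blast
    have "rel {v} `` {(w, x) # u} = letter {v} v x \<otimes>\<^bsub>?W\<^esub> letter {v} v y"
      using cls_mult[of "[(v, x)]" u] Cons y by (simp add: subgraph_group_def)
    also have "\<dots> = letter {v} v (x \<otimes>\<^bsub>?G\<^esub> y)" using hom_mult[OF hom] Cons y by simp
    finally show ?case using Cons y G.m_closed by blast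
  qed
  have surj: "letter {v} v ` carrier ?G = carrier ?W"
  proof -
    have "X \<in> letter {v} v ` carrier ?G" if "X \<in> carrier ?W" for X
    proof -
      obtain u where "u \<in> words {v}" "X = cls u" using \<open>X \<in> carrier ?W\<close> unfolding subgraph_group_def by (rule cls_cases)
      then show ?thesis using img by blast
    qed
    then show ?thesis using hom_in_carrier[OF hom] by blast
  qed
  have law: "csa_law ?G" "involution_free ?G" using csa G.csa_star_group_iff by blast+
  have "csa_law ?W \<and> involution_free ?W"
    using csa_law_image[OF G.is_group W.is_group hom inj law] by (simp add: surj)
  moreover have "malnormal (carrier ?W) ?W"
    by (rule W.malnormalI[OF W.subgroup_self])
  ultimately show ?thesis using inj surj by (simp add: csa_subgraph_def malnormal_vertices_def)
qed

end

context oriented_graph_of_groups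
begin

text \<open>
At most one edge joins \<open>v\<close> and \<open>F\<close>. If it leaves \<open>v\<close>, its group is malnormal in the group of \<open>v\<close>, one
of the two factors of the amalgam; this is the first conclusion. If it enters \<open>v\<close>, the edge group has to
be malnormal in the group of \<open>F\<close>, which follows by transitivity if the vertex groups are malnormal there;
so the second conclusion maintains this property too.
\<close>

lemma add_vertex:
  assumes F: "F \<subseteq> all_vertices" and v: "v \<in> all_vertices" "v \<notin> F"
    and csa: "csa_star_group (vertex_group \<G> v)"
    and no_loop: "\<And>e. e \<in> edges \<Longrightarrow> \<iota> e \<noteq> \<tau> e"
    and unique: "\<And>e e'. e \<in> edges \<Longrightarrow> e' \<in> edges \<Longrightarrow>
      {\<iota> e, \<tau> e} \<subseteq> insert v F \<Longrightarrow>
      {\<iota> e', \<tau> e'} \<subseteq> insert v F \<Longrightarrow>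
      v \<in> {\<iota> e, \<tau> e} \<Longrightarrow>
      v \<in> {\<iota> e', \<tau> e'} \<Longrightarrow> e = e'"
    and mal: "\<And>e. e \<in> edges \<Longrightarrow> malnormal (edge_group \<G> e) (tail_group \<G> e)"
    and csa_F: "csa_subgraph F"
  shows "(\<forall>e \<in> edges. \<tau> e = v \<longrightarrow> \<iota> e \<notin> F) \<Longrightarrow>
      csa_subgraph (insert v F)"
    and "malnormal_vertices F \<Longrightarrow>
      (\<And>e. e \<in> edges \<Longrightarrow> malnormal (edge_map \<G> e ` edge_group \<G> e) (head_group \<G> e)) \<Longrightarrow>
      csa_subgraph (insert v F) \<and> malnormal_vertices (insert v F)"
proof -
  let ?t = "\<iota>" and ?h = "\<tau>" and ?E = "edges"
  have sv: "{v} \<subseteq> all_vertices" using v by simp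
  have csa_v: "csa_subgraph {v}" and mal_v: "malnormal_vertices {v}"
    using csa_subgraph_singleton[OF v(1) csa] no_loop by metis+
  have disj: "{v} \<inter> F = {}" "F \<inter> {v} = {}" using v by auto
  have un: "{v} \<union> F = insert v F" "F \<union> {v} = insert v F" by auto
  have mal_letter: "malnormal (letter A w ` M) (subgraph_group A)"
    if "A \<subseteq> all_vertices" "w \<in> A" "csa_subgraph A" "malnormal_vertices A"
      "malnormal M (vertex_group \<G> w)" for A w M
    using malnormal_letter_image[OF that(1-3)] that(2,4,5) by (simp add: malnormal_vertices_def)
  have none: "csa_subgraph (insert v F) \<and> (malnormal_vertices F \<longrightarrow> malnormal_vertices (insert v F))"
    if "\<And>e. e \<in> ?E \<Longrightarrow> \<not> (?t e = v \<and> ?h e \<in> F) \<and> \<not> (?t e \<in> F \<and> ?h e = v)"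
    using free_union[OF sv F disj(1) _ csa_v csa_F] that mal_v by (simp add: un)
  have out: "csa_subgraph (insert v F) \<and> (malnormal_vertices F \<longrightarrow>
      malnormal (edge_map \<G> e ` edge_group \<G> e) (head_group \<G> e) \<longrightarrow> malnormal_vertices (insert v F))"
    if e: "e \<in> ?E" "?t e = v" "?h e \<in> F" for e
  proof -
    have "?t e \<in> {v}" using e by simp
    moreover have "e' = e" if "e' \<in> ?E" "?t e' \<in> {v} \<and> ?h e' \<in> F \<or> ?t e' \<in> F \<and> ?h e' \<in> {v}" for e'
      using unique[OF that(1) e(1)] that(2) e(2,3) by auto
    moreover have "malnormal (letter {v} (?t e) ` edge_group \<G> e) (subgraph_group {v})"
      using mal_letter[OF sv _ csa_v mal_v mal[OF e(1)]] e(2) by simp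
    ultimately have "csa_subgraph ({v} \<union> F) \<and> (malnormal_vertices {v} \<longrightarrow> malnormal_vertices F \<longrightarrow>
        malnormal (letter F (?h e) ` edge_map \<G> e ` edge_group \<G> e) (subgraph_group F) \<longrightarrow>
        malnormal_vertices ({v} \<union> F))"
      using edge_union[OF sv F disj(1) e(1) _ e(3) _ csa_v csa_F] by blast
    then show ?thesis using mal_v mal_letter[OF F e(3) csa_F] by (simp add: un)
  qed
  show "csa_subgraph (insert v F)" if "\<forall>e \<in> ?E. ?h e = v \<longrightarrow> ?t e \<notin> F"
    using none out that by blast
  show "csa_subgraph (insert v F) \<and> malnormal_vertices (insert v F)"
    if mal_F: "malnormal_vertices F"
      and mal': "\<And>e. e \<in> ?E \<Longrightarrow> malnormal (edge_map \<G> e ` edge_group \<G> e) (head_group \<G> e)"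
  proof (cases "\<exists>e \<in> ?E. ?t e \<in> F \<and> ?h e = v")
    case False
    then show ?thesis using none out mal_F mal' by blast
  next
    case True
    then obtain e where e: "e \<in> ?E" "?t e \<in> F" "?h e = v" by blast
    have "?h e \<in> {v}" using e by simp
    moreover have "e' = e" if "e' \<in> ?E" "?t e' \<in> F \<and> ?h e' \<in> {v} \<or> ?t e' \<in> {v} \<and> ?h e' \<in> F" for e'
      using unique[OF that(1) e(1)] that(2) e(2,3) by auto
    moreover have "malnormal (letter F (?t e) ` edge_group \<G> e) (subgraph_group F)"
      using mal_letter[OF F e(2) csa_F mal_F mal[OF e(1)]] .
    moreover have "malnormal (letter {v} (?h e) ` edge_map \<G> e ` edge_group \<G> e) (subgraph_group {v})"
      using mal_letter[OF sv _ csa_v mal_v mal'[OF e(1)]] e(3) by simp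
    ultimately have "csa_subgraph (F \<union> {v}) \<and> malnormal_vertices (F \<union> {v})"
      using edge_union[OF F sv disj(2) e(1,2) _ _ csa_F csa_v] mal_F mal_v by blast
    then show ?thesis by (simp add: un)
  qed
qed

section \<open>Passing to finite subgraphs\<close>

text \<open>
The hypotheses of either law are finitely many relations between words, which hold over some finite
set of vertices. That \<open>a\<close> and \<open>y\<close> are nontrivial is inherited by the smaller set, where fewer relations
hold, and the conclusion drawn there is a relation that persists in \<open>V\<close>.
\<close>

lemma laws_if_finite_subgraphs:
  assumes V: "V \<subseteq> all_vertices"
    and fin: "\<And>F. finite F \<Longrightarrow> F \<subseteq> V \<Longrightarrow> csa_law (subgraph_group F) \<and> involution_free (subgraph_group F)"
  shows "csa_law (subgraph_group V) \<and> involution_free (subgraph_group V)"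
proof -
  interpret V: word_congruence V "vertex_group \<G>" "rel V" using V by (rule word_congruence_rel)
  have W: "subgraph_group V = V.W" by (simp add: subgraph_group_def)
  have "csa_law V.W"
    unfolding csa_law_def
  proof (intro ballI impI)
    fix A B X Y
    assume car: "A \<in> carrier V.W" "B \<in> carrier V.W" "X \<in> carrier V.W" "Y \<in> carrier V.W"
      and ne: "A \<noteq> \<one>\<^bsub>V.W\<^esub>" "Y \<noteq> \<one>\<^bsub>V.W\<^esub>"
      and eqs: "A \<otimes>\<^bsub>V.W\<^esub> Y = Y \<otimes>\<^bsub>V.W\<^esub> A" "X \<otimes>\<^bsub>V.W\<^esub> B = A \<otimes>\<^bsub>V.W\<^esub> X" "B \<otimes>\<^bsub>V.W\<^esub> Y = Y \<otimes>\<^bsub>V.W\<^esub> B"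
    obtain a where a: "a \<in> words V" "A = V.cls a" using car(1) by (rule V.cls_cases)
    obtain b where b: "b \<in> words V" "B = V.cls b" using car(2) by (rule V.cls_cases)
    obtain x where x: "x \<in> words V" "X = V.cls x" using car(3) by (rule V.cls_cases)
    obtain y where y: "y \<in> words V" "Y = V.cls y" using car(4) by (rule V.cls_cases)
    have r: "(a @ y, y @ a) \<in> rel V" "(x @ b, a @ x) \<in> rel V" "(b @ y, y @ b) \<in> rel V"
      using eqs a b x y by (simp_all add: V.cls_mult V.cls_eq_iff)
    obtain F1 where F1: "finite F1" "F1 \<subseteq> V" "(a @ y, y @ a) \<in> rel F1"
      using graph_rel_finite_support[OF r(1)] by blast
    obtain F2 where F2: "finite F2" "F2 \<subseteq> V" "(x @ b, a @ x) \<in> rel F2"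
      using graph_rel_finite_support[OF r(2)] by blast
    obtain F3 where F3: "finite F3" "F3 \<subseteq> V" "(b @ y, y @ b) \<in> rel F3"
      using graph_rel_finite_support[OF r(3)] by blast
    define F where "F = F1 \<union> F2 \<union> F3"
    have F: "finite F" "F \<subseteq> V" using F1 F2 F3 by (auto simp: F_def)
    have rF: "(a @ y, y @ a) \<in> rel F" "(x @ b, a @ x) \<in> rel F" "(b @ y, y @ b) \<in> rel F"
      using F1(3) F2(3) F3(3) graph_rel_mono[of F1 F \<G>] graph_rel_mono[of F2 F \<G>] graph_rel_mono[of F3 F \<G>]
      by (auto simp: F_def)
    have Fv: "F \<subseteq> all_vertices" using F V by blast
    interpret F: word_congruence F "vertex_group \<G>" "rel F" using Fv by (rule word_congruence_rel)
    have FV: "rel F \<subseteq> rel V" using F by (intro graph_rel_mono)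
    have w: "a \<in> words F" "b \<in> words F" "x \<in> words F" "y \<in> words F"
      using rel_words[OF rF(1) Fv] rel_words[OF rF(2) Fv] by simp_all
    have ne': "F.cls a \<noteq> \<one>\<^bsub>F.W\<^esub>" "F.cls y \<noteq> \<one>\<^bsub>F.W\<^esub>"
      using ne a y FV by (auto simp: F.cls_one V.cls_one F.cls_eq_iff V.cls_eq_iff w)
    have law: "csa_law F.W" using fin[OF F] by (simp add: subgraph_group_def)
    have "F.cls a \<otimes>\<^bsub>F.W\<^esub> F.cls y = F.cls y \<otimes>\<^bsub>F.W\<^esub> F.cls a"
      "F.cls x \<otimes>\<^bsub>F.W\<^esub> F.cls b = F.cls a \<otimes>\<^bsub>F.W\<^esub> F.cls x"
      "F.cls b \<otimes>\<^bsub>F.W\<^esub> F.cls y = F.cls y \<otimes>\<^bsub>F.W\<^esub> F.cls b"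
      using w rF[THEN F.cls_cong] by (simp_all add: F.cls_mult)
    then have "F.cls a \<otimes>\<^bsub>F.W\<^esub> F.cls x = F.cls x \<otimes>\<^bsub>F.W\<^esub> F.cls a"
      by (rule csa_lawD[OF law F.cls_closed[OF w(1)] F.cls_closed[OF w(2)] F.cls_closed[OF w(3)]
            F.cls_closed[OF w(4)] ne'])
    then have "(a @ x, x @ a) \<in> rel F" using w by (simp add: F.cls_mult F.cls_eq_iff)
    then show "A \<otimes>\<^bsub>V.W\<^esub> X = X \<otimes>\<^bsub>V.W\<^esub> A"
      using FV a x by (auto simp: V.cls_mult V.cls_eq_iff)
  qed
  moreover have "involution_free V.W"
    unfolding involution_free_def
  proof (intro ballI impI)
    fix X assume X: "X \<in> carrier V.W" "X \<otimes>\<^bsub>V.W\<^esub> X = \<one>\<^bsub>V.W\<^esub>"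
    obtain x where x: "x \<in> words V" "X = V.cls x" using X(1) by (rule V.cls_cases)
    then have xx: "(x @ x, []) \<in> rel V" using X(2) by (simp add: V.cls_mult V.cls_one V.cls_eq_iff)
    obtain F where F: "finite F" "F \<subseteq> V" "(x @ x, []) \<in> rel F"
      using graph_rel_finite_support[OF xx] by blast
    have Fv: "F \<subseteq> all_vertices" using F V by blast
    interpret F: word_congruence F "vertex_group \<G>" "rel F" using Fv by (rule word_congruence_rel)
    have w: "x \<in> words F" using rel_words[OF F(3) Fv] by simp
    have "involution_free F.W" using fin[OF F(1,2)] by (simp add: subgraph_group_def)
    moreover have "F.cls x \<otimes>\<^bsub>F.W\<^esub> F.cls x = \<one>\<^bsub>F.W\<^esub>" using F(3) w by (simp add: F.cls_mult F.cls_one F.cls_eq_iff)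
    ultimately have "F.cls x = \<one>\<^bsub>F.W\<^esub>" using F.cls_closed[OF w] unfolding involution_free_def by blast
    then have "(x, []) \<in> rel F" using w by (simp add: F.cls_one F.cls_eq_iff)
    then have "(x, []) \<in> rel V" using graph_rel_mono[OF F(2)] by blast
    then show "X = \<one>\<^bsub>V.W\<^esub>" using x by (simp add: V.cls_one V.cls_eq_iff)
  qed
  ultimately show ?thesis by (simp add: W)
qed

section \<open>The fundamental group as a group of words\<close>

lemma word_congruence_fp_rel:
  "word_congruence (all_vertices) (vertex_group \<G>) (fp_rel (all_vertices) (vertex_group \<G>))"
  (is "word_congruence ?V ?G ?R")
proof (rule word_congruence.intro)
  show grp: "group (vertex_group \<G> v)" if "v \<in> ?V" for v using that vertex_group by blast
  have words: "u \<in> words ?V \<and> w \<in> words ?V" if "(u, w) \<in> ?R" for u w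
    using that
  proof (induction rule: fp_rel.induct)
    case (mult u w v x y)
    then interpret group "vertex_group \<G> v" using vertex_group by blast
    show ?case using mult by simp
  next
    case (one u w v)
    then interpret group "vertex_group \<G> v" using vertex_group by blast
    show ?case using one by simp
  qed auto
  have in_context: "(p @ u @ q, p @ w @ q) \<in> ?R" if "(u, w) \<in> ?R" "p \<in> words ?V" "q \<in> words ?V" for u w p q
    using that
  proof (induction rule: fp_rel.induct)
    case (mult u w v x y)
    then show ?case using fp_rel.mult[of "p @ u" ?V ?G "w @ q" v x y] by simp
  next
    case (one u w v)
    then show ?case using fp_rel.one[of "p @ u" ?V ?G "w @ q" v] by simp
  next
    case (trans u v w) then show ?case by (blast intro: fp_rel.trans)
  next
    case (sym u w) then show ?case by (blast intro: fp_rel.sym)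
  next
    case (refl w) then show ?case by (intro fp_rel.refl) simp
  qed
  show "equiv (words ?V) ?R"
  proof (rule equivI)
    show "?R \<subseteq> words ?V \<times> words ?V" using words by auto
    show "refl_on (words ?V) ?R" by (rule refl_onI) (rule fp_rel.refl)
    show "Relation.sym ?R" by (rule symI) (rule fp_rel.sym)
    show "Relation.trans ?R" by (rule transI) (rule fp_rel.trans)
  qed
  show "(u @ w, u' @ w') \<in> ?R" if uw: "(u, u') \<in> ?R" "(w, w') \<in> ?R" for u u' w w'
  proof -
    have "(u @ w, u' @ w) \<in> ?R" using in_context[OF uw(1), of "[]" w] words[OF uw(2)] by simp
    moreover have "(u' @ w, u' @ w') \<in> ?R" using in_context[OF uw(2), of u' "[]"] words[OF uw(1)] by simp
    ultimately show ?thesis by (rule fp_rel.trans)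
  qed
  show "([(v, x), (v, y)], [(v, x \<otimes>\<^bsub>vertex_group \<G> v\<^esub> y)]) \<in> ?R"
    if "v \<in> ?V" "x \<in> carrier (vertex_group \<G> v)" "y \<in> carrier (vertex_group \<G> v)" for v x y
    using fp_rel.mult[of "[]" ?V ?G "[]" v x y] that by simp
  show "([(v, \<one>\<^bsub>vertex_group \<G> v\<^esub>)], []) \<in> ?R" if "v \<in> ?V" for v
    using fp_rel.one[of "[]" ?V ?G "[]" v] that by simp
qed

lemma fp_rel_subset_graph_rel:
  "fp_rel (all_vertices) (vertex_group \<G>) \<subseteq> rel (all_vertices)"
proof
  fix p assume "p \<in> fp_rel (all_vertices) (vertex_group \<G>)"
  then have "(fst p, snd p) \<in> fp_rel (all_vertices) (vertex_group \<G>)" by simp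
  then have "(fst p, snd p) \<in> rel (all_vertices)"
  proof (induction rule: fp_rel.induct)
    case (trans u v w) then show ?case by (blast intro: graph_rel.trans)
  qed (blast intro: graph_rel.intros)+
  then show "p \<in> rel (all_vertices)" by simp
qed

end

lemma normal_normal_closure:
  assumes "group G" "S \<subseteq> carrier G"
  shows "normal_closure G S \<lhd> G"
proof -
  interpret group G by fact
  let ?A = "{N. N \<lhd> G \<and> S \<subseteq> N}"
  have "carrier G \<lhd> G" unfolding normal_inv_iff using subgroup_self by auto
  then have ne: "?A \<noteq> {}" using assms by blast
  have "subgroup (normal_closure G S) G"
    unfolding normal_closure_def using ne by (intro subgroups_Inter) (auto simp: normal_inv_iff)
  moreover have "x \<otimes>\<^bsub>G\<^esub> h \<otimes>\<^bsub>G\<^esub> inv\<^bsub>G\<^esub> x \<in> normal_closure G S"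
    if "x \<in> carrier G" "h \<in> normal_closure G S" for x h
    using that unfolding normal_closure_def by (simp add: normal_inv_iff)
  ultimately show ?thesis by (simp add: normal_inv_iff)
qed

context oriented_graph_of_groups
begin

text \<open>
The map from the free product to the group of words is onto, and it kills the edge relators. Conversely,
the universal property of the group of words yields a map to the quotient by the relators, so
nothing more than their normal closure is killed.
\<close>

theorem fundamental_group_iso:
  "group (fundamental_group \<G>)"
  "\<exists>\<phi>. \<phi> \<in> iso (fundamental_group \<G>) (subgraph_group (all_vertices))"
proof -
  let ?V = "all_vertices" and ?P = "vertex_free_product \<G>"
  let ?R = "fp_rel ?V (vertex_group \<G>)" and ?W = "subgraph_group ?V"
  interpret R: word_congruence ?V "vertex_group \<G>" ?R by (rule word_congruence_fp_rel)
  interpret V: word_congruence ?V "vertex_group \<G>" "rel ?V" by (rule word_congruence_rel) simp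
  have P: "?P = R.W" by (simp add: vertex_free_product_def free_product_def word_group_def)
  interpret P: group ?P unfolding P by (rule R.group_W)
  interpret W: group ?W by (rule group_subgraph_group) simp
  have RV: "?R \<subseteq> rel ?V" by (rule fp_rel_subset_graph_rel)
  define h where "h X = rel ?V `` X" for X
  have h: "h (R.cls u) = V.cls u" if "u \<in> words ?V" for u
    unfolding h_def using RV that by (blast intro: graph_rel.trans fp_rel.refl)
  have h_hom: "h \<in> hom ?P ?W"
    unfolding P subgraph_group_def
  proof (rule homI)
    fix X Y assume "X \<in> carrier R.W" "Y \<in> carrier R.W"
    then obtain u v where uv: "u \<in> words ?V" "X = R.cls u" "v \<in> words ?V" "Y = R.cls v"
      by (metis R.cls_cases)
    then show "h X \<in> carrier V.W" using h V.cls_closed by simp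
    show "h (X \<otimes>\<^bsub>R.W\<^esub> Y) = h X \<otimes>\<^bsub>V.W\<^esub> h Y"
      using uv h by (simp add: R.cls_mult V.cls_mult)
  qed
  interpret h: group_hom ?P ?W h by (simp add: group_hom_def group_hom_axioms_def P.is_group W.is_group h_hom)
  have surj: "h ` carrier ?P = carrier ?W"
  proof
    show "h ` carrier ?P \<subseteq> carrier ?W" by auto
    show "carrier ?W \<subseteq> h ` carrier ?P"
    proof
      fix X assume "X \<in> carrier ?W"
      then obtain u where "u \<in> words ?V" "X = V.cls u" unfolding subgraph_group_def by (rule V.cls_cases)
      then show "X \<in> h ` carrier ?P" using h R.cls_closed unfolding P by (metis image_eqI)
    qed
  qed
  have inj: "vertex_inj \<G> v x = R.cls [(v, x)]" for v x by (simp add: vertex_inj_def fp_inj_def)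
  have inj_closed: "R.cls [(v, x)] \<in> carrier ?P" if "v \<in> ?V" "x \<in> carrier (vertex_group \<G> v)" for v x
    unfolding P using R.cls_closed that by simp
  define N where "N = normal_closure ?P (edge_relators \<G>)"
  interpret base: wf_digraph "base_graph \<G>" by (rule base_graph)
  have edge_verts: "\<iota> e \<in> ?V" "\<tau> e \<in> ?V"
    if "e \<in> edges" for e using that by auto
  have ends: "R.cls [(\<iota> e, g)] \<in> carrier ?P"
      "R.cls [(\<tau> e, edge_map \<G> e g)] \<in> carrier ?P"
    if "e \<in> edges" "g \<in> edge_group \<G> e" for e g
    using inj_closed edge_verts edge_closed that by blast+
  have rels: "edge_relators \<G> \<subseteq> carrier ?P"
    unfolding edge_relators_def inj using ends by auto
  interpret N: normal N ?P unfolding N_def by (rule normal_normal_closure[OF P.is_group rels])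
  interpret Q: group "?P Mod N" by (rule N.factorgroup_is_group)
  have fund: "fundamental_group \<G> = ?P Mod N" by (simp add: fundamental_group_def N_def)
  have q: "(\<lambda>X. N #>\<^bsub>?P\<^esub> X) \<in> hom ?P (?P Mod N)" by (rule N.r_coset_hom_Mod)
  have q_one: "N #>\<^bsub>?P\<^esub> X = \<one>\<^bsub>?P Mod N\<^esub>" if "X \<in> N" for X
    using P.coset_join2[OF _ N.subgroup_axioms that] N.mem_carrier[OF that] by (simp add: FactGroup_def)
  \<comment> \<open>Modulo \<open>N\<close> the edge relations hold, so the group of words maps back to the quotient.\<close>
  have "\<exists>\<psi> \<in> hom ?W (?P Mod N). \<forall>u \<in> words ?V.
      \<psi> (rel ?V `` {u}) = word_eval (?P Mod N) (\<lambda>v x. N #>\<^bsub>?P\<^esub> R.cls [(v, x)]) u"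
  proof (rule subgraph_group_universal)
    show "(\<lambda>x. N #>\<^bsub>?P\<^esub> R.cls [(v, x)]) \<in> hom (vertex_group \<G> v) (?P Mod N)" if "v \<in> ?V" for v
      using hom_compose[OF R.letter_hom[OF that, folded P] q] by (simp add: comp_def)
    fix e g assume e: "e \<in> edges" "g \<in> edge_group \<G> e"
    let ?a = "R.cls [(\<iota> e, g)]" and ?b = "R.cls [(\<tau> e, edge_map \<G> e g)]"
    have "?a \<otimes>\<^bsub>?P\<^esub> inv\<^bsub>?P\<^esub> ?b \<in> edge_relators \<G>" unfolding edge_relators_def inj using e by blast
    then have "?a \<otimes>\<^bsub>?P\<^esub> inv\<^bsub>?P\<^esub> ?b \<in> N" unfolding N_def normal_closure_def by blast
    then have "N #>\<^bsub>?P\<^esub> (?a \<otimes>\<^bsub>?P\<^esub> inv\<^bsub>?P\<^esub> ?b) = N" using q_one by (simp add: FactGroup_def)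
    then have "N #>\<^bsub>?P\<^esub> (?a \<otimes>\<^bsub>?P\<^esub> inv\<^bsub>?P\<^esub> ?b) #>\<^bsub>?P\<^esub> ?b = N #>\<^bsub>?P\<^esub> ?b" by simp
    then show "N #>\<^bsub>?P\<^esub> ?a = N #>\<^bsub>?P\<^esub> ?b"
      using ends[OF e] by (simp add: P.coset_mult_assoc[OF N.subset] P.m_assoc)
  qed (simp_all add: Q.is_group)
  then obtain \<psi> where \<psi>: "\<psi> \<in> hom ?W (?P Mod N)"
    "\<And>u. u \<in> words ?V \<Longrightarrow> \<psi> (V.cls u) = word_eval (?P Mod N) (\<lambda>v x. N #>\<^bsub>?P\<^esub> R.cls [(v, x)]) u" by blast
  have \<psi>h: "\<psi> (h X) = N #>\<^bsub>?P\<^esub> X" if "X \<in> carrier ?P" for X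
  proof -
    have "(\<psi> \<circ> h) X = N #>\<^bsub>?P\<^esub> X"
    proof (rule hom_eq_on_letters[OF word_congruence_fp_rel Q.is_group])
      show "\<psi> \<circ> h \<in> hom R.W (?P Mod N)" using hom_compose[OF h_hom \<psi>(1)] by (simp add: P)
      show "(\<lambda>X. N #>\<^bsub>?P\<^esub> X) \<in> hom R.W (?P Mod N)" using q by (simp add: P)
      show "X \<in> carrier R.W" using that by (simp add: P)
      fix v x assume v: "v \<in> ?V" "x \<in> carrier (vertex_group \<G> v)"
      then have w: "[(v, x)] \<in> words ?V" by simp
      have "N #>\<^bsub>?P\<^esub> R.cls [(v, x)] \<in> carrier (?P Mod N)"
        using hom_in_carrier[OF q inj_closed[OF v]] .
      then have "word_eval (?P Mod N) (\<lambda>v x. N #>\<^bsub>?P\<^esub> R.cls [(v, x)]) [(v, x)] = N #>\<^bsub>?P\<^esub> R.cls [(v, x)]"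
        unfolding word_eval_simps by (rule Q.r_one)
      then show "(\<psi> \<circ> h) (R.cls [(v, x)]) = N #>\<^bsub>?P\<^esub> R.cls [(v, x)]"
        using h[OF w] \<psi>(2)[OF w] by (simp only: comp_apply)
    qed
    then show ?thesis by simp
  qed
  have "kernel ?P ?W h = N"
  proof
    show "N \<subseteq> kernel ?P ?W h"
    proof -
      have "edge_relators \<G> \<subseteq> kernel ?P ?W h"
      proof
        fix X assume "X \<in> edge_relators \<G>"
        then obtain e g where e: "e \<in> edges" "g \<in> edge_group \<G> e"
          and X: "X = R.cls [(\<iota> e, g)] \<otimes>\<^bsub>?P\<^esub>
            inv\<^bsub>?P\<^esub> R.cls [(\<tau> e, edge_map \<G> e g)]"
          unfolding edge_relators_def inj by blast
        have "h (R.cls [(\<iota> e, g)]) = h (R.cls [(\<tau> e, edge_map \<G> e g)])"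
          using h letter_edge[OF _ e(1) edge_verts[OF e(1)] e(2)] edge_verts[OF e(1)] edge_closed[OF e] by simp
        then show "X \<in> kernel ?P ?W h" using ends[OF e] X by (simp add: kernel_def)
      qed
      then show ?thesis unfolding N_def normal_closure_def using h.normal_kernel by blast
    qed
    show "kernel ?P ?W h \<subseteq> N"
    proof
      fix X assume "X \<in> kernel ?P ?W h"
      then have X: "X \<in> carrier ?P" "h X = \<one>\<^bsub>?W\<^esub>" by (auto simp: kernel_def)
      have "N #>\<^bsub>?P\<^esub> X = \<one>\<^bsub>?P Mod N\<^esub>" using \<psi>h[OF X(1)] hom_one[OF \<psi>(1) W.is_group Q.is_group] X(2) by simp
      then have "N #>\<^bsub>?P\<^esub> X = N" by (simp add: FactGroup_def)
      then show "X \<in> N" using P.rcos_self[OF X(1) N.subgroup_axioms] by simp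
    qed
  qed
  then have "(\<lambda>X. the_elem (h ` X)) \<in> iso (?P Mod N) ?W" using h.FactGroup_iso_set[OF surj] by simp
  then show "\<exists>\<phi>. \<phi> \<in> iso (fundamental_group \<G>) ?W" unfolding fund by blast
  show "group (fundamental_group \<G>)" unfolding fund by (rule Q.is_group)
qed

theorem csa_star_if_finite_subgraphs:
  assumes "\<And>F. finite F \<Longrightarrow> F \<subseteq> all_vertices \<Longrightarrow> csa_subgraph F"
  shows "csa_star_group (fundamental_group \<G>)"
proof -
  interpret F: group "fundamental_group \<G>" by (rule fundamental_group_iso)
  let ?W = "subgraph_group (all_vertices)"
  obtain \<phi> where "\<phi> \<in> iso (fundamental_group \<G>) ?W" using fundamental_group_iso(2) by blast
  then have \<phi>: "\<phi> \<in> hom (fundamental_group \<G>) ?W" "inj_on \<phi> (carrier (fundamental_group \<G>))"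
    by (auto simp: iso_def bij_betw_def)
  have "csa_law ?W \<and> involution_free ?W"
  proof (rule laws_if_finite_subgraphs)
    fix F assume "finite F" "F \<subseteq> all_vertices"
    then show "csa_law (subgraph_group F) \<and> involution_free (subgraph_group F)"
      using assms unfolding csa_subgraph_def by blast
  qed simp
  then show ?thesis
    unfolding F.csa_star_group_iff
    using csa_law_involution_free_mono[OF F.is_group group_subgraph_group[OF subset_refl] \<phi>] by blast
qed

end

section \<open>Removing a vertex\<close>

lemma doubled_simps [simp]:
  "verts (doubled \<Gamma>) = verts \<Gamma>" "arcs (doubled \<Gamma>) = arcs \<Gamma> \<times> UNIV"
  "tail (doubled \<Gamma>) (e, b) = (if b then tail \<Gamma> e else head \<Gamma> e)"
  "head (doubled \<Gamma>) (e, b) = (if b then head \<Gamma> e else tail \<Gamma> e)"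
  by (simp_all add: doubled_def)

lemma forest_no_loop:
  assumes "wf_digraph \<Gamma>"
    and forest: "\<not> (\<exists>p. pre_digraph.cycle (doubled \<Gamma>) p \<and> distinct (map fst p))"
    and e: "e \<in> arcs \<Gamma>"
  shows "tail \<Gamma> e \<noteq> head \<Gamma> e"
proof
  assume loop: "tail \<Gamma> e = head \<Gamma> e"
  have "tail \<Gamma> e \<in> verts \<Gamma>" using assms(1) e by (rule wf_digraph.tail_in_verts)
  then have "pre_digraph.awalk (doubled \<Gamma>) (tail \<Gamma> e) [(e, True)] (tail \<Gamma> e)"
    using e loop by (simp add: pre_digraph.awalk_def pre_digraph.cas.simps)
  then have "pre_digraph.cycle (doubled \<Gamma>) [(e, True)]"
    unfolding pre_digraph.cycle_def by (intro exI[of _ "tail \<Gamma> e"]) (simp add: pre_digraph.awalk_verts.simps)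
  then show False using forest by (metis distinct_singleton list.simps(8,9))
qed

text \<open>
Otherwise an endless walk in \<open>F\<close> exists that never uses an arc twice in succession. It has to revisit a
vertex; up to the first repetition the vertices are distinct, and this makes the closing part a
circuit. In that part an arc can recur only in the opposite direction, hence in the very next step.
\<close>

lemma forest_has_leaf:
  assumes forest: "\<not> (\<exists>p. pre_digraph.cycle (doubled \<Gamma>) p \<and> distinct (map fst p))"
    and F: "finite F" "F \<noteq> {}" "F \<subseteq> verts \<Gamma>"
  shows "\<exists>v \<in> F. \<forall>e \<in> arcs \<Gamma>. \<forall>e' \<in> arcs \<Gamma>.
    {tail \<Gamma> e, head \<Gamma> e} \<subseteq> F \<longrightarrow> {tail \<Gamma> e', head \<Gamma> e'} \<subseteq> F \<longrightarrow>
    v \<in> {tail \<Gamma> e, head \<Gamma> e} \<longrightarrow> v \<in> {tail \<Gamma> e', head \<Gamma> e'} \<longrightarrow> e = e'"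
proof (rule ccontr)
  assume no_leaf: "\<not> ?thesis"
  let ?D = "doubled \<Gamma>"
  define A where "A = {d. fst d \<in> arcs \<Gamma> \<and> tail ?D d \<in> F \<and> head ?D d \<in> F}"
  have A_iff: "(e, b) \<in> A \<longleftrightarrow> e \<in> arcs \<Gamma> \<and> {tail \<Gamma> e, head \<Gamma> e} \<subseteq> F" for e b
    by (auto simp: A_def)
  have out: "\<exists>d \<in> A. tail ?D d = v \<and> fst d \<noteq> e0" if "v \<in> F" for v e0
  proof -
    have "\<not> (\<forall>e \<in> arcs \<Gamma>. \<forall>e' \<in> arcs \<Gamma>.
        {tail \<Gamma> e, head \<Gamma> e} \<subseteq> F \<longrightarrow> {tail \<Gamma> e', head \<Gamma> e'} \<subseteq> F \<longrightarrow>
        v \<in> {tail \<Gamma> e, head \<Gamma> e} \<longrightarrow> v \<in> {tail \<Gamma> e', head \<Gamma> e'} \<longrightarrow> e = e')"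
      by (rule notI, rule notE[OF no_leaf], rule bexI[OF _ that])
    then obtain e e' where ee: "e \<in> arcs \<Gamma>" "e' \<in> arcs \<Gamma>" "{tail \<Gamma> e, head \<Gamma> e} \<subseteq> F"
      "{tail \<Gamma> e', head \<Gamma> e'} \<subseteq> F" "v \<in> {tail \<Gamma> e, head \<Gamma> e}"
      "v \<in> {tail \<Gamma> e', head \<Gamma> e'}" "e \<noteq> e'"
      unfolding Ball_def not_all not_imp by (elim exE conjE) (rule that)
    obtain e1 where "e1 = e \<or> e1 = e'" "e1 \<noteq> e0" using ee(7) by (cases "e = e0") auto
    then have "e1 \<in> arcs \<Gamma>" "{tail \<Gamma> e1, head \<Gamma> e1} \<subseteq> F"
      "v \<in> {tail \<Gamma> e1, head \<Gamma> e1}" "e1 \<noteq> e0" using ee(1-6) by blast+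
    then show ?thesis by (intro bexI[of _ "(e1, v = tail \<Gamma> e1)"]) (auto simp: A_iff)
  qed
  \<comment> \<open>Without a leaf one can walk forever inside \<open>F\<close> and never turn back along the same arc.\<close>
  have "\<exists>f. \<forall>n. f n \<in> A \<and> tail ?D (f (Suc n)) = head ?D (f n) \<and> fst (f (Suc n)) \<noteq> fst (f n)"
  proof (rule dependent_nat_choice)
    show "\<exists>x. x \<in> A" using F(2) out by blast
    show "\<exists>y. y \<in> A \<and> tail ?D y = head ?D x \<and> fst y \<noteq> fst x" if "x \<in> A" for x n
    proof -
      have "head ?D x \<in> F" using that by (simp add: A_def)
      from out[OF this, of "fst x"] show ?thesis by blast
    qed
  qed
  then obtain f where f: "\<And>n. f n \<in> A" "\<And>n. tail ?D (f (Suc n)) = head ?D (f n)"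
    "\<And>n. fst (f (Suc n)) \<noteq> fst (f n)" by blast
  define g where "g n = tail ?D (f n)" for n
  have "range g \<subseteq> F" using f(1) by (auto simp: g_def A_def)
  then have "finite (range g)" using F(1) by (rule finite_subset)
  then have "\<not> inj g" using finite_imageD infinite_UNIV_nat by blast
  then have ex: "\<exists>j i. i < j \<and> g i = g j" unfolding inj_on_def by (metis linorder_neqE_nat)
  define j where "j = (LEAST j. \<exists>i. i < j \<and> g i = g j)"
  have "\<exists>i. i < j \<and> g i = g j" unfolding j_def using ex by (rule LeastI_ex)
  then obtain i where ij: "i < j" "g i = g j" by blast
  have g_inj: "a = b" if "g a = g b" "a < j" "b < j" for a b
    using not_less_Least[of _ "\<lambda>j. \<exists>i. i < j \<and> g i = g j", folded j_def] that
    by (metis linorder_neqE_nat)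
  let ?p = "map f [i..<j]"
  have cas: "pre_digraph.cas ?D (g a) (map f [a..<b]) (g b)" if "a \<le> b" for a b
    using that
  proof (induction "b - a" arbitrary: a)
    case 0 then show ?case by (simp add: pre_digraph.cas.simps)
  next
    case (Suc n)
    then have "a < b" by simp
    then have "map f [a..<b] = f a # map f [Suc a..<b]" by (simp add: upt_conv_Cons)
    moreover have "pre_digraph.cas ?D (g (Suc a)) (map f [Suc a..<b]) (g b)" using Suc \<open>a < b\<close> by simp
    ultimately show ?case using f(2) by (simp add: pre_digraph.cas.simps g_def)
  qed
  have p: "?p \<noteq> []" using ij by simp
  have "pre_digraph.awalk ?D (g i) ?p (g i)"
    unfolding pre_digraph.awalk_def
  proof (intro conjI)
    show "g i \<in> verts ?D" using \<open>range g \<subseteq> F\<close> F(3) by auto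
    have "f n \<in> arcs ?D" for n using f(1)[of n] by (cases "f n") (simp add: A_iff)
    then have "f ` {i..<j} \<subseteq> arcs ?D" by blast
    then show "set ?p \<subseteq> arcs ?D" by (simp only: set_map set_upt)
    show "pre_digraph.cas ?D (g i) ?p (g i)" using cas[of i j] ij by simp
  qed
  moreover have "distinct (tl (pre_digraph.awalk_verts ?D (g i) ?p))"
  proof -
    have "pre_digraph.awalk_verts ?D (g i) ?p = tail ?D (hd ?p) # map (head ?D) ?p"
      using pre_digraph.awalk_verts_conv'[of ?D "g i" ?p "g i"] cas[of i j] ij p by simp
    then have "tl (pre_digraph.awalk_verts ?D (g i) ?p) = map (\<lambda>n. g (Suc n)) [i..<j]"
      using f(2) by (simp add: g_def)
    moreover have "inj_on (\<lambda>n. g (Suc n)) {i..<j}"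
    proof (rule linorder_inj_onI)
      fix a b assume ab: "a < b" "a \<in> {i..<j}" "b \<in> {i..<j}"
      show "g (Suc a) \<noteq> g (Suc b)"
      proof (cases "Suc b = j")
        case True
        then show ?thesis using g_inj[of "Suc a" i] ab ij by auto
      next
        case False
        then show ?thesis using g_inj[of "Suc a" "Suc b"] ab by auto
      qed
    qed auto
    ultimately show ?thesis by (simp add: distinct_map)
  qed
  ultimately have "pre_digraph.cycle ?D ?p" unfolding pre_digraph.cycle_def using p by blast
  moreover have "distinct (map fst ?p)"
  proof -
    have "inj_on (\<lambda>n. fst (f n)) {i..<j}"
    proof (rule linorder_inj_onI)
      fix a b assume ab: "a < b" "a \<in> {i..<j}" "b \<in> {i..<j}"
      show "fst (f a) \<noteq> fst (f b)"
      proof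
        assume eq: "fst (f a) = fst (f b)"
        have "g a \<noteq> g b" using g_inj[of a b] ab by auto
        then have "g b = head ?D (f a)"
          using eq by (cases "f a"; cases "f b") (auto simp: g_def split: if_splits)
        then have "g b = g (Suc a)" using f(2) by (simp add: g_def)
        then have "b = Suc a" using g_inj[of b "Suc a"] ab by auto
        then show False using f(3)[of a] eq by simp
      qed
    qed auto
    then show ?thesis by (simp add: distinct_map comp_def)
  qed
  ultimately show False using forest by blast
qed

lemma ordinal_graph_arcs:
  assumes r: "Well_order r" and e: "e \<in> arcs (ordinal_graph r \<alpha>)"
  shows "(fst e, snd e) \<in> r" "fst e \<noteq> snd e" "snd e = wo_rel.suc r {fst e}"
proof -
  interpret wo_rel r using r by (simp add: wo_rel_def)
  obtain \<beta> where b: "\<beta> \<in> Order_Relation.underS r \<alpha>" "e = (\<beta>, suc {\<beta>})"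
    using e by (auto simp: ordinal_graph_def)
  have ba: "(\<beta>, \<alpha>) \<in> r" "\<beta> \<noteq> \<alpha>" using b(1) by (auto simp: Order_Relation.underS_def)
  then have "\<alpha> \<in> AboveS {\<beta>}" by (auto simp: AboveS_def Field_def)
  then have "suc {\<beta>} \<noteq> \<beta> \<and> (\<beta>, suc {\<beta>}) \<in> r"
    using ba by (intro suc_greater) (auto simp: Field_def)
  then show "(fst e, snd e) \<in> r" "fst e \<noteq> snd e" "snd e = suc {fst e}" using b(2) by auto
qed

text \<open>
Arcs lead upwards, so the least vertex of a finite set has no incoming arc there, and it has at most
one outgoing arc because the successor is determined.
\<close>

theorem ordinal_graph_csa_star:
  fixes \<G> :: "('o, 'o \<times> 'o, 'g) graph_of_groups"
  assumes r: "Well_order r" and G: "oriented_graph_of_groups \<G>" and base: "base_graph \<G> = ordinal_graph r \<alpha>"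
    and csa: "\<And>\<beta>. \<beta> \<in> verts (base_graph \<G>) \<Longrightarrow> csa_star_group (vertex_group \<G> \<beta>)"
    and mal: "quasi_malnormal \<G>"
  shows "csa_star_group (fundamental_group \<G>)"
proof -
  interpret oriented_graph_of_groups \<G> by (rule G)
  interpret wo_rel r using r by (simp add: wo_rel_def)
  have ends: "tail (base_graph \<G>) = fst" "head (base_graph \<G>) = snd" by (simp_all add: base ordinal_graph_def)
  have verts: "verts (base_graph \<G>) \<subseteq> Field r" by (auto simp: base ordinal_graph_def Field_def)
  have arc: "(fst e, snd e) \<in> r" "fst e \<noteq> snd e" "snd e = suc {fst e}" if "e \<in> arcs (base_graph \<G>)" for e
    using ordinal_graph_arcs[OF r] that by (auto simp: base)
  show ?thesis
  proof (rule csa_star_if_finite_subgraphs)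
    fix F assume "finite F" "F \<subseteq> verts (base_graph \<G>)"
    then show "csa_subgraph F"
    proof (induction F rule: finite_psubset_induct)
      case (psubset F)
      show ?case
      proof (cases "F = {}")
        case True then show ?thesis by (simp add: csa_subgraph_empty)
      next
        case False
        define m where "m = minim F"
        have FF: "F \<subseteq> Field r" using psubset.prems verts by blast
        have m: "m \<in> F" "\<And>x. x \<in> F \<Longrightarrow> (m, x) \<in> r"
          using minim_in[OF FF False] minim_least[OF FF] by (simp_all add: m_def)
        have starts: "fst e = m" if "e \<in> arcs (base_graph \<G>)" "fst e \<in> F" "m \<in> {fst e, snd e}" for e
          using arc[OF that(1)] m(2)[OF that(2)] that(3) antisymD[OF ANTISYM] by auto
        have "csa_subgraph (insert m (F - {m}))"
        proof (rule add_vertex(1))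
          show "F - {m} \<subseteq> verts (base_graph \<G>)" "m \<in> verts (base_graph \<G>)" "m \<notin> F - {m}"
            using psubset.prems m by auto
          then show "csa_star_group (vertex_group \<G> m)" using csa by blast
          show "csa_subgraph (F - {m})" using psubset.IH[of "F - {m}"] psubset.prems m by blast
          show "tail (base_graph \<G>) e \<noteq> head (base_graph \<G>) e" if "e \<in> arcs (base_graph \<G>)" for e
            using arc[OF that] by (simp add: ends)
          show "malnormal (edge_group \<G> e) (tail_group \<G> e)" if "e \<in> arcs (base_graph \<G>)" for e
            using mal that by (simp add: quasi_malnormal_def)
          show "\<forall>e \<in> arcs (base_graph \<G>). head (base_graph \<G>) e = m \<longrightarrow> tail (base_graph \<G>) e \<notin> F - {m}"
            using starts by (auto simp: ends)
          fix e e' assume e: "e \<in> arcs (base_graph \<G>)" "e' \<in> arcs (base_graph \<G>)"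
            "{tail (base_graph \<G>) e, head (base_graph \<G>) e} \<subseteq> insert m (F - {m})"
            "{tail (base_graph \<G>) e', head (base_graph \<G>) e'} \<subseteq> insert m (F - {m})"
            "m \<in> {tail (base_graph \<G>) e, head (base_graph \<G>) e}"
            "m \<in> {tail (base_graph \<G>) e', head (base_graph \<G>) e'}"
          have "fst e \<in> F" "fst e' \<in> F" using e(3,4) m(1) by (auto simp: ends)
          moreover have "m \<in> {fst e, snd e}" "m \<in> {fst e', snd e'}" using e(5,6) by (simp_all add: ends)
          ultimately have "fst e = m" "fst e' = m" using starts[OF e(1)] starts[OF e(2)] by blast+
          then show "e = e'" using arc(3)[OF e(1)] arc(3)[OF e(2)] by (simp add: prod_eq_iff)
        qed
        then show ?thesis using m(1) by (simp add: insert_absorb)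
      qed
    qed
  qed
qed

text \<open>
Every finite set of vertices spans a forest, and a forest can be taken apart leaf by leaf.
\<close>

theorem oriented_tree_csa_star:
  assumes G: "oriented_graph_of_groups \<G>" and tree: "oriented_tree (base_graph \<G>)"
    and csa: "\<And>v. v \<in> verts (base_graph \<G>) \<Longrightarrow> csa_star_group (vertex_group \<G> v)"
    and mal: "malnormal_graph_of_groups \<G>"
  shows "csa_star_group (fundamental_group \<G>)"
proof -
  interpret oriented_graph_of_groups \<G> by (rule G)
  have forest: "\<not> (\<exists>p. pre_digraph.cycle (doubled (base_graph \<G>)) p \<and> distinct (map fst p))"
    and wf: "wf_digraph (base_graph \<G>)"
    using tree by (simp_all add: oriented_tree_def)
  have "csa_subgraph F \<and> malnormal_vertices F" if "finite F" "F \<subseteq> verts (base_graph \<G>)" for F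
    using that
  proof (induction F rule: finite_psubset_induct)
    case (psubset F)
    show ?case
    proof (cases "F = {}")
      case True then show ?thesis by (simp add: csa_subgraph_empty malnormal_vertices_def)
    next
      case False
      obtain v where v: "v \<in> F" and leaf: "\<forall>e \<in> arcs (base_graph \<G>). \<forall>e' \<in> arcs (base_graph \<G>).
          {tail (base_graph \<G>) e, head (base_graph \<G>) e} \<subseteq> F \<longrightarrow>
          {tail (base_graph \<G>) e', head (base_graph \<G>) e'} \<subseteq> F \<longrightarrow>
          v \<in> {tail (base_graph \<G>) e, head (base_graph \<G>) e} \<longrightarrow>
          v \<in> {tail (base_graph \<G>) e', head (base_graph \<G>) e'} \<longrightarrow> e = e'"
        using forest_has_leaf[OF forest psubset.hyps False psubset.prems] by blast
      have F: "insert v (F - {v}) = F" using v by blast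
      have "csa_subgraph (insert v (F - {v})) \<and> malnormal_vertices (insert v (F - {v}))"
      proof (rule add_vertex(2))
        show "F - {v} \<subseteq> verts (base_graph \<G>)" "v \<in> verts (base_graph \<G>)" "v \<notin> F - {v}"
          using psubset.prems v by auto
        then show "csa_star_group (vertex_group \<G> v)" using csa by blast
        show "csa_subgraph (F - {v})" "malnormal_vertices (F - {v})"
          using psubset.IH[of "F - {v}"] psubset.prems v by blast+
        show "tail (base_graph \<G>) e \<noteq> head (base_graph \<G>) e" if "e \<in> arcs (base_graph \<G>)" for e
          using forest_no_loop[OF wf forest that] .
        show "malnormal (edge_group \<G> e) (tail_group \<G> e)"
          "malnormal (edge_map \<G> e ` edge_group \<G> e) (head_group \<G> e)"
          if "e \<in> arcs (base_graph \<G>)" for e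
          using mal that by (simp_all add: malnormal_graph_of_groups_def quasi_malnormal_def)
      qed (use leaf in \<open>unfold F, blast\<close>)
      then show ?thesis unfolding F .
    qed
  qed
  then show ?thesis using csa_star_if_finite_subgraphs by blast
qed

theorem theorem3:
  fixes r :: "'o rel" and \<alpha> :: 'o
    and \<G> :: "('o, 'o \<times> 'o, 'g) graph_of_groups"
    and \<H> :: "('v, 'e, 'h) graph_of_groups"
  shows "(Well_order r \<and> \<alpha> \<in> Field r \<and>
          oriented_graph_of_groups \<G> \<and> base_graph \<G> = ordinal_graph r \<alpha> \<and>
          (\<forall>\<beta> \<in> verts (base_graph \<G>). csa_star_group (vertex_group \<G> \<beta>)) \<and>
          quasi_malnormal \<G>
          \<longrightarrow> csa_star_group (fundamental_group \<G>))
       \<and> (oriented_graph_of_groups \<H> \<and> oriented_tree (base_graph \<H>) \<and>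
          (\<forall>v \<in> verts (base_graph \<H>). csa_star_group (vertex_group \<H> v)) \<and>
          malnormal_graph_of_groups \<H>
          \<longrightarrow> csa_star_group (fundamental_group \<H>))"
  using ordinal_graph_csa_star[of r \<G> \<alpha>] oriented_tree_csa_star[of \<H>] by blast

end
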